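(* Let $S\in\mathbb{R}^{m\times n}$ be an SRHT, $\delta\in(0,1)$ and $\rho>0$. Then $\mathbb{P}\big(\|C_S-I_d\|_2\leqslant\max\{\sqrt\rho,\rho\}\big)\geqslant1-\delta$ provided that $m\geqslant m_\delta/\rho$, where $$m_\delta=16\,\log(16d_e/\delta)\,\big(\sqrt{d_e}+\sqrt{8\log(2n/\delta)}\big)^2 .$$
   Context: Let $A\in\mathbb{R}^{n\times d}$, $A\neq0$, with $n\geqslant d$ and $n$ a power of $2$, $\Lambda\in\mathbb{R}^{d\times d}$ diagonal with $\Lambda\succeq I_d$, and $\nu>0$. Set $H=A^\top A+\nu^2\Lambda$; for $S\in\mathbb{R}^{m\times n}$ set $H_S=A^\top S^\top SA+\nu^2\Lambda$ and $C_S=H^{-1/2}H_SH^{-1/2}$. Let $A(A^\top A+\nu^2\Lambda)^{-1/2}=UDV^\top$ be a thin SVD ($U\in\mathbb{R}^{n\times d}$, $V\in\mathbb{R}^{d\times d}$ with orthonormal columns, $D$ diagonal nonnegative), and let the effective dimension be $d_e=\|D\|_F^2/\|D\|_2^2$. An SRHT is $S=\sqrt{n/m}\,R\,W\,E$, where $R\in\mathbb{R}^{m\times n}$ selects $m$ rows uniformly at random without replacement, $W\in\mathbb{R}^{n\times n}$ is the orthonormal (normalized) Walsh–Hadamard matrix, and $E$ is diagonal with independent Rademacher ($\pm1$) entries. *)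

theory Defs
  imports "Jordan_Normal_Form.Matrix" "HOL-Probability.Probability_Mass_Function"
begin

definition vnorm :: "real Matrix.vec \<Rightarrow> real" where
  "vnorm x = sqrt (x \<bullet> x)"

definition spec_norm :: "real mat \<Rightarrow> real" where
  "spec_norm M = Sup {vnorm (M *\<^sub>v x) | x. x \<in> carrier_vec (dim_col M) \<and> vnorm x \<le> 1}"

definition frob_norm :: "real mat \<Rightarrow> real" where
  "frob_norm M = sqrt (\<Sum>i<dim_row M. \<Sum>j<dim_col M. (M $$ (i,j))\<^sup>2)"

definition psd :: "real mat \<Rightarrow> bool" where
  "psd M \<longleftrightarrow> M \<in> carrier_mat (dim_row M) (dim_row M) \<and> transpose_mat M = M \<and>
     (\<forall>x \<in> carrier_vec (dim_row M). x \<bullet> (M *\<^sub>v x) \<ge> 0)"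

definition inv_sqrt_mat :: "real mat \<Rightarrow> real mat" where
  "inv_sqrt_mat H = (THE B. B \<in> carrier_mat (dim_row H) (dim_row H) \<and> psd B \<and>
                           B * B * H = 1\<^sub>m (dim_row H))"

text \<open>Orthonormal (normalized) Walsh--Hadamard matrix of size n (n a power of 2):
  entries (-1)^(popcount (i AND j)) / sqrt n (Sylvester ordering).\<close>
definition hadamard_mat :: "nat \<Rightarrow> real mat" where
  "hadamard_mat n = Matrix.mat n n (\<lambda>(i,j). (-1) ^ card {k. bit i k \<and> bit j k} / sqrt (real n))"

definition select_mat :: "nat \<Rightarrow> nat \<Rightarrow> nat list \<Rightarrow> real mat" where
  "select_mat m n rs = Matrix.mat m n (\<lambda>(i,j). if rs ! i = j then 1 else 0)"

definition sign_mat :: "nat \<Rightarrow> real list \<Rightarrow> real mat" where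
  "sign_mat n es = Matrix.mat n n (\<lambda>(i,j). if i = j then es ! i else 0)"

definition sign_vectors :: "nat \<Rightarrow> real list set" where
  "sign_vectors n = {es. length es = n \<and> set es \<subseteq> {-1, 1}}"

definition row_samples :: "nat \<Rightarrow> nat \<Rightarrow> nat list set" where
  "row_samples m n = {rs. length rs = m \<and> distinct rs \<and> set rs \<subseteq> {..<n}}"

definition srht_space :: "nat \<Rightarrow> nat \<Rightarrow> (real list \<times> nat list) pmf" where
  "srht_space m n = pmf_of_set (sign_vectors n \<times> row_samples m n)"

definition srht :: "nat \<Rightarrow> nat \<Rightarrow> real list \<times> nat list \<Rightarrow> real mat" where
  "srht m n \<omega> = sqrt (real n / real m) \<cdot>\<^sub>m
      (select_mat m n (snd \<omega>) * hadamard_mat n * sign_mat n (fst \<omega>))"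

end

theory Submission
  imports Defs "Jordan_Normal_Form.Determinant"
begin

text \<open>
  Put \<open>Z = A H\<^sup>-\<^sup>1\<^sup>/\<^sup>2\<close>. Then \<open>C\<^sub>S - I = Z\<^sup>T S\<^sup>T S Z - Z\<^sup>T Z\<close>, which is \<open>1/m\<close> times the centred sum of \<open>m\<close> rank-one
  matrices \<open>x\<^sub>r x\<^sub>r\<^sup>T\<close> drawn without replacement, \<open>x\<^sub>r\<close> being the rows of \<open>\<surd>n W E Z\<close>. Two exponential moments are
  controlled by a differential inequality, and no matrix exponential is needed.

  Row norms: for \<open>f = |\<Sum>\<^sub>j \<epsilon>\<^sub>j w\<^sub>j|\<^sup>2\<close>, pairing \<open>\<epsilon>\<close> with the vector whose \<open>j\<close>-th sign is flipped bounds the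
  derivative of \<open>E exp (\<mu> f)\<close> and gives, with \<open>s = \<parallel>Z\<parallel>\<^sub>2\<close>, \<open>P(f > s\<^sup>2 (\<surd>d\<^sub>e + \<tau>)\<^sup>2) \<le> exp (- \<tau>\<^sup>2 / 2)\<close>.

  Sampling: with \<open>Y\<close> the centred sum, consider \<open>\<Phi>(\<theta>) = E tr (cosh (\<theta> Y) - I)\<close>; subtracting \<open>I\<close> is what lets
  \<open>d\<^sub>e\<close> replace \<open>d\<close>. Since \<open>n Y\<close> is the sum of \<open>x\<^sub>r x\<^sub>r\<^sup>T - x\<^sub>j x\<^sub>j\<^sup>T\<close> over sampled \<open>r\<close> and unsampled \<open>j\<close>,
  exchanging \<open>r\<close> and \<open>j\<close> (an involution on samples) turns \<open>\<Phi>'\<close> into differences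
  \<open>tr ((Y - Y') (sinh (\<theta> Y) - sinh (\<theta> Y')))\<close>, which a mean value inequality in the two eigenbases bounds
  by \<open>\<theta>/2 tr ((Y - Y')\<^sup>2 (cosh (\<theta> Y) + cosh (\<theta> Y')))\<close>.
\<close>

subsection \<open>Spectral theorem for real symmetric matrices\<close>

text \<open>The sampled rows are dependent and the summands do not commute, so the usual product
  structure of exponential moments is missing. Exchanges replace it: trading one sampled row for an
  unsampled one changes \<open>Y\<close> by a matrix of rank at most two, and only traces at two
  neighbouring samples are compared. Flipping a sign plays the same role for the row norms. In both
  cases the derivative is bounded by a multiple of itself plus a multiple of the function. Moving
  the first part to the left creates the denominators \<open>1 - \<theta> * B\<close> and
  \<open>1 - 2 * \<mu> * L2\<close>, hence the restrictions on \<open>\<theta>\<close> and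
  \<open>\<mu>\<close>. \<open>cosh\<close> treats both ends of the spectrum at once. Since
  \<open>cosh - 1\<close> is nonnegative and vanishes at 0, the sampling moment starts at 0, and
  size enters only through the trace of the Gram matrix. Probabilities are kept as counts over
  finite sets. Signs are fixed first, and signs and sampling get \<open>\<delta> / 2\<close> each.
  On good signs the squared row bound is \<open>B = s2 * \<beta>\<close>, with
  \<open>\<beta>\<close> the squared bracket of the sample size. The factor \<open>s2\<close>
  cancels from the moment exponent once \<open>\<theta>\<close> is scaled by
  \<open>1 / (s2 * \<beta>)\<close>, and \<open>s2 \<le> 1\<close> takes care of the
  threshold.\<close>

text \<open>Vectors and matrices are functions on all of \<open>nat\<close>; only indices below \<open>d\<close> matter.\<close>

definition ip :: "nat \<Rightarrow> (nat \<Rightarrow> real) \<Rightarrow> (nat \<Rightarrow> real) \<Rightarrow> real" where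
  "ip d x y = (\<Sum>i<d. x i * y i)"

definition mv :: "nat \<Rightarrow> (nat \<Rightarrow> nat \<Rightarrow> real) \<Rightarrow> (nat \<Rightarrow> real) \<Rightarrow> nat \<Rightarrow> real" where
  "mv d M x = (\<lambda>i. \<Sum>j<d. M i j * x j)"

definition orthonormal :: "nat \<Rightarrow> nat \<Rightarrow> (nat \<Rightarrow> nat \<Rightarrow> real) \<Rightarrow> bool" where
  "orthonormal d k v \<longleftrightarrow> (\<forall>i<k. \<forall>j<k. ip d (v i) (v j) = (if i = j then 1 else 0))"

definition eigenbasis ::
    "nat \<Rightarrow> (nat \<Rightarrow> nat \<Rightarrow> real) \<Rightarrow> (nat \<Rightarrow> real) \<Rightarrow> (nat \<Rightarrow> nat \<Rightarrow> real) \<Rightarrow> bool" where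
  "eigenbasis d M lam v \<longleftrightarrow>
     orthonormal d d v \<and> (\<forall>k<d. \<forall>i<d. mv d M (v k) i = lam k * v k i)"

lemma ip_commute: "ip d x y = ip d y x"
  by (simp add: ip_def mult.commute)

lemma ip_self_nonneg: "0 \<le> ip d x x"
  by (simp add: ip_def sum_nonneg)

lemma ip_eq_0_iff: "ip d x x = 0 \<longleftrightarrow> (\<forall>i<d. x i = 0)"
  by (auto simp: ip_def sum_nonneg_eq_0_iff)

lemma ip_cong: "(\<And>i. i < d \<Longrightarrow> x i = x' i) \<Longrightarrow> (\<And>i. i < d \<Longrightarrow> y i = y' i) \<Longrightarrow> ip d x y = ip d x' y'"
  by (simp add: ip_def)

lemma ip_add_left: "ip d (\<lambda>i. x i + y i) z = ip d x z + ip d y z"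
  and ip_diff_left: "ip d (\<lambda>i. x i - y i) z = ip d x z - ip d y z"
  and ip_scale_left: "ip d (\<lambda>i. c * x i) z = c * ip d x z"
  and ip_add_right: "ip d z (\<lambda>i. x i + y i) = ip d z x + ip d z y"
  and ip_diff_right: "ip d z (\<lambda>i. x i - y i) = ip d z x - ip d z y"
  and ip_scale_right: "ip d z (\<lambda>i. c * x i) = c * ip d z x"
  by (simp_all add: ip_def algebra_simps sum.distrib sum_subtractf sum_distrib_left)

lemmas ip_bilinear = ip_add_left ip_diff_left ip_scale_left ip_add_right ip_diff_right ip_scale_right

lemma ip_unit_left: "i < d \<Longrightarrow> ip d (\<lambda>l. if l = i then 1 else 0) x = x i"
  by (simp add: ip_def if_distrib if_distribR cong: if_cong)

lemma ip_sum_left: "ip d (\<lambda>i. \<Sum>k\<in>S. f k i) z = (\<Sum>k\<in>S. ip d (f k) z)"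
  unfolding ip_def by (simp add: sum_distrib_right) (rule sum.swap)

lemma ip_sum_right: "ip d z (\<lambda>i. \<Sum>k\<in>S. f k i) = (\<Sum>k\<in>S. ip d z (f k))"
  by (simp add: ip_commute[of d z] ip_sum_left)

lemma mv_add: "mv d M (\<lambda>i. x i + y i) = (\<lambda>i. mv d M x i + mv d M y i)"
  and mv_scale: "mv d M (\<lambda>i. c * x i) = (\<lambda>i. c * mv d M x i)"
  by (simp_all add: mv_def algebra_simps sum.distrib sum_distrib_left fun_eq_iff)

lemma ip_mv_symmetric:
  assumes "\<And>i j. i < d \<Longrightarrow> j < d \<Longrightarrow> M i j = M j i"
  shows "ip d x (mv d M y) = ip d (mv d M x) y"
proof -
  have "ip d x (mv d M y) = (\<Sum>i<d. \<Sum>j<d. x i * (M i j * y j))"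
    by (simp add: ip_def mv_def sum_distrib_left)
  also have "\<dots> = (\<Sum>j<d. \<Sum>i<d. x i * (M i j * y j))" by (rule sum.swap)
  also have "\<dots> = (\<Sum>j<d. \<Sum>i<d. M j i * x i * y j)"
    using assms by (intro sum.cong) auto
  also have "\<dots> = ip d (mv d M x) y"
    by (simp add: ip_def mv_def sum_distrib_right)
  finally show ?thesis .
qed

text \<open>For a square matrix a one-sided inverse is two-sided, so orthonormal rows force
  orthonormal columns. This completeness is what \<open>parseval\<close> and
  \<open>entry_expansion\<close> rest on.\<close>

lemma orthonormal_resolution:
  assumes "orthonormal d d v" "i < d" "j < d"
  shows "(\<Sum>k<d. v k i * v k j) = (if i = j then 1 else 0)"
proof -
  define P where "P = Matrix.mat d d (\<lambda>(k,i). v k i)"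
  have P: "P \<in> carrier_mat d d" by (simp add: P_def)
  have "P * transpose_mat P = 1\<^sub>m d"
    using assms(1) by (intro eq_matI) (auto simp: P_def orthonormal_def ip_def scalar_prod_def atLeast0LessThan)
  then have "transpose_mat P * P = 1\<^sub>m d"
    using mat_mult_left_right_inverse[of P d "transpose_mat P"] P by simp
  then have "(transpose_mat P * P) $$ (i,j) = (1\<^sub>m d) $$ (i,j)" by simp
  then show ?thesis using assms(2,3)
    by (simp add: P_def scalar_prod_def atLeast0LessThan)
qed

lemma mult_if_one_right: "(a :: real) * (if P then 1 else 0) = (if P then a else 0)"
  by simp

lemma parseval:
  assumes "orthonormal d d v"
  shows "(\<Sum>k<d. ip d x (v k) * ip d (v k) y) = ip d x y"
proof -
  have "(\<Sum>k<d. ip d x (v k) * ip d (v k) y) = (\<Sum>k<d. \<Sum>i<d. \<Sum>j<d. x i * y j * (v k i * v k j))"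
    unfolding ip_def sum_product by (intro sum.cong refl) (simp add: mult_ac)
  also have "\<dots> = (\<Sum>i<d. \<Sum>k<d. \<Sum>j<d. x i * y j * (v k i * v k j))" by (rule sum.swap)
  also have "\<dots> = (\<Sum>i<d. \<Sum>j<d. \<Sum>k<d. x i * y j * (v k i * v k j))"
    by (intro sum.cong refl sum.swap)
  also have "\<dots> = (\<Sum>i<d. \<Sum>j<d. x i * y j * (if i = j then 1 else 0))"
    by (intro sum.cong refl) (simp only: sum_distrib_left[symmetric] orthonormal_resolution[OF assms] lessThan_iff)
  also have "\<dots> = ip d x y"
    by (simp add: ip_def mult_if_one_right)
  finally show ?thesis .
qed

lemma parseval_norm:
  assumes "orthonormal d d v"
  shows "(\<Sum>k<d. (ip d x (v k))\<^sup>2) = ip d x x"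
  using parseval[OF assms, of x x] by (simp add: power2_eq_square ip_commute)

text \<open>Vectors live in the product topology on \<open>nat \<Rightarrow> real\<close>, where
  compactness comes from Tychonoff. Forcing the coordinates from \<open>d\<close> on to vanish
  places the sphere inside a product of compact intervals.\<close>

lemma compact_unit_sphere_subspace:
  "compact {x :: nat \<Rightarrow> real. (\<forall>i. i \<ge> d \<longrightarrow> x i = 0) \<and> ip d x x = 1 \<and> (\<forall>j<k. ip d x (v j) = 0)}"
proof -
  let ?K = "{x :: nat \<Rightarrow> real. (\<forall>i. i \<ge> d \<longrightarrow> x i = 0) \<and> ip d x x = 1 \<and> (\<forall>j<k. ip d x (v j) = 0)}"
  let ?C = "PiE UNIV (\<lambda>_. {-1..1}) :: (nat \<Rightarrow> real) set"
  have C: "compact ?C"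
    using compactin_PiE[of "\<lambda>_. euclidean :: real topology" UNIV "\<lambda>_. {-1..1}"]
    by (simp add: euclidean_product_topology)
  have cont: "continuous_on UNIV (\<lambda>x :: nat \<Rightarrow> real. x i)" for i by simp
  have cl: "closed ?K"
    unfolding ip_def
    by (intro closed_Collect_conj closed_Collect_all closed_Collect_imp closed_Collect_eq
        continuous_intros cont open_Collect_const)
  have "?K \<subseteq> ?C"
  proof
    fix x assume x: "x \<in> ?K"
    have "\<bar>x i\<bar> \<le> 1" for i
    proof (cases "i < d")
      case True
      then have "(x i)\<^sup>2 \<le> ip d x x"
        unfolding ip_def power2_eq_square by (intro member_le_sum) auto
      then show ?thesis using x by (simp add: abs_square_le_1)
    next
      case False then show ?thesis using x by simp
    qed
    then show "x \<in> ?C" by (auto simp: abs_le_iff minus_le_iff)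
  qed
  then have "?K = ?C \<inter> ?K" by blast
  then show ?thesis using compact_Int_closed[OF C cl] by simp
qed

text \<open>First-order optimality without derivatives: for small positive \<open>t\<close> the
  linear term would dominate.\<close>

lemma quadratic_nonpos_imp_zero:
  fixes a b :: real
  assumes "a \<ge> 0" and "\<And>t. 2 * t * a + t\<^sup>2 * b \<le> 0"
  shows "a = 0"
proof (rule ccontr)
  assume "a \<noteq> 0"
  then have a: "a > 0" using assms(1) by simp
  \<comment> \<open>Chosen so that \<open>t * \<bar>b\<bar> \<le> a\<close>: the quadratic term can
    cancel at most half of \<open>2 * a\<close>.\<close>
  define t where "t = a / (\<bar>b\<bar> + 1)"
  have t: "t > 0" using a by (simp add: t_def)
  have "t * \<bar>b\<bar> \<le> t * (\<bar>b\<bar> + 1)" using t by (intro mult_left_mono) auto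
  also have "\<dots> = a" unfolding t_def by (simp add: add_nonneg_eq_0_iff)
  finally have tb: "t * \<bar>b\<bar> \<le> a" .
  have "- (t * b) \<le> t * \<bar>b\<bar>" using t by (metis abs_mult abs_of_pos abs_ge_minus_self)
  then have "2 * a + t * b > 0" using tb a by linarith
  then have "t * (2 * a + t * b) > 0" using t by simp
  then show False using assms(2)[of t] by (simp add: algebra_simps power2_eq_square)
qed

text \<open>A maximiser of the Rayleigh quotient on the orthogonal complement of \<open>v 0, \<dots>, v (k - 1)\<close>.\<close>

lemma exists_orthogonal_eigenvector:
  assumes sym: "\<And>i j. i < d \<Longrightarrow> j < d \<Longrightarrow> M i j = M j i"
    and on: "orthonormal d k v" and eig: "\<And>j i. j < k \<Longrightarrow> i < d \<Longrightarrow> mv d M (v j) i = lam j * v j i"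
    and kd: "k < d"
  obtains w mu where "ip d w w = 1" "\<And>j. j < k \<Longrightarrow> ip d w (v j) = 0"
    "\<And>i. i < d \<Longrightarrow> mv d M w i = mu * w i"
proof -
  define K where "K = {x :: nat \<Rightarrow> real. (\<forall>i. i \<ge> d \<longrightarrow> x i = 0) \<and> ip d x x = 1 \<and> (\<forall>j<k. ip d x (v j) = 0)}"
  define q where "q x = ip d x (mv d M x)" for x
  have normalise: "(\<lambda>i. if i < d then x i / sqrt (ip d x x) else 0) \<in> K"
    if "ip d x x > 0" "\<And>j. j < k \<Longrightarrow> ip d x (v j) = 0" for x
  proof -
    let ?y = "\<lambda>i. if i < d then x i / sqrt (ip d x x) else 0"
    have e: "ip d ?y z = inverse (sqrt (ip d x x)) * ip d x z" for z
      unfolding ip_scale_left[symmetric] by (intro ip_cong) (auto simp: divide_inverse)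
    have "ip d ?y ?y = inverse (sqrt (ip d x x)) * (inverse (sqrt (ip d x x)) * ip d x x)"
      unfolding e ip_commute[of d x ?y] ..
    then show ?thesis
      using that by (auto simp: K_def e) (simp add: field_simps flip: real_sqrt_mult)
  qed
  have Kne: "K \<noteq> {}"
  proof -
    \<comment> \<open>The standard basis vectors minus their projections onto
      \<open>v 0, ..., v (k - 1)\<close>. Their squared norms add up to \<open>d - k > 0\<close>, so
      one of them can be normalised.\<close>
    define r where "r i = (\<lambda>l. (if l = i then 1 else 0) - (\<Sum>j<k. v j i * v j l))" for i :: nat
    have rv: "ip d (r i) (v j) = 0" if "i < d" "j < k" for i j
    proof -
      have "ip d (\<lambda>l. if l = i then 1 else 0) (v j) = v j i"
        using that by (simp add: ip_unit_left)
      moreover have "ip d (\<lambda>l. \<Sum>j<k. v j i * v j l) (v j) = v j i"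
      proof -
        have "(\<Sum>l<k. v l i * ip d (v l) (v j)) = (\<Sum>l<k. v l i * (if l = j then 1 else 0))"
          using that on by (intro sum.cong) (auto simp: orthonormal_def)
        then show ?thesis using that by (simp add: ip_sum_left ip_scale_left mult_if_one_right)
      qed
      ultimately show ?thesis by (simp add: r_def ip_bilinear)
    qed
    have rr: "ip d (r i) (r i) = 1 - (\<Sum>j<k. (v j i)\<^sup>2)" if "i < d" for i
    proof -
      have "ip d (r i) (r i) = ip d (r i) (\<lambda>l. if l = i then 1 else 0) - (\<Sum>j<k. v j i * ip d (r i) (v j))"
        by (subst (2) r_def) (simp add: ip_bilinear ip_sum_right)
      also have "\<dots> = ip d (r i) (\<lambda>l. if l = i then 1 else 0)" using rv[OF that] by simp
      also have "\<dots> = r i i"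
        using that by (subst ip_commute) (simp add: ip_unit_left)
      finally show ?thesis by (simp add: r_def power2_eq_square)
    qed
    have "(\<Sum>i<d. ip d (r i) (r i)) = real d - (\<Sum>i<d. \<Sum>j<k. (v j i)\<^sup>2)"
      using rr by (simp add: sum_subtractf)
    also have "(\<Sum>i<d. \<Sum>j<k. (v j i)\<^sup>2) = (\<Sum>j<k. ip d (v j) (v j))"
      by (subst sum.swap) (simp add: ip_def power2_eq_square)
    also have "\<dots> = real k" using on by (simp add: orthonormal_def)
    finally have "(\<Sum>i<d. ip d (r i) (r i)) > 0" using kd by simp
    then obtain i where "i < d" "ip d (r i) (r i) > 0"
      by (metis (no_types, lifting) lessThan_iff not_le sum_nonpos)
    then show ?thesis using normalise[of "r i"] rv by blast
  qed
  have "compact K" unfolding K_def by (rule compact_unit_sphere_subspace)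
  moreover have "continuous_on K q"
    unfolding q_def ip_def mv_def
    by (rule continuous_on_subset[of UNIV])
       (auto intro!: continuous_intros)
  ultimately obtain w where wK: "w \<in> K" and wmax: "\<And>x. x \<in> K \<Longrightarrow> q x \<le> q w"
    using continuous_attains_sup[of K q] Kne by metis
  define mu where "mu = q w"
  have ww: "ip d w w = 1" and wv: "\<And>j. j < k \<Longrightarrow> ip d w (v j) = 0" using wK by (auto simp: K_def)
  \<comment> \<open>Homogeneity carries maximality from the unit sphere to the whole orthogonal
    complement.\<close>
  have qle: "q x \<le> mu * ip d x x" if xv: "\<And>j. j < k \<Longrightarrow> ip d x (v j) = 0" for x
  proof (cases "ip d x x = 0")
    case True
    then have "\<forall>i<d. x i = 0" by (simp only: ip_eq_0_iff)
    then have "ip d x (mv d M x) = 0" by (simp add: ip_def)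
    then show ?thesis using True by (simp add: q_def)
  next
    case False
    then have pos: "ip d x x > 0" using ip_self_nonneg[of d x] by linarith
    let ?c = "inverse (sqrt (ip d x x))"
    let ?y = "\<lambda>i. if i < d then x i / sqrt (ip d x x) else 0"
    have "q ?y = ip d (\<lambda>i. ?c * x i) (mv d M (\<lambda>i. ?c * x i))"
      unfolding q_def by (intro ip_cong) (auto simp: divide_inverse mv_def mult_ac)
    also have "\<dots> = ?c * ?c * q x" by (simp add: q_def mv_scale ip_bilinear)
    finally have "?c * ?c * q x \<le> mu" using wmax[OF normalise[OF pos xv]] by (simp add: mu_def)
    moreover have "?c * ?c = inverse (ip d x x)"
      using pos by (simp flip: inverse_mult_distrib)
    ultimately show ?thesis using pos by (simp add: field_simps)
  qed
  \<comment> \<open>This defect is orthogonal to \<open>w\<close> and to every \<open>v j\<close>,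
    so \<open>w + t * r\<close> is an admissible competitor, and its first-order gain is
    \<open>2 * t * ip d r r\<close>.\<close>
  define r where "r = (\<lambda>i. mv d M w i - mu * w i)"
  have rw: "ip d r w = 0"
    by (simp add: r_def ip_bilinear ww mu_def q_def ip_commute[of d w "mv d M w"])
  have rv: "ip d r (v j) = 0" if "j < k" for j
  proof -
    have "ip d (mv d M w) (v j) = ip d w (mv d M (v j))" using ip_mv_symmetric[OF sym] by simp
    also have "\<dots> = ip d w (\<lambda>i. lam j * v j i)" using eig[OF that] by (intro ip_cong) auto
    finally show ?thesis using wv[OF that] by (simp add: r_def ip_bilinear)
  qed
  have rMw: "ip d r (mv d M w) = ip d r r"
    using rw by (subst (3) r_def) (simp add: ip_bilinear)
  have "2 * t * ip d r r + t\<^sup>2 * (q r - mu * ip d r r) \<le> 0" for t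
  proof -
    let ?x = "\<lambda>i. w i + t * r i"
    have "q ?x = q w + t * ip d w (mv d M r) + t * ip d r (mv d M w) + t * t * q r"
      by (simp add: q_def mv_add mv_scale ip_bilinear algebra_simps)
    also have "ip d w (mv d M r) = ip d r (mv d M w)"
      using ip_mv_symmetric[OF sym, where x = w and y = r] by (simp add: ip_commute)
    finally have "q ?x = mu + 2 * t * ip d r r + t\<^sup>2 * q r"
      by (simp add: rMw mu_def power2_eq_square)
    moreover have "ip d ?x ?x = 1 + t\<^sup>2 * ip d r r"
      using rw by (simp add: ip_bilinear ww ip_commute[of d w r] power2_eq_square)
    moreover have "q ?x \<le> mu * ip d ?x ?x"
      using wv rv by (intro qle) (simp add: ip_bilinear)
    ultimately show ?thesis by (simp add: algebra_simps)
  qed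
  then have "ip d r r = 0" by (rule quadratic_nonpos_imp_zero[OF ip_self_nonneg])
  then have "mv d M w i = mu * w i" if "i < d" for i using that by (simp add: ip_eq_0_iff r_def)
  then show ?thesis using that[of w mu] ww wv by blast
qed

theorem spectral_theorem:
  assumes sym: "\<And>i j. i < d \<Longrightarrow> j < d \<Longrightarrow> M i j = M j i"
  shows "\<exists>lam v. eigenbasis d M lam v"
proof -
  have "\<exists>lam v. orthonormal d k v \<and> (\<forall>j<k. \<forall>i<d. mv d M (v j) i = lam j * v j i)" if "k \<le> d" for k
    using that
  proof (induction k)
    case 0 show ?case by (simp add: orthonormal_def)
  next
    case (Suc k)
    then obtain lam v where on: "orthonormal d k v"
      and eig: "\<And>j i. j < k \<Longrightarrow> i < d \<Longrightarrow> mv d M (v j) i = lam j * v j i" by auto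
    have kd: "k < d" using Suc.prems by simp
    obtain w mu where w: "ip d w w = 1" "\<And>j. j < k \<Longrightarrow> ip d w (v j) = 0"
      "\<And>i. i < d \<Longrightarrow> mv d M w i = mu * w i"
      by (rule exists_orthogonal_eigenvector[OF sym on eig kd]) (assumption | rule that)+
    have "orthonormal d (Suc k) (v(k := w))"
      using on w by (auto simp: orthonormal_def less_Suc_eq ip_commute)
    moreover have "\<forall>j<Suc k. \<forall>i<d. mv d M ((v(k := w)) j) i = (lam(k := mu)) j * (v(k := w)) j i"
      using eig w by (auto simp: less_Suc_eq)
    ultimately show ?case by blast
  qed
  from this[of d] show ?thesis by (auto simp: eigenbasis_def)
qed

subsection \<open>A trace mean value inequality\<close>

lemma sinh_le_mult_cosh:
  fixes h :: real
  assumes "0 \<le> h"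
  shows "sinh h \<le> h * cosh h"
proof -
  have "(\<lambda>h. h * cosh h - sinh h) 0 \<le> (\<lambda>h. h * cosh h - sinh h) h"
  proof (rule DERIV_nonneg_imp_nondecreasing[OF assms])
    fix x :: real assume x: "0 \<le> x" "x \<le> h"
    have "((\<lambda>h. h * cosh h - sinh h) has_real_derivative x * sinh x) (at x)"
      by (auto intro!: derivative_eq_intros)
    moreover have "x * sinh x \<ge> 0" using x by simp
    ultimately show "\<exists>y. ((\<lambda>h. h * cosh h - sinh h) has_real_derivative y) (at x) \<and> y \<ge> 0" by blast
  qed
  then show ?thesis by simp
qed

text \<open>Both sides are even in \<open>h\<close>, which reduces to \<open>h \<ge> 0\<close>. Both
  exchange arguments, for rows and for signs, end in this scalar inequality.\<close>

lemma mult_sinh_le: "h * sinh h \<le> h\<^sup>2 * cosh (h :: real)"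
proof -
  have "\<bar>h\<bar> * sinh \<bar>h\<bar> \<le> \<bar>h\<bar> * (\<bar>h\<bar> * cosh \<bar>h\<bar>)"
    by (intro mult_left_mono sinh_le_mult_cosh) auto
  then show ?thesis
    by (cases "h \<ge> 0") (auto simp: power2_eq_square mult.assoc)
qed

text \<open>A difference quotient of \<open>sinh\<close> against the average of its derivative at
  the endpoints. In terms of half-sum \<open>u\<close> and half-difference \<open>h\<close> both
  sides contain \<open>cosh u\<close>, and \<open>mult_sinh_le\<close> remains.\<close>

lemma sinh_diff_le_cosh_mean:
  fixes a b \<theta> :: real
  assumes "0 \<le> \<theta>"
  shows "(a - b) * (sinh (\<theta> * a) - sinh (\<theta> * b)) \<le> \<theta> / 2 * (a - b)\<^sup>2 * (cosh (\<theta> * a) + cosh (\<theta> * b))"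
proof (cases "\<theta> = 0")
  case False
  then have \<theta>: "\<theta> > 0" using assms by simp
  define u h where "u = \<theta> * (a + b) / 2" and "h = \<theta> * (a - b) / 2"
  have e: "\<theta> * a = u + h" "\<theta> * b = u - h" by (simp_all add: u_def h_def field_simps)
  have "\<theta> * ((a - b) * (sinh (\<theta> * a) - sinh (\<theta> * b))) = 4 * cosh u * (h * sinh h)"
    unfolding e sinh_add sinh_diff by (simp add: h_def field_simps)
  also have "\<dots> \<le> 4 * cosh u * (h\<^sup>2 * cosh h)" by (intro mult_left_mono mult_sinh_le) auto
  also have "\<dots> = \<theta> * (\<theta> / 2 * (a - b)\<^sup>2 * (cosh (\<theta> * a) + cosh (\<theta> * b)))"
    unfolding e cosh_add cosh_diff by (simp add: h_def power2_eq_square field_simps)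
  finally show ?thesis using mult_le_cancel_left_pos[OF \<theta>] by blast
qed simp

text \<open>Symmetry lets \<open>A\<close> act on \<open>u k\<close> while \<open>B\<close> acts on
  \<open>w l\<close>. On mixed pairs the difference thus acts as a scalar, although \<open>A\<close>
  and \<open>B\<close> need not commute.\<close>

lemma eigenbasis_mixed:
  assumes A: "eigenbasis d A a u" and B: "eigenbasis d B b w"
    and symA: "\<And>i j. i < d \<Longrightarrow> j < d \<Longrightarrow> A i j = A j i"
    and \<Delta>: "\<And>i j. i < d \<Longrightarrow> j < d \<Longrightarrow> \<Delta> i j = A i j - B i j"
    and "k < d" "l < d"
  shows "ip d (u k) (mv d \<Delta> (w l)) = (a k - b l) * ip d (u k) (w l)"
proof -
  have "ip d (u k) (mv d \<Delta> (w l)) = ip d (u k) (\<lambda>i. mv d A (w l) i - mv d B (w l) i)"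
    using \<Delta> by (intro ip_cong) (auto simp: mv_def sum_subtractf[symmetric] left_diff_distrib intro!: sum.cong)
  also have "\<dots> = ip d (mv d A (u k)) (w l) - ip d (u k) (mv d B (w l))"
    by (simp add: ip_bilinear ip_mv_symmetric[OF symA])
  also have "ip d (mv d A (u k)) (w l) = ip d (\<lambda>i. a k * u k i) (w l)"
    using A assms(5) by (intro ip_cong) (auto simp: eigenbasis_def)
  also have "ip d (u k) (mv d B (w l)) = ip d (u k) (\<lambda>i. b l * w l i)"
    using B assms(6) by (intro ip_cong) (auto simp: eigenbasis_def)
  finally show ?thesis by (simp add: ip_bilinear algebra_simps)
qed

text \<open>Mixed double sums, weighted by squared overlaps of the two eigenbases, for
  \<open>tr (\<Delta> (F A - F B))\<close> and \<open>tr (F A \<Delta>\<^sup>2)\<close>. With both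
  traces in this form, a scalar inequality in \<open>a k\<close> and \<open>b l\<close> passes to
  traces term by term.\<close>

lemma
  assumes A: "eigenbasis d A a u" and B: "eigenbasis d B b w"
    and symA: "\<And>i j. i < d \<Longrightarrow> j < d \<Longrightarrow> A i j = A j i"
    and symB: "\<And>i j. i < d \<Longrightarrow> j < d \<Longrightarrow> B i j = B j i"
    and \<Delta>: "\<And>i j. i < d \<Longrightarrow> j < d \<Longrightarrow> \<Delta> i j = A i j - B i j"
  shows trace_function_difference:
      "(\<Sum>k<d. F (a k) * ip d (u k) (mv d \<Delta> (u k))) - (\<Sum>l<d. F (b l) * ip d (w l) (mv d \<Delta> (w l)))
       = (\<Sum>k<d. \<Sum>l<d. (ip d (u k) (w l))\<^sup>2 * ((a k - b l) * (F (a k) - F (b l))))" (is ?eq)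
    and trace_function_norm:
      "(\<Sum>k<d. F (a k) * ip d (mv d \<Delta> (u k)) (mv d \<Delta> (u k)))
       = (\<Sum>k<d. \<Sum>l<d. (ip d (u k) (w l))\<^sup>2 * ((a k - b l)\<^sup>2 * F (a k)))" (is ?norm)
proof -
  have sym\<Delta>: "\<Delta> i j = \<Delta> j i" if "i < d" "j < d" for i j
    using that by (simp add: \<Delta> symA[of i j] symB[of i j])
  have onu: "orthonormal d d u" and onw: "orthonormal d d w" using A B by (auto simp: eigenbasis_def)
  have mix: "ip d (u k) (mv d \<Delta> (w l)) = (a k - b l) * ip d (u k) (w l)" if "k < d" "l < d" for k l
    by (rule eigenbasis_mixed[OF A B]) (use symA \<Delta> that in auto)
  have mix': "ip d (w l) (mv d \<Delta> (u k)) = (a k - b l) * ip d (u k) (w l)" if "k < d" "l < d" for k l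
    using mix[OF that] ip_mv_symmetric[OF sym\<Delta>, where x = "w l" and y = "u k"] by (simp add: ip_commute)
  have u: "ip d (u k) (mv d \<Delta> (u k)) = (\<Sum>l<d. (ip d (u k) (w l))\<^sup>2 * (a k - b l))" if "k < d" for k
    using that by (subst parseval[OF onw, symmetric]) (auto simp: mix' power2_eq_square algebra_simps)
  have w: "ip d (w l) (mv d \<Delta> (w l)) = (\<Sum>k<d. (ip d (u k) (w l))\<^sup>2 * (a k - b l))" if "l < d" for l
    using that by (subst parseval[OF onu, symmetric])
      (auto simp: mix power2_eq_square algebra_simps ip_commute[of d "w l"])
  have "(\<Sum>k<d. F (a k) * ip d (u k) (mv d \<Delta> (u k)))
      = (\<Sum>k<d. \<Sum>l<d. (ip d (u k) (w l))\<^sup>2 * ((a k - b l) * F (a k)))"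
    by (simp add: u sum_distrib_left algebra_simps)
  moreover have "(\<Sum>l<d. F (b l) * ip d (w l) (mv d \<Delta> (w l)))
      = (\<Sum>k<d. \<Sum>l<d. (ip d (u k) (w l))\<^sup>2 * ((a k - b l) * F (b l)))"
    by (subst sum.swap) (simp add: w sum_distrib_left algebra_simps)
  ultimately show ?eq by (simp add: sum_subtractf[symmetric] algebra_simps)
  show ?norm
  proof (intro sum.cong refl)
    fix k assume k: "k \<in> {..<d}"
    have "ip d (mv d \<Delta> (u k)) (mv d \<Delta> (u k)) = (\<Sum>l<d. (ip d (mv d \<Delta> (u k)) (w l))\<^sup>2)"
      using parseval_norm[OF onw] by simp
    also have "\<dots> = (\<Sum>l<d. ((a k - b l) * ip d (u k) (w l))\<^sup>2)"
      using k by (intro sum.cong) (auto simp: ip_commute[of d "mv d \<Delta> (u k)"] mix')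
    finally show "F (a k) * ip d (mv d \<Delta> (u k)) (mv d \<Delta> (u k))
       = (\<Sum>l<d. (ip d (u k) (w l))\<^sup>2 * ((a k - b l)\<^sup>2 * F (a k)))"
      by (simp add: sum_distrib_left power_mult_distrib mult_ac)
  qed
qed

lemma trace_sinh_difference_le:
  assumes A: "eigenbasis d A a u" and B: "eigenbasis d B b w"
    and symA: "\<And>i j. i < d \<Longrightarrow> j < d \<Longrightarrow> A i j = A j i"
    and symB: "\<And>i j. i < d \<Longrightarrow> j < d \<Longrightarrow> B i j = B j i"
    and \<Delta>: "\<And>i j. i < d \<Longrightarrow> j < d \<Longrightarrow> \<Delta> i j = A i j - B i j"
    and \<theta>: "0 \<le> \<theta>"
  shows "(\<Sum>k<d. sinh (\<theta> * a k) * ip d (u k) (mv d \<Delta> (u k)))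
      - (\<Sum>l<d. sinh (\<theta> * b l) * ip d (w l) (mv d \<Delta> (w l)))
    \<le> \<theta> / 2 * ((\<Sum>k<d. cosh (\<theta> * a k) * ip d (mv d \<Delta> (u k)) (mv d \<Delta> (u k)))
              + (\<Sum>l<d. cosh (\<theta> * b l) * ip d (mv d \<Delta> (w l)) (mv d \<Delta> (w l))))"
proof -
  define c where "c k l = (ip d (u k) (w l))\<^sup>2" for k l
  \<comment> \<open>The norm formula with the roles of \<open>A\<close> and \<open>B\<close>
    exchanged speaks of \<open>B - A\<close>; only its square occurs, so the sign is
    immaterial.\<close>
  have "ip d (mv d \<Delta> y) (mv d \<Delta> y) = ip d (mv d (\<lambda>i j. B i j - A i j) y) (mv d (\<lambda>i j. B i j - A i j) y)" for y
  proof -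
    have "mv d (\<lambda>i j. B i j - A i j) y i = - mv d \<Delta> y i" if "i < d" for i
      using that by (simp add: mv_def \<Delta> sum_negf[symmetric] algebra_simps)
    then show ?thesis by (simp add: ip_def)
  qed
  then have 2: "(\<Sum>l<d. cosh (\<theta> * b l) * ip d (mv d \<Delta> (w l)) (mv d \<Delta> (w l)))
      = (\<Sum>k<d. \<Sum>l<d. c k l * ((a k - b l)\<^sup>2 * cosh (\<theta> * b l)))"
    using trace_function_norm[OF B A symB symA refl, of "\<lambda>t. cosh (\<theta> * t)"]
    by (simp add: c_def ip_commute power2_commute) (rule sum.swap)
  have 1: "(\<Sum>k<d. cosh (\<theta> * a k) * ip d (mv d \<Delta> (u k)) (mv d \<Delta> (u k)))
      = (\<Sum>k<d. \<Sum>l<d. c k l * ((a k - b l)\<^sup>2 * cosh (\<theta> * a k)))"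
    using trace_function_norm[OF A B symA symB \<Delta>, of "\<lambda>t. cosh (\<theta> * t)"] by (simp add: c_def)
  have "(\<Sum>k<d. sinh (\<theta> * a k) * ip d (u k) (mv d \<Delta> (u k)))
      - (\<Sum>l<d. sinh (\<theta> * b l) * ip d (w l) (mv d \<Delta> (w l)))
      = (\<Sum>k<d. \<Sum>l<d. c k l * ((a k - b l) * (sinh (\<theta> * a k) - sinh (\<theta> * b l))))"
    using trace_function_difference[OF A B symA symB \<Delta>, of "\<lambda>t. sinh (\<theta> * t)"] by (simp add: c_def)
  also have "\<dots> \<le> (\<Sum>k<d. \<Sum>l<d. c k l * (\<theta> / 2 * (a k - b l)\<^sup>2 * (cosh (\<theta> * a k) + cosh (\<theta> * b l))))"
    by (intro sum_mono mult_left_mono sinh_diff_le_cosh_mean \<theta>) (simp add: c_def)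
  also have "\<dots> = \<theta> / 2 * ((\<Sum>k<d. \<Sum>l<d. c k l * ((a k - b l)\<^sup>2 * cosh (\<theta> * a k)))
      + (\<Sum>k<d. \<Sum>l<d. c k l * ((a k - b l)\<^sup>2 * cosh (\<theta> * b l))))"
    by (simp add: sum_distrib_left sum.distrib[symmetric] algebra_simps add_divide_distrib)
  finally show ?thesis unfolding 1 2 .
qed

subsection \<open>Sampling without replacement\<close>

lemma sum_over_sample_split:
  fixes h :: "nat \<Rightarrow> real"
  assumes "rs \<in> row_samples m n"
  shows "(\<Sum>r<n. h r) = (\<Sum>p<m. h (rs ! p)) + (\<Sum>j\<in>{..<n} - set rs. h j)"
proof -
  have rs: "length rs = m" "distinct rs" "set rs \<subseteq> {..<n}" using assms by (auto simp: row_samples_def)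
  have "(\<Sum>r\<in>set rs. h r) = (\<Sum>p<m. h (rs ! p))"
    using rs by (simp add: sum.distinct_set_conv_list sum_list_sum_nth atLeast0LessThan)
  then show ?thesis using sum.subset_diff[OF rs(3), of h] by simp
qed

lemma card_unsampled:
  assumes "rs \<in> row_samples m n"
  shows "real (card ({..<n} - set rs)) = real n - real m"
  using sum_over_sample_split[OF assms, of "\<lambda>_. 1"] by simp

text \<open>There are \<open>n - m\<close> unsampled rows, so the double sum is \<open>n - m\<close>
  times the sampled sum minus \<open>m\<close> times the unsampled one. This is how the centred sum
  becomes a sum over exchanges.\<close>

lemma sum_sampled_minus_unsampled:
  fixes h :: "nat \<Rightarrow> real"
  assumes "rs \<in> row_samples m n"
  shows "(\<Sum>p<m. \<Sum>j\<in>{..<n} - set rs. h (rs ! p) - h j)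
    = real n * (\<Sum>p<m. h (rs ! p)) - real m * (\<Sum>r<n. h r)"
proof -
  let ?J = "{..<n} - set rs"
  have "(\<Sum>p<m. \<Sum>j\<in>?J. h (rs ! p) - h j) = (\<Sum>p<m. (real n - real m) * h (rs ! p) - sum h ?J)"
    by (simp add: sum_subtractf card_unsampled[OF assms])
  also have "\<dots> = (real n - real m) * (\<Sum>p<m. h (rs ! p)) - real m * sum h ?J"
    by (simp add: sum_subtractf sum_distrib_left)
  finally show ?thesis by (simp add: sum_over_sample_split[OF assms, of h] algebra_simps)
qed

text \<open>Serves to add up the squared increments. The coefficient \<open>n - 2 * m\<close> may
  have either sign, which is why an absolute value appears in
  \<open>excess_deriv_le\<close>.\<close>

lemma sum_sampled_plus_unsampled:
  fixes h :: "nat \<Rightarrow> real"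
  assumes "rs \<in> row_samples m n"
  shows "(\<Sum>p<m. \<Sum>j\<in>{..<n} - set rs. h (rs ! p) + h j)
    = (real n - 2 * real m) * (\<Sum>p<m. h (rs ! p)) + real m * (\<Sum>r<n. h r)"
proof -
  let ?J = "{..<n} - set rs"
  have "(\<Sum>p<m. \<Sum>j\<in>?J. h (rs ! p) + h j) = (\<Sum>p<m. (real n - real m) * h (rs ! p) + sum h ?J)"
    by (simp add: sum.distrib card_unsampled[OF assms])
  also have "\<dots> = (real n - real m) * (\<Sum>p<m. h (rs ! p)) + real m * sum h ?J"
    by (simp add: sum.distrib sum_distrib_left)
  finally show ?thesis by (simp add: sum_over_sample_split[OF assms, of h] algebra_simps)
qed

section \<open>Exchanging a sampled and an unsampled row\<close>

definition swaps :: "nat \<Rightarrow> nat \<Rightarrow> (nat list \<times> nat \<times> nat) set" where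
  "swaps m n = Sigma (row_samples m n) (\<lambda>rs. {..<m} \<times> ({..<n} - set rs))"

text \<open>The row put out of the sample is stored in the place of the row that entered; this makes
  the map an involution on \<open>swaps m n\<close>.\<close>

definition swap :: "nat list \<times> nat \<times> nat \<Rightarrow> nat list \<times> nat \<times> nat" where
  "swap = (\<lambda>(rs, p, j). (rs[p := j], p, rs ! p))"

lemma swap_in_swaps: "t \<in> swaps m n \<Longrightarrow> swap t \<in> swaps m n"
  and swap_swap: "t \<in> swaps m n \<Longrightarrow> swap (swap t) = t"
  by (force simp: swaps_def swap_def row_samples_def set_update_distinct distinct_list_update)+

lemma finite_row_samples: "finite (row_samples m n)"
  by (rule finite_subset[OF _ finite_lists_length_eq[of "{..<n}" m]]) (auto simp: row_samples_def)

lemma sum_swap_invariant: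
  fixes f :: "_ \<Rightarrow> real"
  shows "(\<Sum>t\<in>swaps m n. f (swap t)) = (\<Sum>t\<in>swaps m n. f t)"
  by (rule sum.reindex_bij_witness[of _ swap swap]) (auto simp: swap_swap swap_in_swaps)

lemma sum_swaps:
  fixes f :: "nat list \<Rightarrow> nat \<Rightarrow> nat \<Rightarrow> real"
  shows "(\<Sum>(rs,p,j)\<in>swaps m n. f rs p j)
    = (\<Sum>rs\<in>row_samples m n. \<Sum>p<m. \<Sum>j\<in>{..<n} - set rs. f rs p j)"
  unfolding swaps_def
  by (subst sum.Sigma[symmetric]) (auto simp: finite_row_samples sum.cartesian_product)

definition sample_deviation ::
    "nat \<Rightarrow> nat \<Rightarrow> (nat \<Rightarrow> nat \<Rightarrow> real) \<Rightarrow> nat list \<Rightarrow> nat \<Rightarrow> nat \<Rightarrow> real" where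
  "sample_deviation m n x rs i j =
     (\<Sum>p<m. x (rs ! p) i * x (rs ! p) j) - real m / real n * (\<Sum>r<n. x r i * x r j)"

lemma sample_deviation_symmetric: "sample_deviation m n x rs i j = sample_deviation m n x rs j i"
  by (simp add: sample_deviation_def mult.commute)

lemma mv_outer: "mv d (\<lambda>i j. z i * z j) y = (\<lambda>i. ip d z y * z i)"
  by (simp add: mv_def ip_def sum_distrib_left fun_eq_iff mult_ac)

lemma mv_sum: "mv d (\<lambda>i j. \<Sum>k\<in>S. f k i j) y = (\<lambda>i. \<Sum>k\<in>S. mv d (f k) y i)"
  unfolding mv_def by (simp add: sum_distrib_right fun_eq_iff) (intro allI sum.swap)

lemma mv_diff_mat: "mv d (\<lambda>i j. A i j - B i j) y = (\<lambda>i. mv d A y i - mv d B y i)"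
  and mv_scale_mat: "mv d (\<lambda>i j. c * A i j) y = (\<lambda>i. c * mv d A y i)"
  by (simp_all add: mv_def sum_subtractf sum_distrib_left left_diff_distrib mult.assoc)

lemma quadratic_form_sample_deviation:
  "ip d y (mv d (sample_deviation m n x rs) y)
   = (\<Sum>p<m. (ip d (x (rs ! p)) y)\<^sup>2) - real m / real n * (\<Sum>r<n. (ip d (x r) y)\<^sup>2)"
proof -
  have "sample_deviation m n x rs = (\<lambda>i j. (\<Sum>p<m. x (rs ! p) i * x (rs ! p) j)
      - real m / real n * (\<Sum>r<n. x r i * x r j))"
    by (simp add: sample_deviation_def fun_eq_iff)
  then show ?thesis
    by (simp add: mv_diff_mat mv_sum mv_outer mv_scale_mat[where c = "real m / real n"] ip_diff_right
        ip_scale_right[where c = "real m / real n"] ip_scale_right ip_sum_right power2_eq_square ip_commute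
        del: times_divide_eq_left)
qed

text \<open>The population term and all positions except \<open>p\<close> cancel. It identifies the
  difference of two rank-one matrices with \<open>Y - Y'\<close>, as the trace inequality
  requires.\<close>

lemma sample_deviation_swap:
  assumes "rs \<in> row_samples m n" "p < m"
  shows "x (rs ! p) i * x (rs ! p) k - x j i * x j k
    = sample_deviation m n x rs i k - sample_deviation m n x (rs[p := j]) i k"
proof -
  let ?h = "\<lambda>r. x r i * x r k"
  have l: "length rs = m" using assms(1) by (simp add: row_samples_def)
  have "(\<Sum>q<m. ?h (rs ! q)) - (\<Sum>q<m. ?h (rs[p := j] ! q))
      = (\<Sum>q<m. if q = p then ?h (rs ! p) - ?h j else 0)"
    unfolding sum_subtractf[symmetric] using l by (intro sum.cong) (auto simp: nth_list_update)
  also have "\<dots> = ?h (rs ! p) - ?h j" using assms(2) by simp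
  finally show ?thesis by (simp add: sample_deviation_def)
qed

text \<open>The setting after the signs have been fixed. \<open>B\<close> bounds squared row norms,
  \<open>s2\<close> stands for a squared operator norm and \<open>s2 * de\<close> for a squared
  Frobenius norm; the factor \<open>n\<close> reflects the scaling of the rows by
  \<open>sqrt n\<close>. One eigenbasis per sample is chosen in advance, so that traces of functions
  of \<open>Y\<close> are plain sums.\<close>

locale row_sampling =
  fixes n d m :: nat and x :: "nat \<Rightarrow> nat \<Rightarrow> real" and B s2 de :: real
    and lam :: "nat list \<Rightarrow> nat \<Rightarrow> real" and v :: "nat list \<Rightarrow> nat \<Rightarrow> nat \<Rightarrow> real"
  assumes n_pos: "0 < n" and m_le: "m \<le> n"
    and row_bound: "r < n \<Longrightarrow> ip d (x r) (x r) \<le> B"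
    and operator_bound: "(\<Sum>r<n. (ip d (x r) y)\<^sup>2) \<le> real n * s2 * ip d y y"
    and trace: "(\<Sum>r<n. ip d (x r) (x r)) = real n * s2 * de"
    and eig: "rs \<in> row_samples m n \<Longrightarrow> eigenbasis d (sample_deviation m n x rs) (lam rs) (v rs)"
begin

abbreviation "outer_diff r j \<equiv> (\<lambda>i k. x r i * x r k - x j i * x j k)"

lemma quadratic_form_outer_diff:
  "ip d y (mv d (outer_diff r j) y) = (ip d (x r) y)\<^sup>2 - (ip d (x j) y)\<^sup>2"
  by (simp add: mv_diff_mat mv_outer ip_bilinear power2_eq_square ip_commute)

text \<open>The parallelogram law removes the cross term; each remaining square has an additional
  factor \<open>ip d (x r) (x r)\<close>, bounded by \<open>B\<close>.\<close>

lemma norm_outer_diff_le: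
  assumes "r < n" "j < n"
  shows "ip d (mv d (outer_diff r j) y) (mv d (outer_diff r j) y)
    \<le> 2 * B * ((ip d (x r) y)\<^sup>2 + (ip d (x j) y)\<^sup>2)"
proof -
  let ?a = "\<lambda>i. ip d (x r) y * x r i" and ?b = "\<lambda>i. ip d (x j) y * x j i"
  have "ip d (\<lambda>i. ?a i - ?b i) (\<lambda>i. ?a i - ?b i) + ip d (\<lambda>i. ?a i + ?b i) (\<lambda>i. ?a i + ?b i)
      = 2 * ip d ?a ?a + 2 * ip d ?b ?b"
    by (simp only: ip_add_left ip_diff_left ip_add_right ip_diff_right)
  then have "ip d (\<lambda>i. ?a i - ?b i) (\<lambda>i. ?a i - ?b i) \<le> 2 * ip d ?a ?a + 2 * ip d ?b ?b"
    using ip_self_nonneg[of d "\<lambda>i. ?a i + ?b i"] by linarith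
  also have "\<dots> = 2 * ((ip d (x r) y)\<^sup>2 * ip d (x r) (x r) + (ip d (x j) y)\<^sup>2 * ip d (x j) (x j))"
    by (simp add: ip_bilinear power2_eq_square)
  also have "\<dots> \<le> 2 * ((ip d (x r) y)\<^sup>2 * B + (ip d (x j) y)\<^sup>2 * B)"
    using assms by (intro mult_left_mono add_mono row_bound) auto
  finally show ?thesis by (simp add: mv_diff_mat mv_outer algebra_simps)
qed

lemma eigenvalue_quadratic_form:
  assumes "rs \<in> row_samples m n" "k < d"
  shows "lam rs k = (\<Sum>p<m. (ip d (x (rs ! p)) (v rs k))\<^sup>2) - real m / real n * (\<Sum>r<n. (ip d (x r) (v rs k))\<^sup>2)"
proof -
  have "ip d (v rs k) (mv d (sample_deviation m n x rs) (v rs k)) = ip d (v rs k) (\<lambda>i. lam rs k * v rs k i)"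
    using eig[OF assms(1)] assms(2) by (intro ip_cong) (auto simp: eigenbasis_def)
  also have "\<dots> = lam rs k"
    using eig[OF assms(1)] assms(2) by (simp add: ip_bilinear eigenbasis_def orthonormal_def)
  finally show ?thesis by (simp add: quadratic_form_sample_deviation)
qed

text \<open>An eigenvalue is the quadratic form of \<open>Y\<close> at its own eigenvector, so
  \<open>sum_sampled_minus_unsampled\<close> expands \<open>n * lam rs k\<close> over the exchanges
  available at \<open>rs\<close>.\<close>

lemma trace_function_as_swaps:
  "real n * (\<Sum>rs\<in>row_samples m n. \<Sum>k<d. lam rs k * F (lam rs k))
   = (\<Sum>(rs,p,j)\<in>swaps m n. \<Sum>k<d. F (lam rs k) * ip d (v rs k) (mv d (outer_diff (rs ! p) j) (v rs k)))"
proof -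
  have "real n * lam rs k = (\<Sum>p<m. \<Sum>j\<in>{..<n} - set rs. ip d (v rs k) (mv d (outer_diff (rs ! p) j) (v rs k)))"
    if "rs \<in> row_samples m n" "k < d" for rs k
    unfolding quadratic_form_outer_diff
      sum_sampled_minus_unsampled[OF that(1), where h = "\<lambda>r. (ip d (x r) (v rs k))\<^sup>2"]
    using eigenvalue_quadratic_form[OF that] n_pos by (simp add: field_simps)
  then have "real n * (\<Sum>rs\<in>row_samples m n. \<Sum>k<d. lam rs k * F (lam rs k))
    = (\<Sum>rs\<in>row_samples m n. \<Sum>k<d. F (lam rs k) *
        (\<Sum>p<m. \<Sum>j\<in>{..<n} - set rs. ip d (v rs k) (mv d (outer_diff (rs ! p) j) (v rs k))))"
    unfolding sum_distrib_left by (intro sum.cong refl) (auto simp: sum_distrib_left[symmetric] mult_ac)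
  also have "\<dots> = (\<Sum>rs\<in>row_samples m n. \<Sum>p<m. \<Sum>j\<in>{..<n} - set rs. \<Sum>k<d.
      F (lam rs k) * ip d (v rs k) (mv d (outer_diff (rs ! p) j) (v rs k)))"
    unfolding sum_distrib_left
    by (rule sum.cong[OF refl], subst sum.swap, rule sum.cong[OF refl], rule sum.swap)
  finally show ?thesis unfolding sum_swaps .
qed

text \<open>Adding the copy reindexed by \<open>swap\<close>, in which \<open>outer_diff\<close> has
  the opposite sign, leaves only differences of \<open>F\<close> at neighbouring samples.\<close>

lemma trace_function_antisymmetrised:
  "2 * real n * (\<Sum>rs\<in>row_samples m n. \<Sum>k<d. lam rs k * F (lam rs k))
   = (\<Sum>(rs,p,j)\<in>swaps m n.
        (\<Sum>k<d. F (lam rs k) * ip d (v rs k) (mv d (outer_diff (rs ! p) j) (v rs k)))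
      - (\<Sum>k<d. F (lam (rs[p := j]) k)
          * ip d (v (rs[p := j]) k) (mv d (outer_diff (rs ! p) j) (v (rs[p := j]) k))))"
proof -
  let ?g = "\<lambda>(rs,p,j). \<Sum>k<d. F (lam rs k) * ip d (v rs k) (mv d (outer_diff (rs ! p) j) (v rs k))"
  have "2 * real n * (\<Sum>rs\<in>row_samples m n. \<Sum>k<d. lam rs k * F (lam rs k))
      = (\<Sum>t\<in>swaps m n. ?g t) + (\<Sum>t\<in>swaps m n. ?g (swap t))"
    unfolding sum_swap_invariant using trace_function_as_swaps[of F] by simp
  also have "\<dots> = (\<Sum>t\<in>swaps m n. ?g t + ?g (swap t))" by (simp add: sum.distrib)
  finally show ?thesis
    by (simp only:, intro sum.cong refl)
       (auto simp: swaps_def swap_def row_samples_def quadratic_form_outer_diff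
          sum_subtractf[symmetric] sum.distrib[symmetric] algebra_simps intro!: sum.cong)
qed

lemma eigenbasis_swap:
  assumes "(rs,p,j) \<in> swaps m n"
  shows "eigenbasis d (sample_deviation m n x rs) (lam rs) (v rs)"
    "eigenbasis d (sample_deviation m n x (rs[p := j])) (lam (rs[p := j])) (v (rs[p := j]))"
  using swap_in_swaps[OF assms] assms by (auto simp: swaps_def swap_def intro!: eig)

text \<open>For constant \<open>F\<close> every antisymmetrised summand vanishes. The result
  disposes of the trace of \<open>Y\<close> that is left over when 1 is split off from
  \<open>cosh\<close>.\<close>

lemma sum_eigenvalues_zero: "(\<Sum>rs\<in>row_samples m n. \<Sum>k<d. lam rs k) = 0"
proof -
  have "2 * real n * (\<Sum>rs\<in>row_samples m n. \<Sum>k<d. lam rs k * 1) = 0"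
    unfolding trace_function_antisymmetrised[of "\<lambda>_. 1"]
  proof (intro sum.neutral ballI, clarify)
    fix rs p j assume t: "(rs,p,j) \<in> swaps m n"
    then have rs: "rs \<in> row_samples m n" "p < m" by (auto simp: swaps_def)
    show "(\<Sum>k<d. 1 * ip d (v rs k) (mv d (outer_diff (rs ! p) j) (v rs k)))
      - (\<Sum>k<d. 1 * ip d (v (rs[p := j]) k) (mv d (outer_diff (rs ! p) j) (v (rs[p := j]) k))) = 0"
      by (subst trace_function_difference[OF eigenbasis_swap[OF t], where F = "\<lambda>_. 1"])
         (auto simp: sample_deviation_symmetric sample_deviation_swap[OF rs])
  qed
  then show ?thesis using n_pos by simp
qed

text \<open>The bound of \<open>trace_sinh_difference_le\<close> is symmetric in the two samples, so
  after summation over the involution its two halves are equal.\<close>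

lemma trace_sinh_le_swaps:
  assumes \<theta>: "0 \<le> \<theta>"
  shows "2 * real n * (\<Sum>rs\<in>row_samples m n. \<Sum>k<d. lam rs k * sinh (\<theta> * lam rs k))
    \<le> \<theta> * (\<Sum>(rs,p,j)\<in>swaps m n. \<Sum>k<d. cosh (\<theta> * lam rs k)
          * ip d (mv d (outer_diff (rs ! p) j) (v rs k)) (mv d (outer_diff (rs ! p) j) (v rs k)))"
proof -
  let ?h = "\<lambda>(rs,p,j). \<Sum>k<d. cosh (\<theta> * lam rs k)
          * ip d (mv d (outer_diff (rs ! p) j) (v rs k)) (mv d (outer_diff (rs ! p) j) (v rs k))"
  let ?g = "\<lambda>rs p j. (\<Sum>k<d. sinh (\<theta> * lam rs k) * ip d (v rs k) (mv d (outer_diff (rs ! p) j) (v rs k)))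
      - (\<Sum>k<d. sinh (\<theta> * lam (rs[p := j]) k)
          * ip d (v (rs[p := j]) k) (mv d (outer_diff (rs ! p) j) (v (rs[p := j]) k)))"
  have key: "?g rs p j \<le> \<theta> / 2 * (?h (rs,p,j) + ?h (swap (rs,p,j)))" if t: "(rs,p,j) \<in> swaps m n" for rs p j
  proof -
    have rs: "rs \<in> row_samples m n" "p < m" using t by (auto simp: swaps_def)
    then have l: "p < length rs" by (simp add: row_samples_def)
    \<comment> \<open>The partner exchange has \<open>outer_diff\<close> negated; its squared norms
      agree.\<close>
    have neg: "ip d (mv d (outer_diff j (rs ! p)) y) (mv d (outer_diff j (rs ! p)) y)
        = ip d (mv d (outer_diff (rs ! p) j) y) (mv d (outer_diff (rs ! p) j) y)" for y
      by (simp add: mv_diff_mat mv_outer ip_bilinear algebra_simps)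
    have "?g rs p j \<le> \<theta> / 2 * (
         (\<Sum>k<d. cosh (\<theta> * lam rs k)
          * ip d (mv d (outer_diff (rs ! p) j) (v rs k)) (mv d (outer_diff (rs ! p) j) (v rs k)))
       + (\<Sum>k<d. cosh (\<theta> * lam (rs[p := j]) k)
          * ip d (mv d (outer_diff (rs ! p) j) (v (rs[p := j]) k)) (mv d (outer_diff (rs ! p) j) (v (rs[p := j]) k))))"
      by (rule trace_sinh_difference_le[OF eigenbasis_swap[OF t] _ _ _ \<theta>])
         (auto simp: sample_deviation_symmetric sample_deviation_swap[OF rs])
    then show ?thesis using l by (simp add: swap_def neg)
  qed
  have "2 * real n * (\<Sum>rs\<in>row_samples m n. \<Sum>k<d. lam rs k * sinh (\<theta> * lam rs k))
      = (\<Sum>(rs,p,j)\<in>swaps m n. ?g rs p j)"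
    by (rule trace_function_antisymmetrised)
  also have "\<dots> \<le> (\<Sum>t\<in>swaps m n. \<theta> / 2 * (?h t + ?h (swap t)))"
  proof (rule sum_mono)
    fix t assume "t \<in> swaps m n"
    then show "(case t of (rs,p,j) \<Rightarrow> ?g rs p j) \<le> \<theta> / 2 * (?h t + ?h (swap t))"
      using key by (cases t) (simp only: prod.case)
  qed
  also have "\<dots> = \<theta> * (\<Sum>t\<in>swaps m n. ?h t)"
    unfolding sum_distrib_left[symmetric] sum.distrib sum_swap_invariant by simp
  finally show ?thesis .
qed

end

section \<open>The differential inequality for the sampling moment\<close>

lemma gronwall_exp_bound:
  fixes f g :: "real \<Rightarrow> real"
  assumes "0 \<le> T"
    and f: "\<And>t. 0 \<le> t \<Longrightarrow> t \<le> T \<Longrightarrow> (f has_real_derivative f' t) (at t)"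
    and g: "\<And>t. 0 \<le> t \<Longrightarrow> t \<le> T \<Longrightarrow> (g has_real_derivative g' t) (at t)"
    and le: "\<And>t. 0 \<le> t \<Longrightarrow> t \<le> T \<Longrightarrow> f' t \<le> g' t * f t"
  shows "f T \<le> f 0 * exp (g T - g 0)"
proof -
  have "(\<lambda>t. f t * exp (- g t)) T \<le> (\<lambda>t. f t * exp (- g t)) 0"
  proof (rule DERIV_nonpos_imp_nonincreasing[OF assms(1)])
    fix t assume t: "0 \<le> t" "t \<le> T"
    have "((\<lambda>t. f t * exp (- g t)) has_real_derivative (f' t - g' t * f t) * exp (- g t)) (at t)"
      by (auto intro!: derivative_eq_intros f[OF t] g[OF t] simp: algebra_simps)
    moreover have "(f' t - g' t * f t) * exp (- g t) \<le> 0"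
      using le[OF t] by (simp add: mult_nonpos_nonneg)
    ultimately show "\<exists>y. ((\<lambda>t. f t * exp (- g t)) has_real_derivative y) (at t) \<and> y \<le> 0" by blast
  qed
  then have "f T * exp (- g T) * exp (g T) \<le> f 0 * exp (- g 0) * exp (g T)"
    by (simp add: mult_right_mono)
  then show ?thesis by (simp add: exp_diff exp_minus field_simps)
qed

text \<open>\<open>cosh - sinh\<close> is at most 1 at a nonnegative argument. This converts
  \<open>Y\<close> times \<open>cosh - 1\<close> back into the integrand of the derivative, whatever
  the sign of the eigenvalue.\<close>

lemma abs_mult_cosh_minus_one_le:
  fixes l \<theta> :: real
  assumes "0 \<le> \<theta>"
  shows "\<bar>l\<bar> * (cosh (\<theta> * l) - 1) \<le> l * sinh (\<theta> * l)"
proof -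
  have "cosh \<bar>\<theta> * l\<bar> - sinh \<bar>\<theta> * l\<bar> \<le> 1" by (subst cosh_minus_sinh) simp
  then have "\<bar>l\<bar> * (cosh \<bar>\<theta> * l\<bar> - 1) \<le> \<bar>l\<bar> * sinh \<bar>\<theta> * l\<bar>" by (intro mult_left_mono) auto
  also have "\<dots> = l * sinh (\<theta> * l)"
    using assms by (cases "l \<ge> 0") (simp_all add: abs_mult)
  finally show ?thesis by simp
qed

context row_sampling
begin

text \<open>A sum over samples instead of an expectation, so \<open>de\<close> is always accompanied
  by \<open>card (row_samples m n)\<close>. The inner sum extends over \<open>- 1\<close> too; hence
  the value at 0 is 0.\<close>

definition excess :: "real \<Rightarrow> real" where
  "excess \<theta> = (\<Sum>rs\<in>row_samples m n. \<Sum>k<d. cosh (\<theta> * lam rs k) - 1)"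

definition excess_deriv :: "real \<Rightarrow> real" where
  "excess_deriv \<theta> = (\<Sum>rs\<in>row_samples m n. \<Sum>k<d. lam rs k * sinh (\<theta> * lam rs k))"

lemma excess_has_derivative: "(excess has_real_derivative excess_deriv \<theta>) (at \<theta>)"
  unfolding excess_def[abs_def] excess_deriv_def
  by (auto intro!: derivative_eq_intros sum.cong)

lemma B_nonneg: "0 \<le> B"
  using row_bound[OF n_pos] ip_self_nonneg[of d "x 0"] by linarith

text \<open>The part \<open>cosh - 1\<close> is paired with the operator norm, whereas the constant
  1 meets only the trace of the Gram matrix. That is how \<open>de\<close> enters and
  \<open>d\<close> does not.\<close>

lemma sum_cosh_deviation_le:
  "(\<Sum>rs\<in>row_samples m n. \<Sum>k<d. cosh (\<theta> * lam rs k) * (\<Sum>r<n. (ip d (x r) (v rs k))\<^sup>2))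
    \<le> real n * s2 * (excess \<theta> + real (card (row_samples m n)) * de)"
proof -
  define S where "S rs k = (\<Sum>r<n. (ip d (x r) (v rs k))\<^sup>2)" for rs k
  have S1: "S rs k \<le> real n * s2" if "rs \<in> row_samples m n" "k < d" for rs k
    using operator_bound[of "v rs k"] eig[OF that(1)] that(2)
    by (simp add: S_def eigenbasis_def orthonormal_def)
  have S2: "(\<Sum>k<d. S rs k) = real n * s2 * de" if "rs \<in> row_samples m n" for rs
  proof -
    have "(\<Sum>k<d. S rs k) = (\<Sum>r<n. \<Sum>k<d. (ip d (x r) (v rs k))\<^sup>2)"
      unfolding S_def by (rule sum.swap)
    also have "\<dots> = (\<Sum>r<n. ip d (x r) (x r))"
      using eig[OF that] by (simp add: parseval_norm eigenbasis_def)
    finally show ?thesis by (simp add: trace)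
  qed
  have "(\<Sum>rs\<in>row_samples m n. \<Sum>k<d. cosh (\<theta> * lam rs k) * S rs k)
      = (\<Sum>rs\<in>row_samples m n. (\<Sum>k<d. (cosh (\<theta> * lam rs k) - 1) * S rs k) + (\<Sum>k<d. S rs k))"
    by (simp add: sum.distrib[symmetric] algebra_simps)
  also have "\<dots> \<le> (\<Sum>rs\<in>row_samples m n. (\<Sum>k<d. (cosh (\<theta> * lam rs k) - 1) * (real n * s2)) + real n * s2 * de)"
    by (intro sum_mono add_mono mult_left_mono S1) (auto simp: S2 cosh_real_ge_1)
  also have "\<dots> = real n * s2 * (excess \<theta> + real (card (row_samples m n)) * de)"
    unfolding sum_distrib_right[symmetric] sum.distrib excess_def[symmetric] by (simp add: algebra_simps)
  finally show ?thesis unfolding S_def .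
qed

text \<open>The summed squares of the exchanges are bounded by a combination of \<open>Y\<close> and
  the full Gram matrix. Against \<open>cosh\<close> the first yields the derivative again, the
  second yields \<open>excess\<close> and the trace.\<close>

lemma excess_deriv_le:
  assumes \<theta>: "0 \<le> \<theta>"
  shows "excess_deriv \<theta> \<le> \<theta> * B * (excess_deriv \<theta>
      + 2 * real m * s2 * (excess \<theta> + real (card (row_samples m n)) * de))"
proof -
  define S where "S rs k = (\<Sum>r<n. (ip d (x r) (v rs k))\<^sup>2)" for rs k
  define D where "D rs p j k = ip d (mv d (outer_diff (rs ! p) j) (v rs k)) (mv d (outer_diff (rs ! p) j) (v rs k))"
    for rs p j k
  have D: "(\<Sum>p<m. \<Sum>j\<in>{..<n} - set rs. D rs p j k)
      \<le> 2 * B * ((real n - 2 * real m) * lam rs k + 2 * real m * S rs k)"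
    if rs: "rs \<in> row_samples m n" and k: "k < d" for rs k
  proof -
    let ?h = "\<lambda>r. (ip d (x r) (v rs k))\<^sup>2"
    have "(\<Sum>p<m. \<Sum>j\<in>{..<n} - set rs. D rs p j k)
        \<le> (\<Sum>p<m. \<Sum>j\<in>{..<n} - set rs. 2 * B * (?h (rs ! p) + ?h j))"
      unfolding D_def using rs
      by (intro sum_mono norm_outer_diff_le) (force simp: row_samples_def)+
    also have "\<dots> = 2 * B * ((real n - 2 * real m) * (\<Sum>p<m. ?h (rs ! p)) + real m * S rs k)"
      unfolding sum_distrib_left[symmetric] sum_sampled_plus_unsampled[OF rs, where h = ?h] S_def ..
    also have "(\<Sum>p<m. ?h (rs ! p)) = lam rs k + real m / real n * S rs k"
      using eigenvalue_quadratic_form[OF that] by (simp add: S_def)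
    also have "(real n - 2 * real m) * (lam rs k + real m / real n * S rs k) + real m * S rs k
        = (real n - 2 * real m) * lam rs k + 2 * real m * S rs k - 2 * real m * real m / real n * S rs k"
      using n_pos by (simp add: field_simps)
    also have "\<dots> \<le> (real n - 2 * real m) * lam rs k + 2 * real m * S rs k"
      by (simp add: S_def sum_nonneg)
    finally show ?thesis using B_nonneg by (simp add: mult_left_mono)
  qed
  have "2 * real n * excess_deriv \<theta>
      \<le> \<theta> * (\<Sum>(rs,p,j)\<in>swaps m n. \<Sum>k<d. cosh (\<theta> * lam rs k) * D rs p j k)"
    unfolding excess_deriv_def D_def by (rule trace_sinh_le_swaps[OF \<theta>])
  also have "(\<Sum>(rs,p,j)\<in>swaps m n. \<Sum>k<d. cosh (\<theta> * lam rs k) * D rs p j k)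
      = (\<Sum>rs\<in>row_samples m n. \<Sum>k<d. cosh (\<theta> * lam rs k) * (\<Sum>p<m. \<Sum>j\<in>{..<n} - set rs. D rs p j k))"
    unfolding sum_swaps sum_distrib_left
    by (rule sum.cong[OF refl], subst (2) sum.swap, rule sum.cong[OF refl], rule sum.swap)
  also have "\<dots> \<le> (\<Sum>rs\<in>row_samples m n. \<Sum>k<d. cosh (\<theta> * lam rs k)
        * (2 * B * ((real n - 2 * real m) * lam rs k + 2 * real m * S rs k)))"
    by (intro sum_mono mult_left_mono D) auto
  \<comment> \<open>In the term linear in \<open>Y\<close>, \<open>cosh\<close> is split into
    \<open>cosh - 1\<close> and 1: the former is absorbed by the derivative, the latter sums to zero
    over all samples.\<close>
  also have "\<dots> = 2 * B * ((\<Sum>rs\<in>row_samples m n. \<Sum>k<d. (real n - 2 * real m) * (lam rs k * (cosh (\<theta> * lam rs k) - 1)))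
      + (real n - 2 * real m) * (\<Sum>rs\<in>row_samples m n. \<Sum>k<d. lam rs k)
      + 2 * real m * (\<Sum>rs\<in>row_samples m n. \<Sum>k<d. cosh (\<theta> * lam rs k) * S rs k))"
    unfolding sum_distrib_left sum.distrib[symmetric]
    by (intro sum.cong refl) (simp add: algebra_simps)
  also have "\<dots> \<le> 2 * B * (real n * excess_deriv \<theta>
      + 2 * real m * (real n * s2 * (excess \<theta> + real (card (row_samples m n)) * de)))"
  proof -
    \<comment> \<open>Uses \<open>\<bar>n - 2 * m\<bar> \<le> n\<close>, which covers both signs of
      \<open>n - 2 * m\<close>.\<close>
    have "(real n - 2 * real m) * (lam rs k * (cosh (\<theta> * lam rs k) - 1)) \<le> real n * (lam rs k * sinh (\<theta> * lam rs k))"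
      for rs k
    proof -
      have "(real n - 2 * real m) * (lam rs k * (cosh (\<theta> * lam rs k) - 1))
          \<le> \<bar>(real n - 2 * real m) * (lam rs k * (cosh (\<theta> * lam rs k) - 1))\<bar>" by simp
      also have "\<dots> = \<bar>real n - 2 * real m\<bar> * (\<bar>lam rs k\<bar> * (cosh (\<theta> * lam rs k) - 1))"
        by (simp add: abs_mult cosh_real_ge_1)
      also have "\<dots> \<le> real n * (lam rs k * sinh (\<theta> * lam rs k))"
        using m_le by (intro mult_mono abs_mult_cosh_minus_one_le \<theta>) (auto simp: cosh_real_ge_1)
      finally show ?thesis .
    qed
    then have "(\<Sum>rs\<in>row_samples m n. \<Sum>k<d. (real n - 2 * real m) * (lam rs k * (cosh (\<theta> * lam rs k) - 1)))
        \<le> real n * excess_deriv \<theta>"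
      unfolding excess_deriv_def sum_distrib_left by (intro sum_mono)
    moreover have "2 * real m * (\<Sum>rs\<in>row_samples m n. \<Sum>k<d. cosh (\<theta> * lam rs k) * S rs k)
        \<le> 2 * real m * (real n * s2 * (excess \<theta> + real (card (row_samples m n)) * de))"
      unfolding S_def by (intro mult_left_mono sum_cosh_deviation_le) auto
    ultimately show ?thesis
      using B_nonneg sum_eigenvalues_zero by (intro mult_left_mono) auto
  qed
  finally have "2 * real n * excess_deriv \<theta> \<le> \<theta> * (2 * B * (real n * excess_deriv \<theta>
      + 2 * real m * (real n * s2 * (excess \<theta> + real (card (row_samples m n)) * de))))"
    using \<theta> by (simp add: mult_left_mono)
  also have "\<dots> = 2 * real n * (\<theta> * B * (excess_deriv \<theta>
      + 2 * real m * s2 * (excess \<theta> + real (card (row_samples m n)) * de)))"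
    by (simp add: algebra_simps)
  finally show ?thesis using n_pos by (simp add: mult_le_cancel_left_pos)
qed

lemma excess_deriv_nonneg: "0 \<le> \<theta> \<Longrightarrow> 0 \<le> excess_deriv \<theta>"
  unfolding excess_deriv_def
  by (intro sum_nonneg) (metis abs_ge_zero abs_mult_cosh_minus_one_le cosh_real_ge_1 diff_ge_0_iff_ge
      mult_nonneg_nonneg order_trans)

text \<open>As the derivative is nonnegative, the coefficient \<open>1 - t * B\<close> may be frozen
  at its smallest value \<open>1 - \<theta> * B\<close>. The comparison function is then the
  quadratic \<open>a * t\<^sup>2\<close>, which produces the factor
  \<open>\<theta>\<^sup>2\<close>.\<close>

lemma excess_le:
  assumes \<theta>: "0 \<le> \<theta>" "\<theta> * B < 1"
  shows "excess \<theta> + real (card (row_samples m n)) * de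
    \<le> real (card (row_samples m n)) * de * exp (B * real m * s2 * \<theta>\<^sup>2 / (1 - \<theta> * B))"
proof -
  define Nd where "Nd = real (card (row_samples m n)) * de"
  define a where "a = B * real m * s2 / (1 - \<theta> * B)"
  have "(\<lambda>t. excess t + Nd) \<theta> \<le> (\<lambda>t. excess t + Nd) 0 * exp ((\<lambda>t. a * t\<^sup>2) \<theta> - (\<lambda>t. a * t\<^sup>2) 0)"
  proof (rule gronwall_exp_bound[OF \<theta>(1)])
    fix t assume t: "0 \<le> t" "t \<le> \<theta>"
    show "((\<lambda>t. excess t + Nd) has_real_derivative excess_deriv t) (at t)"
      by (auto intro!: derivative_eq_intros excess_has_derivative)
    show "((\<lambda>t. a * t\<^sup>2) has_real_derivative 2 * a * t) (at t)"
      by (auto intro!: derivative_eq_intros)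
    have "t * B \<le> \<theta> * B" using t B_nonneg by (intro mult_right_mono)
    then have "excess_deriv t * (1 - \<theta> * B) \<le> excess_deriv t * (1 - t * B)"
      using excess_deriv_nonneg[OF t(1)] by (intro mult_left_mono) auto
    also have "\<dots> \<le> 2 * B * real m * s2 * t * (excess t + Nd)"
      using excess_deriv_le[OF t(1)] by (simp add: Nd_def algebra_simps)
    finally show "excess_deriv t \<le> 2 * a * t * (excess t + Nd)"
      using \<theta>(2) by (simp add: a_def field_simps)
  qed
  then show ?thesis by (simp add: Nd_def a_def excess_def mult_ac)
qed

text \<open>Markov's inequality for \<open>cosh - 1\<close>: one large eigenvalue of either sign
  suffices, because all others contribute nonnegative amounts.\<close>

lemma large_deviation_count:
  assumes \<theta>: "0 \<le> \<theta>" "\<theta> * B < 1" and \<tau>: "0 \<le> \<tau>" and de: "0 \<le> de"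
  shows "real (card {rs \<in> row_samples m n. \<exists>k<d. \<bar>lam rs k\<bar> > \<tau>}) * (cosh (\<theta> * \<tau>) - 1)
    \<le> real (card (row_samples m n)) * de * exp (B * real m * s2 * \<theta>\<^sup>2 / (1 - \<theta> * B))"
proof -
  let ?bad = "{rs \<in> row_samples m n. \<exists>k<d. \<bar>lam rs k\<bar> > \<tau>}"
  have "real (card ?bad) * (cosh (\<theta> * \<tau>) - 1) = (\<Sum>rs\<in>?bad. cosh (\<theta> * \<tau>) - 1)" by simp
  also have "\<dots> \<le> (\<Sum>rs\<in>?bad. \<Sum>k<d. cosh (\<theta> * lam rs k) - 1)"
  proof (rule sum_mono)
    fix rs assume "rs \<in> ?bad"
    then obtain k where k: "k < d" "\<bar>lam rs k\<bar> > \<tau>" by auto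
    have "cosh (\<theta> * \<tau>) \<le> cosh \<bar>\<theta> * lam rs k\<bar>"
      using k \<theta> \<tau> by (subst cosh_real_nonneg_le_iff) (auto simp: abs_mult intro!: mult_left_mono)
    then have "cosh (\<theta> * \<tau>) - 1 \<le> cosh (\<theta> * lam rs k) - 1" by simp
    also have "\<dots> \<le> (\<Sum>k<d. cosh (\<theta> * lam rs k) - 1)"
      using k by (intro member_le_sum[where f = "\<lambda>k. cosh (\<theta> * lam rs k) - 1"]) (auto simp: cosh_real_ge_1)
    finally show "cosh (\<theta> * \<tau>) - 1 \<le> (\<Sum>k<d. cosh (\<theta> * lam rs k) - 1)" .
  qed
  also have "\<dots> \<le> excess \<theta>"
    unfolding excess_def using finite_row_samples
    by (intro sum_mono2 sum_nonneg) (auto simp: cosh_real_ge_1)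
  also have "\<dots> \<le> excess \<theta> + real (card (row_samples m n)) * de" using de by simp
  finally show ?thesis using excess_le[OF \<theta>] by linarith
qed

end

subsection \<open>Norms of Rademacher sums\<close>

lemma finite_sign_vectors: "finite (sign_vectors n)"
  by (rule finite_subset[OF _ finite_lists_length_eq[of "{-1,1}" n]]) (auto simp: sign_vectors_def)

lemma sign_vectors_nth:
  assumes "es \<in> sign_vectors n" "j < n"
  shows "es ! j = - 1 \<or> es ! j = 1"
  using assms nth_mem[of j es] unfolding sign_vectors_def by blast

lemma sign_vectors_nth_square:
  assumes "es \<in> sign_vectors n" "j < n"
  shows "es ! j * es ! j = 1"
  using sign_vectors_nth[OF assms] by auto

definition flip_sign :: "nat \<Rightarrow> real list \<Rightarrow> real list" where
  "flip_sign j es = es[j := - (es ! j)]"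

lemma flip_sign_in: "es \<in> sign_vectors n \<Longrightarrow> j < n \<Longrightarrow> flip_sign j es \<in> sign_vectors n"
  using sign_vectors_nth[of es n j] set_update_subset_insert[of es j "- (es ! j)"]
  by (fastforce simp: sign_vectors_def flip_sign_def)

lemma flip_sign_flip_sign: "flip_sign j (flip_sign j es) = es"
  by (cases "j < length es") (simp_all add: flip_sign_def list_update_beyond)

lemma sum_flip_sign:
  fixes g :: "real list \<Rightarrow> real"
  assumes "j < n"
  shows "(\<Sum>es\<in>sign_vectors n. g (flip_sign j es)) = (\<Sum>es\<in>sign_vectors n. g es)"
  by (rule sum.reindex_bij_witness[of _ "flip_sign j" "flip_sign j"])
     (auto simp: flip_sign_flip_sign flip_sign_in assms)

text \<open>The logarithmic mean of \<open>exp x\<close> and \<open>exp y\<close> is at most their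
  arithmetic mean, written without division.\<close>

lemma exp_diff_le_mean:
  fixes x y :: real
  shows "(x - y) * (exp x - exp y) \<le> (x - y)\<^sup>2 / 2 * (exp x + exp y)"
proof -
  define u h where "u = (x + y) / 2" and "h = (x - y) / 2"
  have e: "x = u + h" "y = u - h" by (simp_all add: u_def h_def field_simps)
  have s: "exp x - exp y = 2 * exp u * sinh h" "exp x + exp y = 2 * exp u * cosh h"
    unfolding e exp_add exp_diff sinh_def cosh_def by (simp_all add: exp_minus field_simps)
  have "(x - y) * (exp x - exp y) = 4 * exp u * (h * sinh h)" by (simp add: s h_def)
  also have "\<dots> \<le> 4 * exp u * (h\<^sup>2 * cosh h)" by (intro mult_left_mono mult_sinh_le) auto
  also have "\<dots> = (x - y)\<^sup>2 / 2 * (exp x + exp y)" by (simp add: s h_def power2_eq_square)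
  finally show ?thesis .
qed

lemma zero_le_mult_iff_pos: "0 < a \<Longrightarrow> 0 \<le> a * b \<longleftrightarrow> 0 \<le> (b :: real)"
  by (simp add: zero_le_mult_iff)

text \<open>For the matrix with rows \<open>w j\<close>, \<open>L2\<close> bounds the squared
  operator norm and \<open>F2\<close> is the squared Frobenius norm; the tail bound takes
  \<open>L2 = s2\<close> and \<open>F2 = s2 * de\<close>.\<close>

locale rademacher_sum =
  fixes n d :: nat and w :: "nat \<Rightarrow> nat \<Rightarrow> real" and L2 F2 :: real
  assumes operator_bound: "(\<Sum>j<n. (ip d (w j) y)\<^sup>2) \<le> L2 * ip d y y"
    and F2: "(\<Sum>j<n. ip d (w j) (w j)) = F2"
begin

definition signed_sum :: "real list \<Rightarrow> nat \<Rightarrow> real" where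
  "signed_sum es = (\<lambda>i. \<Sum>j<n. es ! j * w j i)"

definition sq_norm :: "real list \<Rightarrow> real" where
  "sq_norm es = ip d (signed_sum es) (signed_sum es)"

text \<open>For \<open>j < n\<close>, the inner product of \<open>w j\<close> with the signed sum
  over the other indices; it does not depend on sign \<open>j\<close>.\<close>

definition residual :: "nat \<Rightarrow> real list \<Rightarrow> real" where
  "residual j es = ip d (w j) (signed_sum es) - es ! j * ip d (w j) (w j)"

lemma signed_sum_flip:
  assumes "es \<in> sign_vectors n" "j < n"
  shows "signed_sum (flip_sign j es) = (\<lambda>i. signed_sum es i - 2 * es ! j * w j i)"
proof
  fix i
  have "signed_sum es i - signed_sum (flip_sign j es) i
      = (\<Sum>k<n. if k = j then 2 * es ! j * w j i else 0)"
    unfolding signed_sum_def sum_subtractf[symmetric] using assms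
    by (intro sum.cong) (auto simp: flip_sign_def nth_list_update sign_vectors_def)
  also have "\<dots> = 2 * es ! j * w j i" using assms(2) by simp
  finally show "signed_sum (flip_sign j es) i = signed_sum es i - 2 * es ! j * w j i" by simp
qed

lemma residual_flip:
  assumes "es \<in> sign_vectors n" "j < n"
  shows "residual j (flip_sign j es) = residual j es"
  using assms by (simp add: residual_def signed_sum_flip[OF assms] ip_bilinear)
     (simp add: flip_sign_def sign_vectors_def)

lemma sq_norm_flip:
  assumes "es \<in> sign_vectors n" "j < n"
  shows "sq_norm (flip_sign j es) = sq_norm es - 4 * (es ! j * residual j es)"
proof -
  have "sq_norm (flip_sign j es) = sq_norm es - 4 * (es ! j * ip d (w j) (signed_sum es))
      + 4 * (es ! j * es ! j) * ip d (w j) (w j)"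
    unfolding sq_norm_def signed_sum_flip[OF assms]
    by (simp add: ip_bilinear ip_commute[of d "signed_sum es" "w j"] algebra_simps)
  also have "\<dots> = sq_norm es - 4 * (es ! j * ip d (w j) (signed_sum es))
      + 4 * (es ! j * (es ! j * ip d (w j) (w j)))"
    by simp
  finally show ?thesis by (simp add: residual_def right_diff_distrib)
qed

text \<open>The flip negates \<open>es ! j * residual j es\<close>. Half the sum over flip pairs is
  therefore this quantity times a difference of exponentials, which has the same sign as the
  quantity and is controlled by \<open>exp_diff_le_mean\<close>.\<close>

lemma
  assumes j: "j < n" and \<mu>: "0 \<le> \<mu>"
  shows tilted_correlation_nonneg:
      "0 \<le> (\<Sum>es\<in>sign_vectors n. exp (\<mu> * sq_norm es) * (es ! j * residual j es))"
    and tilted_correlation_le: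
      "(\<Sum>es\<in>sign_vectors n. exp (\<mu> * sq_norm es) * (es ! j * residual j es))
       \<le> 2 * \<mu> * (\<Sum>es\<in>sign_vectors n. exp (\<mu> * sq_norm es) * (residual j es)\<^sup>2)"
proof -
  let ?E = "\<lambda>es. exp (\<mu> * sq_norm es)" and ?c = "\<lambda>es. es ! j * residual j es"
  have c: "?c (flip_sign j es) = - ?c es" if "es \<in> sign_vectors n" for es
    using that j residual_flip[OF that j] by (auto simp: flip_sign_def sign_vectors_def)
  have sq: "(es ! j)\<^sup>2 = 1" if "es \<in> sign_vectors n" for es
    using sign_vectors_nth_square[OF that j] by (simp add: power2_eq_square)
  have pair: "2 * (\<Sum>es\<in>sign_vectors n. g es) = (\<Sum>es\<in>sign_vectors n. g es + g (flip_sign j es))" for g :: "real list \<Rightarrow> real"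
    by (simp add: sum.distrib sum_flip_sign[OF j])
  have step: "0 \<le> ?c es * (?E es - ?E (flip_sign j es))"
     "?c es * (?E es - ?E (flip_sign j es)) \<le> 2 * \<mu> * (?c es)\<^sup>2 * (?E es + ?E (flip_sign j es))"
    if es: "es \<in> sign_vectors n" for es
  proof -
    let ?x = "\<mu> * sq_norm es" and ?y = "\<mu> * sq_norm (flip_sign j es)"
    have xy: "?x - ?y = 4 * \<mu> * ?c es" unfolding sq_norm_flip[OF es j] by (simp add: algebra_simps)
    have "0 \<le> ?c es * (exp ?x - exp ?y) \<and> ?c es * (exp ?x - exp ?y) \<le> 2 * \<mu> * (?c es)\<^sup>2 * (exp ?x + exp ?y)"
    proof (cases "\<mu> = 0")
      case False
      then have pos: "4 * \<mu> > 0" using \<mu> by simp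
      have "0 \<le> (?x - ?y) * (exp ?x - exp ?y)"
        by (cases "?x \<le> ?y") (auto simp: mult_nonpos_nonpos)
      then have "0 \<le> 4 * \<mu> * (?c es * (exp ?x - exp ?y))" unfolding xy by (simp only: mult.assoc)
      then have 1: "0 \<le> ?c es * (exp ?x - exp ?y)" by (rule zero_le_mult_iff_pos[OF pos, THEN iffD1])
      have "4 * \<mu> * (?c es * (exp ?x - exp ?y)) \<le> (4 * \<mu> * ?c es)\<^sup>2 / 2 * (exp ?x + exp ?y)"
        using exp_diff_le_mean[of ?x ?y] unfolding xy by (simp only: mult.assoc)
      also have "\<dots> = 4 * \<mu> * (2 * \<mu> * (?c es)\<^sup>2 * (exp ?x + exp ?y))"
        by (simp add: power2_eq_square)
      finally show ?thesis using 1 mult_le_cancel_left_pos[OF pos] by blast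
    qed simp
    then show "0 \<le> ?c es * (?E es - ?E (flip_sign j es))"
     "?c es * (?E es - ?E (flip_sign j es)) \<le> 2 * \<mu> * (?c es)\<^sup>2 * (?E es + ?E (flip_sign j es))" by auto
  qed
  have l: "2 * (\<Sum>es\<in>sign_vectors n. ?E es * ?c es)
      = (\<Sum>es\<in>sign_vectors n. ?c es * (?E es - ?E (flip_sign j es)))"
    unfolding pair by (intro sum.cong refl) (simp add: c algebra_simps del: mult_minus_left mult_minus_right)
  also have "\<dots> \<ge> 0" by (intro sum_nonneg step)
  finally show "0 \<le> (\<Sum>es\<in>sign_vectors n. ?E es * ?c es)" by simp
  have "2 * (\<Sum>es\<in>sign_vectors n. ?E es * ?c es)
      \<le> (\<Sum>es\<in>sign_vectors n. 2 * \<mu> * (?c es)\<^sup>2 * (?E es + ?E (flip_sign j es)))"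
    unfolding l by (intro sum_mono step)
  also have "\<dots> = 2 * (\<Sum>es\<in>sign_vectors n. 2 * \<mu> * (?E es * (residual j es)\<^sup>2))"
    unfolding pair using residual_flip[OF _ j]
    by (intro sum.cong refl) (simp add: power_mult_distrib sq algebra_simps)
  finally show "(\<Sum>es\<in>sign_vectors n. ?E es * ?c es)
       \<le> 2 * \<mu> * (\<Sum>es\<in>sign_vectors n. ?E es * (residual j es)\<^sup>2)"
    by (simp add: sum_distrib_left[symmetric])
qed

lemma sq_norm_expand:
  assumes "es \<in> sign_vectors n"
  shows "sq_norm es = (\<Sum>j<n. es ! j * residual j es) + F2"
proof -
  have "sq_norm es = (\<Sum>j<n. es ! j * ip d (w j) (signed_sum es))"
    unfolding sq_norm_def by (subst (1) signed_sum_def) (simp add: ip_sum_left ip_bilinear)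
  also have "\<dots> = (\<Sum>j<n. es ! j * residual j es + ip d (w j) (w j))"
    using sign_vectors_nth_square[OF assms]
    by (intro sum.cong) (auto simp: residual_def right_diff_distrib simp flip: mult.assoc)
  finally show ?thesis by (simp add: sum.distrib F2)
qed

text \<open>Expanding the square of residual plus diagonal part. The cross term stays on the left,
  since its tilted sum is nonnegative by \<open>tilted_correlation_nonneg\<close>.\<close>

lemma sum_residual_le:
  assumes "es \<in> sign_vectors n"
  shows "(\<Sum>j<n. (residual j es)\<^sup>2) + (\<Sum>j<n. 2 * ip d (w j) (w j) * (es ! j * residual j es)) \<le> L2 * sq_norm es"
proof -
  have "(residual j es)\<^sup>2 + 2 * ip d (w j) (w j) * (es ! j * residual j es) \<le> (ip d (w j) (signed_sum es))\<^sup>2"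
    if "j < n" for j
  proof -
    have "(ip d (w j) (signed_sum es))\<^sup>2 = (residual j es + es ! j * ip d (w j) (w j))\<^sup>2"
      by (simp add: residual_def)
    also have "\<dots> = (residual j es)\<^sup>2 + 2 * ip d (w j) (w j) * (es ! j * residual j es)
        + (es ! j * ip d (w j) (w j))\<^sup>2"
      by (simp add: power2_sum)
    finally show ?thesis by simp
  qed
  then have "(\<Sum>j<n. (residual j es)\<^sup>2) + (\<Sum>j<n. 2 * ip d (w j) (w j) * (es ! j * residual j es))
      \<le> (\<Sum>j<n. (ip d (w j) (signed_sum es))\<^sup>2)"
    unfolding sum.distrib[symmetric] by (intro sum_mono) auto
  also have "\<dots> \<le> L2 * sq_norm es" unfolding sq_norm_def by (rule operator_bound)
  finally show ?thesis .
qed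

definition mgf :: "real \<Rightarrow> real" where
  "mgf \<mu> = (\<Sum>es\<in>sign_vectors n. exp (\<mu> * sq_norm es))"

definition mgf_deriv :: "real \<Rightarrow> real" where
  "mgf_deriv \<mu> = (\<Sum>es\<in>sign_vectors n. exp (\<mu> * sq_norm es) * sq_norm es)"

lemma mgf_has_derivative: "(mgf has_real_derivative mgf_deriv \<mu>) (at \<mu>)"
  unfolding mgf_def[abs_def] mgf_deriv_def
  by (auto intro!: derivative_eq_intros sum.cong)

lemma mgf_deriv_le:
  assumes \<mu>: "0 \<le> \<mu>"
  shows "mgf_deriv \<mu> \<le> F2 * mgf \<mu> + 2 * \<mu> * L2 * mgf_deriv \<mu>"
proof -
  let ?E = "\<lambda>es. exp (\<mu> * sq_norm es)"
  \<comment> \<open>Nonnegative cross terms are added to complete the squares, so that the operator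
    bound applies for each sign vector.\<close>
  have "(\<Sum>j<n. \<Sum>es\<in>sign_vectors n. ?E es * (residual j es)\<^sup>2)
      \<le> (\<Sum>j<n. \<Sum>es\<in>sign_vectors n. ?E es * (residual j es)\<^sup>2)
        + (\<Sum>j<n. 2 * ip d (w j) (w j) * (\<Sum>es\<in>sign_vectors n. ?E es * (es ! j * residual j es)))"
    by (simp, intro sum_nonneg mult_nonneg_nonneg tilted_correlation_nonneg \<mu> ip_self_nonneg) auto
  also have "\<dots> = (\<Sum>es\<in>sign_vectors n. ?E es *
        ((\<Sum>j<n. (residual j es)\<^sup>2) + (\<Sum>j<n. 2 * ip d (w j) (w j) * (es ! j * residual j es))))"
  proof -
    have "(\<Sum>j<n. 2 * ip d (w j) (w j) * (\<Sum>es\<in>sign_vectors n. ?E es * (es ! j * residual j es)))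
        = (\<Sum>j<n. \<Sum>es\<in>sign_vectors n. ?E es * (2 * ip d (w j) (w j) * (es ! j * residual j es)))"
      unfolding sum_distrib_left by (intro sum.cong refl) (simp only: mult_ac)
    also have "\<dots> = (\<Sum>es\<in>sign_vectors n. \<Sum>j<n. ?E es * (2 * ip d (w j) (w j) * (es ! j * residual j es)))"
      by (rule sum.swap)
    finally show ?thesis
      using sum.swap[of "\<lambda>j es. ?E es * (residual j es)\<^sup>2" "sign_vectors n" "{..<n}"]
      by (simp only: sum_distrib_left distrib_left sum.distrib)
  qed
  also have "\<dots> \<le> (\<Sum>es\<in>sign_vectors n. ?E es * (L2 * sq_norm es))"
    by (intro sum_mono mult_left_mono sum_residual_le) auto
  also have "\<dots> = L2 * mgf_deriv \<mu>"
    by (simp add: mgf_deriv_def sum_distrib_left mult_ac)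
  finally have R: "(\<Sum>j<n. \<Sum>es\<in>sign_vectors n. ?E es * (residual j es)\<^sup>2) \<le> L2 * mgf_deriv \<mu>" .
  have e: "mgf_deriv \<mu> = (\<Sum>es\<in>sign_vectors n. \<Sum>j<n. ?E es * (es ! j * residual j es)) + F2 * mgf \<mu>"
  proof -
    have "mgf_deriv \<mu> = (\<Sum>es\<in>sign_vectors n. ?E es * (\<Sum>j<n. es ! j * residual j es) + F2 * ?E es)"
      unfolding mgf_deriv_def by (intro sum.cong refl) (simp add: sq_norm_expand distrib_left)
    then show ?thesis by (simp only: sum.distrib sum_distrib_left mgf_def)
  qed
  have "(\<Sum>es\<in>sign_vectors n. \<Sum>j<n. ?E es * (es ! j * residual j es))
      = (\<Sum>j<n. \<Sum>es\<in>sign_vectors n. ?E es * (es ! j * residual j es))" by (rule sum.swap)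
  also have "\<dots> \<le> (\<Sum>j<n. 2 * \<mu> * (\<Sum>es\<in>sign_vectors n. ?E es * (residual j es)\<^sup>2))"
    by (intro sum_mono tilted_correlation_le \<mu>) auto
  also have "\<dots> = 2 * \<mu> * (\<Sum>j<n. \<Sum>es\<in>sign_vectors n. ?E es * (residual j es)\<^sup>2)"
    by (rule sum_distrib_left[symmetric])
  also have "\<dots> \<le> 2 * \<mu> * (L2 * mgf_deriv \<mu>)" using R \<mu> by (intro mult_left_mono) auto
  finally show ?thesis using e by simp
qed

text \<open>The coefficient is frozen at the right end as in \<open>excess_le\<close>; here the
  comparison function is linear.\<close>

lemma mgf_le:
  assumes \<mu>: "0 \<le> \<mu>" "2 * \<mu> * L2 < 1" and L2: "0 \<le> L2"
  shows "mgf \<mu> \<le> real (card (sign_vectors n)) * exp (\<mu> * F2 / (1 - 2 * \<mu> * L2))"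
proof -
  define b where "b = F2 / (1 - 2 * \<mu> * L2)"
  have "mgf \<mu> \<le> mgf 0 * exp ((\<lambda>t. b * t) \<mu> - (\<lambda>t. b * t) 0)"
  proof (rule gronwall_exp_bound[OF \<mu>(1)])
    fix t assume t: "0 \<le> t" "t \<le> \<mu>"
    show "(mgf has_real_derivative mgf_deriv t) (at t)" by (rule mgf_has_derivative)
    show "((\<lambda>t. b * t) has_real_derivative b) (at t)" by (auto intro!: derivative_eq_intros)
    have nn: "0 \<le> mgf_deriv t" unfolding mgf_deriv_def sq_norm_def
      by (intro sum_nonneg mult_nonneg_nonneg ip_self_nonneg) auto
    have "t * L2 \<le> \<mu> * L2" using t L2 by (intro mult_right_mono)
    then have "mgf_deriv t * (1 - 2 * \<mu> * L2) \<le> mgf_deriv t * (1 - 2 * t * L2)"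
      using nn by (intro mult_left_mono) auto
    also have "\<dots> \<le> F2 * mgf t" using mgf_deriv_le[OF t(1)] by (simp add: algebra_simps)
    finally show "mgf_deriv t \<le> b * mgf t"
      using \<mu>(2) by (simp add: b_def field_simps)
  qed
  then show ?thesis by (simp add: b_def mgf_def mult_ac)
qed

end

lemma rademacher_tail_count:
  assumes op: "\<And>y. (\<Sum>j<n. (ip d (w j) y)\<^sup>2) \<le> s2 * ip d y y"
    and tr: "(\<Sum>j<n. ip d (w j) (w j)) = s2 * de"
    and s2: "0 < s2" and de: "0 < de" and \<tau>: "0 \<le> \<tau>"
  shows "real (card {es \<in> sign_vectors n. ip d (\<lambda>i. \<Sum>j<n. es ! j * w j i) (\<lambda>i. \<Sum>j<n. es ! j * w j i)
        > s2 * (sqrt de + \<tau>)\<^sup>2})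
    \<le> real (card (sign_vectors n)) * exp (- \<tau>\<^sup>2 / 2)"
proof -
  interpret rademacher_sum n d w s2 "s2 * de" using op tr by unfold_locales
  define q where "q = sqrt de + \<tau>"
  have q: "q > 0" "sqrt de > 0" using de \<tau> by (simp_all add: q_def add_pos_nonneg)
  \<comment> \<open>Minimises \<open>\<mu> * s2 * de / (1 - 2 * \<mu> * s2) - \<mu> * s2 *
    q\<^sup>2\<close>; stationarity reads \<open>1 - 2 * \<mu> * s2 = sqrt de / q\<close>.\<close>
  define \<mu> where "\<mu> = \<tau> / (2 * s2 * q)"
  have \<mu>0: "0 \<le> \<mu>" using \<tau> s2 q by (simp add: \<mu>_def)
  have \<mu>s: "1 - 2 * \<mu> * s2 = sqrt de / q" 
  proof -
    have "1 - 2 * \<mu> * s2 = 1 - \<tau> / q" using s2 by (simp add: \<mu>_def)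
    also have "\<dots> = (q - \<tau>) / q" using q by (simp add: diff_divide_distrib)
    finally show ?thesis by (simp add: q_def)
  qed
  then have "2 * \<mu> * s2 < 1" using q by (smt (verit) divide_pos_pos)
  then have M: "mgf \<mu> \<le> real (card (sign_vectors n)) * exp (\<mu> * (s2 * de) / (sqrt de / q))"
    using mgf_le[OF \<mu>0] s2 unfolding \<mu>s by simp
  let ?bad = "{es \<in> sign_vectors n. sq_norm es > s2 * q\<^sup>2}"
  have "real (card ?bad) * exp (\<mu> * (s2 * q\<^sup>2)) = (\<Sum>es\<in>?bad. exp (\<mu> * (s2 * q\<^sup>2)))" by simp
  also have "\<dots> \<le> (\<Sum>es\<in>?bad. exp (\<mu> * sq_norm es))"
    using \<mu>0 by (intro sum_mono) (auto intro!: mult_left_mono)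
  also have "\<dots> \<le> mgf \<mu>" unfolding mgf_def using finite_sign_vectors by (intro sum_mono2) auto
  also note M
  finally have "real (card ?bad) \<le> real (card (sign_vectors n))
      * (exp (\<mu> * (s2 * de) / (sqrt de / q)) / exp (\<mu> * (s2 * q\<^sup>2)))"
    by (simp add: field_simps)
  also have "exp (\<mu> * (s2 * de) / (sqrt de / q)) / exp (\<mu> * (s2 * q\<^sup>2)) = exp (- \<tau>\<^sup>2 / 2)"
  proof -
    have "\<mu> * (s2 * de) / (sqrt de / q) = \<tau> * sqrt de / 2"
    proof -
      have "de = sqrt de * sqrt de" using de by simp
      then have "\<mu> * (s2 * de) / (sqrt de / q) = \<mu> * (s2 * (sqrt de * sqrt de)) / (sqrt de / q)" by simp
      also have "\<dots> = \<tau> * sqrt de / 2" using s2 q unfolding \<mu>_def by (simp add: field_simps)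
      finally show ?thesis .
    qed
    moreover have "\<mu> * (s2 * q\<^sup>2) = \<tau> * q / 2" using s2 q by (simp add: \<mu>_def power2_eq_square)
    ultimately have "\<mu> * (s2 * de) / (sqrt de / q) - \<mu> * (s2 * q\<^sup>2) = - \<tau>\<^sup>2 / 2"
      by (simp add: q_def power2_eq_square algebra_simps add_divide_distrib)
    then show ?thesis by (simp add: exp_diff[symmetric])
  qed
  finally show ?thesis by (simp add: sq_norm_def signed_sum_def[abs_def] q_def)
qed

subsection \<open>Walsh--Hadamard orthogonality and inverse square roots\<close>

text \<open>The entries of \<open>hadamard_mat\<close> without the factor \<open>1 / sqrt n\<close>,
  so that every value is a sign.\<close>

definition walsh :: "nat \<Rightarrow> nat \<Rightarrow> real" where
  "walsh i j = (-1) ^ card {k. bit i k \<and> bit j k}"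

lemma walsh_square: "walsh i j * walsh i j = 1"
  by (simp add: walsh_def flip: power_add mult_2)

lemma less_power_2_iff_bits: "(i :: nat) < 2 ^ K \<longleftrightarrow> (\<forall>k\<ge>K. \<not> bit i k)"
proof -
  have "i < 2 ^ K \<longleftrightarrow> take_bit K i = i" by (simp add: take_bit_nat_eq_self_iff)
  also have "\<dots> \<longleftrightarrow> (\<forall>k\<ge>K. \<not> bit i k)"
    unfolding bit_eq_iff bit_take_bit_iff using possible_bit_nat by (meson not_le)
  finally show ?thesis .
qed

text \<open>The common support gains or loses the single element \<open>b\<close> exactly when
  \<open>b\<close> is a bit of \<open>j\<close>; the bound on \<open>i\<close> makes that support
  finite, so its cardinality changes by one.\<close>

lemma walsh_flip_bit:
  assumes "i < 2 ^ K"
  shows "walsh (flip_bit b i) j = (if bit j b then - walsh i j else walsh i j)"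
proof (cases "bit j b")
  case True
  let ?S = "\<lambda>i. {k. bit i k \<and> bit j k}"
  have "k < K" if "bit i k" for k
    using assms that less_power_2_iff_bits[of i K] by (metis not_le)
  then have "?S i \<subseteq> {..<K}" by blast
  then have fin: "finite (?S i)" by (rule finite_subset) simp
  have S: "?S (flip_bit b i) = (if bit i b then ?S i - {b} else insert b (?S i))"
    using True by (auto simp: bit_flip_bit_iff)
  show ?thesis
  proof (cases "bit i b")
    case bi: True
    then have "card (?S i) = Suc (card (?S i - {b}))"
      using True fin by (intro card.remove) auto
    then show ?thesis using S bi True by (simp add: walsh_def del: card_Diff_insert card_Diff_singleton)
  next
    case False
    then show ?thesis using S True fin by (simp add: walsh_def)
  qed
next
  case False
  then have "{k. bit (flip_bit b i) k \<and> bit j k} = {k. bit i k \<and> bit j k}"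
    by (auto simp: bit_flip_bit_iff)
  then show ?thesis using False by (simp add: walsh_def)
qed

text \<open>Distinct columns differ in some bit. Flipping that bit of the row index is a bijection
  that negates exactly one factor, so the sum equals its own negative.\<close>

lemma walsh_orthogonal:
  assumes n: "n = 2 ^ K" and j: "j < n" and k: "k < n"
  shows "(\<Sum>i<n. walsh i j * walsh i k) = (if j = k then real n else 0)"
proof (cases "j = k")
  case True
  then show ?thesis by (simp add: walsh_square)
next
  case False
  then obtain b where b: "bit j b \<noteq> bit k b" by (auto simp: bit_eq_iff)
  \<comment> \<open>Keeps the flipped row index below \<open>n\<close>.\<close>
  then have bK: "b < K" using j k n by (metis less_power_2_iff_bits not_le)
  have inv: "flip_bit b i < n" if "i < n" for i
    using that bK unfolding n by (auto simp: less_power_2_iff_bits bit_flip_bit_iff)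
  have flip: "flip_bit b (flip_bit b i) = i" for i :: nat by (auto simp: bit_eq_iff bit_flip_bit_iff)
  have "(\<Sum>i<n. walsh i j * walsh i k) = (\<Sum>i<n. walsh (flip_bit b i) j * walsh (flip_bit b i) k)"
    by (rule sum.reindex_bij_witness[of _ "flip_bit b" "flip_bit b"]) (auto simp: inv flip)
  also have "\<dots> = (\<Sum>i<n. - (walsh i j * walsh i k))"
    using b by (intro sum.cong) (auto simp: walsh_flip_bit[of _ K] n)
  finally have "(\<Sum>i<n. walsh i j * walsh i k) = 0" by (simp add: sum_negf)
  then show ?thesis using False by simp
qed

section \<open>Positive square roots and spectral norms of matrices\<close>

abbreviation (input) entries :: "real mat \<Rightarrow> nat \<Rightarrow> nat \<Rightarrow> real" where
  "entries M \<equiv> \<lambda>i j. M $$ (i,j)"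

lemma mult_mat_entry:
  assumes "A \<in> carrier_mat a b" "B \<in> carrier_mat b c" "i < a" "j < c"
  shows "(A * B) $$ (i,j) = (\<Sum>k<b. A $$ (i,k) * B $$ (k,j))"
  using assms by (auto simp: scalar_prod_def atLeast0LessThan)

lemma mv_mult_mat:
  assumes "A \<in> carrier_mat d d" "B \<in> carrier_mat d d" "i < d"
  shows "mv d (entries (A * B)) y i = mv d (entries A) (mv d (entries B) y) i"
proof -
  have "mv d (entries (A * B)) y i = (\<Sum>j<d. \<Sum>k<d. A $$ (i,k) * (B $$ (k,j) * y j))"
    using assms by (simp add: mv_def mult_mat_entry[of A d d B d] sum_distrib_right mult.assoc del: index_mult_mat(1))
  also have "\<dots> = (\<Sum>k<d. \<Sum>j<d. A $$ (i,k) * (B $$ (k,j) * y j))" by (rule sum.swap)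
  finally show ?thesis by (simp add: mv_def sum_distrib_left)
qed

lemma mv_cong: "(\<And>j. j < d \<Longrightarrow> x j = y j) \<Longrightarrow> mv d M x = mv d M y"
  by (simp add: mv_def fun_eq_iff)

lemma entry_expansion:
  assumes "orthonormal d d v" "j < d"
  shows "M i j = (\<Sum>k<d. mv d M (v k) i * v k j)"
proof -
  have "(\<Sum>k<d. mv d M (v k) i * v k j) = (\<Sum>k<d. \<Sum>l<d. M i l * (v k l * v k j))"
    by (simp add: mv_def sum_distrib_right mult.assoc)
  also have "\<dots> = (\<Sum>l<d. \<Sum>k<d. M i l * (v k l * v k j))" by (rule sum.swap)
  also have "\<dots> = (\<Sum>l<d. M i l * (if l = j then 1 else 0))"
    using assms(2) by (intro sum.cong refl)
      (simp only: sum_distrib_left[symmetric] orthonormal_resolution[OF assms(1)] lessThan_iff)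
  finally show ?thesis using assms(2) by (simp add: mult_if_one_right)
qed

lemma mat_eq_if_mv_eq:
  assumes "A \<in> carrier_mat d d" "B \<in> carrier_mat d d" "orthonormal d d v"
    and "\<And>k i. k < d \<Longrightarrow> i < d \<Longrightarrow> mv d (entries A) (v k) i = mv d (entries B) (v k) i"
  shows "A = B"
proof (rule eq_matI)
  fix i j assume "i < dim_row B" "j < dim_col B"
  then have ij: "i < d" "j < d" using assms(2) by auto
  show "A $$ (i,j) = B $$ (i,j)"
    using entry_expansion[OF assms(3) ij(2), of "entries A" i] entry_expansion[OF assms(3) ij(2), of "entries B" i]
      assms(4) ij(1) by simp
qed (use assms in auto)

lemma mv_eigenvector:
  assumes "eigenbasis d M lam v" "k < d" "i < d"
  shows "mv d M (v k) i = lam k * v k i"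
  using assms by (simp add: eigenbasis_def)

lemma scalar_prod_ip:
  assumes "x \<in> carrier_vec d" "y \<in> carrier_vec d"
  shows "x \<bullet> y = ip d (\<lambda>i. x $ i) (\<lambda>i. y $ i)"
  using assms by (simp add: scalar_prod_def ip_def atLeast0LessThan)

lemma mult_mat_vec_mv:
  assumes "M \<in> carrier_mat d d" "x \<in> carrier_vec d" "i < d"
  shows "(M *\<^sub>v x) $ i = mv d (entries M) (\<lambda>i. x $ i) i"
  using assms by (simp add: scalar_prod_def mv_def atLeast0LessThan)

lemma psd_quadratic_form:
  assumes "psd M" "M \<in> carrier_mat d d"
  shows "0 \<le> ip d y (mv d (entries M) y)"
proof -
  let ?y = "Matrix.vec d y"
  have "0 \<le> ?y \<bullet> (M *\<^sub>v ?y)" using assms by (auto simp: psd_def)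
  also have "\<dots> = ip d (\<lambda>i. ?y $ i) (\<lambda>i. (M *\<^sub>v ?y) $ i)"
    using assms(2) by (intro scalar_prod_ip) auto
  also have "\<dots> = ip d y (mv d (entries M) y)"
  proof (intro ip_cong)
    fix i assume i: "i < d"
    show "(M *\<^sub>v ?y) $ i = mv d (entries M) y i"
      using mult_mat_vec_mv[OF assms(2) _ i, of ?y] by (simp add: mv_def)
  qed simp
  finally show ?thesis .
qed

lemma psdI:
  assumes "M \<in> carrier_mat d d" "transpose_mat M = M" "\<And>y. 0 \<le> ip d y (mv d (entries M) y)"
  shows "psd M"
  unfolding psd_def
proof (intro conjI ballI)
  fix x :: "real Matrix.vec" assume "x \<in> carrier_vec (dim_row M)"
  then have x: "x \<in> carrier_vec d" using assms(1) by simp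
  have "x \<bullet> (M *\<^sub>v x) = ip d (\<lambda>i. x $ i) (\<lambda>i. (M *\<^sub>v x) $ i)"
    using assms(1) x by (intro scalar_prod_ip) auto
  also have "\<dots> = ip d (\<lambda>i. x $ i) (mv d (entries M) (\<lambda>i. x $ i))"
    by (intro ip_cong) (auto simp: mult_mat_vec_mv[OF assms(1) x])
  finally show "0 \<le> x \<bullet> (M *\<^sub>v x)" using assms(3) by simp
qed (use assms in auto)

lemma symmetric_entries:
  assumes "M \<in> carrier_mat d d" "transpose_mat M = M" "i < d" "j < d"
  shows "M $$ (i,j) = M $$ (j,i)"
  by (metis assms carrier_matD index_transpose_mat(1))

lemma eigenvalue_eq_quadratic_form:
  assumes "eigenbasis d M lam v" "k < d"
  shows "lam k = ip d (v k) (mv d M (v k))"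
proof -
  have "ip d (v k) (mv d M (v k)) = ip d (v k) (\<lambda>i. lam k * v k i)"
    using mv_eigenvector[OF assms] by (intro ip_cong) auto
  then show ?thesis using assms by (simp add: ip_bilinear eigenbasis_def orthonormal_def)
qed

text \<open>Equal squares force \<open>b k\<close> and \<open>c l\<close> to agree up to sign
  whenever \<open>u k\<close> and \<open>w l\<close> overlap, and nonnegativity fixes the sign.
  Hence \<open>B\<close> and \<open>C\<close> act alike on every \<open>w l\<close>.\<close>

lemma psd_square_root_unique:
  assumes B: "B \<in> carrier_mat d d" "psd B" and C: "C \<in> carrier_mat d d" "psd C"
    and eq: "B * B = C * C"
  shows "B = C"
proof -
  have symB: "entries B i j = entries B j i" if "i < d" "j < d" for i j
    using B that by (intro symmetric_entries) (auto simp: psd_def)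
  have symC: "entries C i j = entries C j i" if "i < d" "j < d" for i j
    using C that by (intro symmetric_entries) (auto simp: psd_def)
  have "\<exists>a z. eigenbasis d (entries B) a z" by (rule spectral_theorem) (rule symB)
  then obtain b u where u: "eigenbasis d (entries B) b u" by blast
  have "\<exists>a z. eigenbasis d (entries C) a z" by (rule spectral_theorem) (rule symC)
  then obtain c w where w: "eigenbasis d (entries C) c w" by blast
  have on: "orthonormal d d u" "orthonormal d d w" using u w by (auto simp: eigenbasis_def)
  have nn: "0 \<le> b k" "0 \<le> c k" if "k < d" for k
    using eigenvalue_eq_quadratic_form[OF u that] eigenvalue_eq_quadratic_form[OF w that]
      psd_quadratic_form[OF B(2,1)] psd_quadratic_form[OF C(2,1)] by simp_all
  have sq: "mv d (entries (M * M)) (z k) i = a k * a k * z k i"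
    if "M \<in> carrier_mat d d" "eigenbasis d (entries M) a z" "k < d" "i < d" for M a z k i
  proof -
    have "mv d (entries M) (mv d (entries M) (z k)) i = mv d (entries M) (\<lambda>i. a k * z k i) i"
      using mv_eigenvector[OF that(2,3)] by (intro fun_cong[OF mv_cong]) auto
    then show ?thesis using that by (simp add: mv_mult_mat mv_scale mv_eigenvector)
  qed
  have key: "b k * ip d (u k) (w l) = c l * ip d (u k) (w l)" if kl: "k < d" "l < d" for k l
  proof -
    have symBB: "entries (B * B) i j = entries (B * B) j i" if "i < d" "j < d" for i j
      unfolding mult_mat_entry[OF B(1) B(1) that] mult_mat_entry[OF B(1) B(1) that(2,1)]
    proof (intro sum.cong refl)
      fix k assume "k \<in> {..<d}"
      then show "B $$ (i,k) * B $$ (k,j) = B $$ (j,k) * B $$ (k,i)"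
        using symB[of i k] symB[of k j] that by simp
    qed
    have "ip d (u k) (mv d (entries (B * B)) (w l)) = ip d (mv d (entries (B * B)) (u k)) (w l)"
      by (rule ip_mv_symmetric[OF symBB])
    also have "\<dots> = ip d (\<lambda>i. b k * b k * u k i) (w l)"
      using sq[OF B(1) u kl(1)] by (intro ip_cong) auto
    also have "ip d (u k) (mv d (entries (B * B)) (w l)) = ip d (u k) (\<lambda>i. c l * c l * w l i)"
      unfolding eq using sq[OF C(1) w kl(2)] by (intro ip_cong) auto
    finally have "b k * b k * ip d (u k) (w l) = c l * c l * ip d (u k) (w l)" by (simp only: ip_scale_left ip_scale_right)
    then have "ip d (u k) (w l) = 0 \<or> b k * b k = c l * c l"
      unfolding mult_cancel_right by blast
    then have "ip d (u k) (w l) = 0 \<or> b k = c l \<or> b k = - c l" by (simp only: square_eq_iff)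
    moreover have "b k = c l" if "b k = - c l" using that nn[OF kl(1)] nn[OF kl(2)] by linarith
    ultimately show ?thesis by auto
  qed
  show ?thesis
  proof (rule mat_eq_if_mv_eq[OF B(1) C(1) on(2)])
    fix l i assume li: "l < d" "i < d"
    have "mv d (entries B) (w l) i - mv d (entries C) (w l) i = 0"
    proof -
      let ?y = "\<lambda>i. mv d (entries B) (w l) i - mv d (entries C) (w l) i"
      have "ip d ?y (u k) = 0" if k: "k < d" for k
      proof -
        have "ip d (mv d (entries B) (w l)) (u k) = ip d (w l) (mv d (entries B) (u k))"
          using ip_mv_symmetric[OF symB, where x = "w l" and y = "u k"] by simp
        also have "\<dots> = ip d (w l) (\<lambda>i. b k * u k i)"
          using mv_eigenvector[OF u k] by (intro ip_cong) auto
        finally have 1: "ip d (mv d (entries B) (w l)) (u k) = b k * ip d (u k) (w l)"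
          by (simp add: ip_bilinear ip_commute)
        have "ip d (mv d (entries C) (w l)) (u k) = ip d (\<lambda>i. c l * w l i) (u k)"
          using mv_eigenvector[OF w li(1)] by (intro ip_cong) auto
        then have "ip d (mv d (entries C) (w l)) (u k) = c l * ip d (u k) (w l)"
          by (simp add: ip_bilinear ip_commute)
        then show ?thesis using 1 key[OF k li(1)] by (simp add: ip_bilinear)
      qed
      then have "ip d ?y ?y = 0" using parseval_norm[OF on(1), of ?y] by simp
      then have "\<forall>i<d. ?y i = 0" by (simp only: ip_eq_0_iff)
      then show ?thesis using li by blast
    qed
    then show "mv d (entries B) (w l) i = mv d (entries C) (w l) i" by simp
  qed
qed

text \<open>\<open>inv_sqrt_mat\<close> is a definite description, so existence and uniqueness are
  both required. The spectral decomposition supplies a candidate; any other has the same square, the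
  inverse of \<open>H\<close>.\<close>

theorem inv_sqrt_mat_properties:
  assumes H: "H \<in> carrier_mat d d" "transpose_mat H = H"
    and pd: "\<And>y. 0 < ip d y y \<Longrightarrow> 0 < ip d y (mv d (entries H) y)"
  shows "inv_sqrt_mat H \<in> carrier_mat d d" "psd (inv_sqrt_mat H)"
    "inv_sqrt_mat H * inv_sqrt_mat H * H = 1\<^sub>m d"
proof -
  have symH: "entries H i j = entries H j i" if "i < d" "j < d" for i j
    using H that by (intro symmetric_entries)
  have "\<exists>a z. eigenbasis d (entries H) a z" by (rule spectral_theorem) (rule symH)
  then obtain lam v where e: "eigenbasis d (entries H) lam v" by blast
  then have on: "orthonormal d d v" by (simp add: eigenbasis_def)
  have pos: "0 < lam k" if "k < d" for k
    using eigenvalue_eq_quadratic_form[OF e that] pd[of "v k"] on that by (simp add: orthonormal_def)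
  define c where "c k = 1 / sqrt (lam k)" for k
  have c: "c k * c k * lam k = 1" "0 \<le> c k" if "k < d" for k
    using pos[OF that] by (simp_all add: c_def)
  define B where "B = Matrix.mat d d (\<lambda>(i,j). \<Sum>k<d. c k * (v k i * v k j))"
  have B: "B \<in> carrier_mat d d" by (simp add: B_def)
  have mvB: "mv d (entries B) y i = (\<Sum>k<d. c k * (ip d (v k) y * v k i))" if "i < d" for y i
  proof -
    have "mv d (entries B) y i = mv d (\<lambda>i j. \<Sum>k<d. c k * (v k i * v k j)) y i"
      using that unfolding mv_def by (intro sum.cong) (auto simp: B_def)
    then show ?thesis by (simp add: mv_sum mv_scale_mat mv_outer)
  qed
  have Bv: "mv d (entries B) (v k) i = c k * v k i" if "i < d" "k < d" for i k
  proof -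
    have "(\<Sum>l<d. c l * (ip d (v l) (v k) * v l i)) = (\<Sum>l<d. if l = k then c k * v k i else 0)"
      using on that by (intro sum.cong) (auto simp: orthonormal_def)
    then show ?thesis using that by (simp add: mvB)
  qed
  have psdB: "psd B"
  proof (rule psdI[OF B])
    show "transpose_mat B = B"
      by (rule eq_matI) (auto simp: B_def mult.commute)
    fix y
    have "ip d y (mv d (entries B) y) = ip d y (\<lambda>i. \<Sum>k<d. c k * (ip d (v k) y * v k i))"
      using mvB by (intro ip_cong) auto
    also have "\<dots> = (\<Sum>k<d. c k * (ip d (v k) y)\<^sup>2)"
      by (simp add: ip_sum_right ip_bilinear power2_eq_square ip_commute)
    also have "\<dots> \<ge> 0" using c by (intro sum_nonneg mult_nonneg_nonneg) auto
    finally show "0 \<le> ip d y (mv d (entries B) y)" .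
  qed
  have BBH: "B * B * H = 1\<^sub>m d"
  proof (rule mat_eq_if_mv_eq[OF _ _ on])
    fix k i assume ki: "k < d" "i < d"
    have "mv d (entries (B * B * H)) (v k) i = mv d (entries (B * B)) (mv d (entries H) (v k)) i"
      using B H ki by (intro mv_mult_mat) auto
    also have "\<dots> = mv d (entries (B * B)) (\<lambda>i. lam k * v k i) i"
      using mv_eigenvector[OF e ki(1)] by (intro fun_cong[OF mv_cong]) auto
    also have "\<dots> = lam k * mv d (entries B) (mv d (entries B) (v k)) i"
      using B ki by (simp add: mv_scale mv_mult_mat)
    also have "mv d (entries B) (mv d (entries B) (v k)) i = mv d (entries B) (\<lambda>i. c k * v k i) i"
      using Bv ki by (intro fun_cong[OF mv_cong]) auto
    also have "lam k * \<dots> = c k * c k * lam k * v k i" using Bv ki by (simp add: mv_scale)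
    also have "\<dots> = mv d (entries (1\<^sub>m d)) (v k) i"
    proof -
      have "mv d (entries (1\<^sub>m d)) (v k) i = (\<Sum>j<d. if j = i then v k i else 0)"
        unfolding mv_def using ki by (intro sum.cong) auto
      then show ?thesis using c(1)[OF ki(1)] ki by simp
    qed
    finally show "mv d (entries (B * B * H)) (v k) i = mv d (entries (1\<^sub>m d)) (v k) i" .
  qed (use B H in auto)
  have uniq: "C = B" if C: "C \<in> carrier_mat d d" "psd C" "C * C * H = 1\<^sub>m d" for C
  proof -
    have "H * (B * B) = 1\<^sub>m d"
      using mat_mult_left_right_inverse[of "B * B" d H] B H BBH by simp
    then have "C * C = C * C * (H * (B * B))" using C by simp
    also have "\<dots> = C * C * H * (B * B)" using C B H by (intro assoc_mult_mat[symmetric]) auto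
    also have "\<dots> = B * B" using C B by simp
    finally show ?thesis using psd_square_root_unique[OF C(1,2) B psdB] by simp
  qed
  have dim: "dim_row H = d" using H by simp
  have "inv_sqrt_mat H = B"
    unfolding inv_sqrt_mat_def dim by (rule the_equality) (use B psdB BBH uniq in blast)+
  then show "inv_sqrt_mat H \<in> carrier_mat d d" "psd (inv_sqrt_mat H)"
    "inv_sqrt_mat H * inv_sqrt_mat H * H = 1\<^sub>m d" using B psdB BBH by auto
qed

lemma spec_norm_le:
  assumes M: "M \<in> carrier_mat d d" and t: "0 \<le> t"
    and le: "\<And>y. ip d (mv d (entries M) y) (mv d (entries M) y) \<le> t\<^sup>2 * ip d y y"
  shows "spec_norm M \<le> t"
  unfolding spec_norm_def
proof (rule cSup_least)
  have "vnorm (0\<^sub>v d) = 0" by (simp add: vnorm_def)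
  then show "{vnorm (M *\<^sub>v x) |x. x \<in> carrier_vec (dim_col M) \<and> vnorm x \<le> 1} \<noteq> {}"
    using M by (auto intro!: exI[of _ "0\<^sub>v d"])
next
  fix s assume "s \<in> {vnorm (M *\<^sub>v x) |x. x \<in> carrier_vec (dim_col M) \<and> vnorm x \<le> 1}"
  then obtain x where s: "s = vnorm (M *\<^sub>v x)" and x: "x \<in> carrier_vec d" "vnorm x \<le> 1" using M by auto
  have x1: "ip d (\<lambda>i. x $ i) (\<lambda>i. x $ i) \<le> 1"
    using x(2) scalar_prod_ip[OF x(1) x(1)] by (simp add: vnorm_def)
  have "(M *\<^sub>v x) \<bullet> (M *\<^sub>v x) = ip d (\<lambda>i. (M *\<^sub>v x) $ i) (\<lambda>i. (M *\<^sub>v x) $ i)"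
    using M x by (intro scalar_prod_ip) auto
  also have "\<dots> = ip d (mv d (entries M) (\<lambda>i. x $ i)) (mv d (entries M) (\<lambda>i. x $ i))"
    by (intro ip_cong) (auto simp: mult_mat_vec_mv[OF M x(1)])
  also have "\<dots> \<le> t\<^sup>2 * ip d (\<lambda>i. x $ i) (\<lambda>i. x $ i)" by (rule le)
  also have "\<dots> \<le> t\<^sup>2 * 1" using x1 by (intro mult_left_mono) auto
  finally show "s \<le> t" using t by (simp add: s vnorm_def real_le_lsqrt)
qed

text \<open>By Parseval in the eigenbasis. It turns the tail bound for eigenvalues into one for the
  spectral norm.\<close>

lemma spec_norm_le_eigenvalues:
  assumes M: "M \<in> carrier_mat d d" and e: "eigenbasis d (entries M) lam v"
    and sym: "\<And>i j. i < d \<Longrightarrow> j < d \<Longrightarrow> M $$ (i,j) = M $$ (j,i)"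
    and t: "0 \<le> t" and le: "\<And>k. k < d \<Longrightarrow> \<bar>lam k\<bar> \<le> t"
  shows "spec_norm M \<le> t"
proof (rule spec_norm_le[OF M t])
  fix y
  have on: "orthonormal d d v" using e by (simp add: eigenbasis_def)
  have "ip d (mv d (entries M) y) (mv d (entries M) y) = (\<Sum>k<d. (ip d (mv d (entries M) y) (v k))\<^sup>2)"
    using parseval_norm[OF on] by simp
  also have "\<dots> = (\<Sum>k<d. (lam k)\<^sup>2 * (ip d y (v k))\<^sup>2)"
  proof (rule sum.cong[OF refl])
    fix k assume k: "k \<in> {..<d}"
    have "ip d (mv d (entries M) y) (v k) = ip d y (mv d (entries M) (v k))"
      using ip_mv_symmetric[OF sym, where x = y and y = "v k"] by simp
    also have "\<dots> = ip d y (\<lambda>i. lam k * v k i)"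
      using mv_eigenvector[OF e] k by (intro ip_cong) auto
    finally show "(ip d (mv d (entries M) y) (v k))\<^sup>2 = (lam k)\<^sup>2 * (ip d y (v k))\<^sup>2"
      by (simp add: ip_bilinear power_mult_distrib)
  qed
  also have "\<dots> \<le> (\<Sum>k<d. t\<^sup>2 * (ip d y (v k))\<^sup>2)"
    using le t by (intro sum_mono mult_right_mono) (auto simp flip: abs_le_square_iff)
  also have "\<dots> = t\<^sup>2 * ip d y y" using parseval_norm[OF on] by (simp add: sum_distrib_left[symmetric])
  finally show "ip d (mv d (entries M) y) (mv d (entries M) y) \<le> t\<^sup>2 * ip d y y" .
qed

subsection \<open>The subsampled randomised Hadamard transform\<close>

text \<open>A family enters only through its weighted Gram matrix, so families sharing it are
  interchangeable. This transfers bounds from mixed rows to \<open>Z\<close>, and from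
  \<open>Z\<close> to its singular vectors.\<close>

lemma weighted_gram_quadratic_form:
  assumes "\<And>i j. i < d \<Longrightarrow> j < d \<Longrightarrow> (\<Sum>r\<in>S. c r * (x r i * x r j)) = G i j"
  shows "(\<Sum>r\<in>S. c r * (ip d (x r) y)\<^sup>2) = ip d y (mv d G y)"
proof -
  have "ip d y (mv d G y) = ip d y (mv d (\<lambda>i j. \<Sum>r\<in>S. c r * (x r i * x r j)) y)"
    using assms by (intro ip_cong) (auto simp: mv_def)
  also have "\<dots> = (\<Sum>r\<in>S. c r * (ip d (x r) y)\<^sup>2)"
    by (simp add: mv_sum mv_scale_mat mv_outer ip_sum_right ip_scale_right power2_eq_square ip_commute)
  finally show ?thesis ..
qed

lemma weighted_gram_trace:
  assumes "\<And>i j. i < d \<Longrightarrow> j < d \<Longrightarrow> (\<Sum>r\<in>S. c r * (x r i * x r j)) = G i j"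
  shows "(\<Sum>r\<in>S. c r * ip d (x r) (x r)) = (\<Sum>i<d. G i i)"
proof -
  have "(\<Sum>i<d. G i i) = (\<Sum>i<d. \<Sum>r\<in>S. c r * (x r i * x r i))"
    using assms by (intro sum.cong) auto
  also have "\<dots> = (\<Sum>r\<in>S. \<Sum>i<d. c r * (x r i * x r i))" by (rule sum.swap)
  finally show ?thesis by (simp add: ip_def sum_distrib_left)
qed

text \<open>Row \<open>r\<close> of \<open>sqrt n * W * E * Z\<close>; the factor
  \<open>sqrt n\<close> cancels the normalisation of the Hadamard matrix.\<close>

definition mixed_row :: "nat \<Rightarrow> real mat \<Rightarrow> real list \<Rightarrow> nat \<Rightarrow> nat \<Rightarrow> real" where
  "mixed_row n Z es r i = (\<Sum>q<n. es ! q * (walsh r q * Z $$ (q,i)))"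

text \<open>Walsh orthogonality removes the terms with \<open>q \<noteq> q'\<close> and squared
  signs are 1, so mixing preserves the Gram matrix up to the factor \<open>n\<close> for every
  choice of signs.\<close>

lemma mixed_row_gram:
  assumes n: "n = 2 ^ K" and es: "es \<in> sign_vectors n"
  shows "(\<Sum>r<n. mixed_row n Z es r i * mixed_row n Z es r j) = real n * (\<Sum>q<n. Z $$ (q,i) * Z $$ (q,j))"
proof -
  let ?f = "\<lambda>q q'. es ! q * es ! q' * (Z $$ (q,i) * Z $$ (q',j))"
  have "(\<Sum>r<n. mixed_row n Z es r i * mixed_row n Z es r j)
      = (\<Sum>r<n. \<Sum>q<n. \<Sum>q'<n. ?f q q' * (walsh r q * walsh r q'))"
    unfolding mixed_row_def sum_product by (intro sum.cong refl) (simp only: mult_ac)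
  also have "\<dots> = (\<Sum>q<n. \<Sum>r<n. \<Sum>q'<n. ?f q q' * (walsh r q * walsh r q'))" by (rule sum.swap)
  also have "\<dots> = (\<Sum>q<n. \<Sum>q'<n. \<Sum>r<n. ?f q q' * (walsh r q * walsh r q'))"
    by (intro sum.cong refl sum.swap)
  also have "\<dots> = (\<Sum>q<n. \<Sum>q'<n. if q = q' then ?f q q * real n else 0)"
  proof (intro sum.cong refl)
    fix q q' assume "q \<in> {..<n}" "q' \<in> {..<n}"
    then show "(\<Sum>r<n. ?f q q' * (walsh r q * walsh r q')) = (if q = q' then ?f q q * real n else 0)"
      using walsh_orthogonal[OF n, of q q'] by (simp add: sum_distrib_left[symmetric])
  qed
  also have "\<dots> = (\<Sum>q<n. ?f q q * real n)" by simp
  also have "\<dots> = (\<Sum>q<n. real n * (Z $$ (q,i) * Z $$ (q,j)))"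
    using sign_vectors_nth_square[OF es] by (intro sum.cong) auto
  finally show ?thesis by (simp add: sum_distrib_left)
qed

lemma srht_carrier: "srht m n \<omega> \<in> carrier_mat m n"
  by (rule carrier_matI) (simp_all add: srht_def select_mat_def hadamard_mat_def sign_mat_def)

lemma srht_entry:
  assumes rs: "rs \<in> row_samples m n" and p: "p < m" and q: "q < n"
  shows "srht m n (es,rs) $$ (p,q) = es ! q * walsh (rs ! p) q / sqrt (real m)"
proof -
  have rp: "rs ! p < n" using rs p by (force simp: row_samples_def)
  have c: "select_mat m n rs \<in> carrier_mat m n" "hadamard_mat n \<in> carrier_mat n n" "sign_mat n es \<in> carrier_mat n n"
    by (simp_all add: select_mat_def hadamard_mat_def sign_mat_def)
  have SH: "(select_mat m n rs * hadamard_mat n) $$ (p,k) = walsh (rs ! p) k / sqrt (real n)" if k: "k < n" for k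
  proof -
    have "(select_mat m n rs * hadamard_mat n) $$ (p,k)
        = (\<Sum>l<n. if l = rs ! p then walsh (rs ! p) k / sqrt (real n) else 0)"
      unfolding mult_mat_entry[OF c(1,2) p k]
      using p k by (intro sum.cong) (auto simp: select_mat_def hadamard_mat_def walsh_def)
    then show ?thesis using rp by simp
  qed
  have "(select_mat m n rs * hadamard_mat n * sign_mat n es) $$ (p,q)
      = (\<Sum>k<n. (select_mat m n rs * hadamard_mat n) $$ (p,k) * sign_mat n es $$ (k,q))"
    using c by (intro mult_mat_entry[of _ m n]) (auto simp: p q)
  also have "\<dots> = (\<Sum>k<n. if k = q then walsh (rs ! p) q / sqrt (real n) * es ! q else 0)"
    using q by (intro sum.cong refl) (auto simp: SH sign_mat_def)
  also have "\<dots> = walsh (rs ! p) q / sqrt (real n) * es ! q" using q by simp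
  finally have e: "(select_mat m n rs * hadamard_mat n * sign_mat n es) $$ (p,q)
      = walsh (rs ! p) q / sqrt (real n) * es ! q" .
  have "srht m n (es,rs) $$ (p,q) = sqrt (real n / real m) * (walsh (rs ! p) q / sqrt (real n) * es ! q)"
    unfolding e[symmetric] srht_def using c p q by (simp del: index_mult_mat(1))
  then show ?thesis using q by (simp add: real_sqrt_divide)
qed

lemma srht_mult_entry:
  assumes "rs \<in> row_samples m n" "p < m" "Z \<in> carrier_mat n d" "i < d"
  shows "(srht m n (es,rs) * Z) $$ (p,i) = mixed_row n Z es (rs ! p) i / sqrt (real m)"
  unfolding mult_mat_entry[OF srht_carrier assms(3,2,4)] mixed_row_def sum_divide_distrib
  using assms by (intro sum.cong) (auto simp: srht_entry)

text \<open>The regulariser contributes \<open>B * Q * B\<close> both to the sketched matrix and to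
  \<open>1\<^sub>m d = B * H * B\<close>, and so cancels.\<close>

lemma preconditioned_deviation:
  fixes A B Q S :: "real mat"
  assumes A: "A \<in> carrier_mat n d" and Q: "Q \<in> carrier_mat d d" and B: "B \<in> carrier_mat d d"
    and sym: "transpose_mat B = B" and inv: "B * (transpose_mat A * A + Q) * B = 1\<^sub>m d"
    and S: "S \<in> carrier_mat m n"
  shows "B * (transpose_mat A * transpose_mat S * S * A + Q) * B - 1\<^sub>m d
    = transpose_mat (S * (A * B)) * (S * (A * B)) - transpose_mat (A * B) * (A * B)"
proof -
  have split: "B * (X + Q) * B = B * X * B + B * Q * B" if X: "X \<in> carrier_mat d d" for X
  proof -
    have "B * (X + Q) * B = (B * X + B * Q) * B" using B X Q by (simp add: mult_add_distrib_mat)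
    also have "\<dots> = B * X * B + B * Q * B" using B X Q by (intro add_mult_distrib_mat) auto
    finally show ?thesis .
  qed
  have gram: "B * (transpose_mat M * M) * B = transpose_mat (M * B) * (M * B)" if M: "M \<in> carrier_mat a d" for M a
  proof -
    have "transpose_mat (M * B) * (M * B) = B * transpose_mat M * (M * B)"
      using transpose_mult[OF M B] sym by simp
    also have "\<dots> = B * transpose_mat M * M * B"
      using M B by (intro assoc_mult_mat[symmetric, of _ d a _ d _ d]) auto
    also have "B * transpose_mat M * M = B * (transpose_mat M * M)"
      using M B by (intro assoc_mult_mat[of _ d d _ a _ d]) auto
    finally show ?thesis ..
  qed
  have SA: "S * A \<in> carrier_mat m d" using S A by simp
  have "transpose_mat A * transpose_mat S * S * A = transpose_mat (S * A) * (S * A)"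
  proof -
    have "transpose_mat (S * A) * (S * A) = transpose_mat A * transpose_mat S * (S * A)"
      using transpose_mult[OF S A] by simp
    also have "\<dots> = transpose_mat A * transpose_mat S * S * A"
      using S A by (intro assoc_mult_mat[symmetric, of _ d m _ n _ d]) auto
    finally show ?thesis ..
  qed
  then have "B * (transpose_mat A * transpose_mat S * S * A + Q) * B
      = transpose_mat (S * A * B) * (S * A * B) + B * Q * B"
    using split[OF mult_carrier_mat[OF transpose_carrier_mat[THEN iffD2, OF SA] SA]] gram[OF SA] by simp
  moreover have "1\<^sub>m d = transpose_mat (A * B) * (A * B) + B * Q * B"
    using split[of "transpose_mat A * A"] gram[OF A] A inv by simp
  moreover have "S * A * B = S * (A * B)" using S A B by simp
  moreover have "X + R - (Y + R) = X - Y"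
    if "X \<in> carrier_mat d d" "Y \<in> carrier_mat d d" "R \<in> carrier_mat d d" for X Y R :: "real mat"
    using that by (intro eq_matI) auto
  moreover have "transpose_mat M * M \<in> carrier_mat d d" if "M \<in> carrier_mat a d" for M :: "real mat" and a
    using that by simp
  moreover have "S * (A * B) \<in> carrier_mat m d" "A * B \<in> carrier_mat n d" "B * Q * B \<in> carrier_mat d d"
    using S A B Q by simp_all
  ultimately show ?thesis by metis
qed

text \<open>Division by \<open>m\<close> turns the sampled Gram matrix into the sketched one, and
  the population term into \<open>transpose_mat Z * Z\<close> through
  \<open>mixed_row_gram\<close>.\<close>

lemma srht_deviation_entry:
  assumes n: "n = 2 ^ K" and es: "es \<in> sign_vectors n" and rs: "rs \<in> row_samples m n"
    and Z: "Z \<in> carrier_mat n d" and ij: "i < d" "j < d" and m: "0 < m"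
  shows "(transpose_mat (srht m n (es,rs) * Z) * (srht m n (es,rs) * Z) - transpose_mat Z * Z) $$ (i,j)
    = sample_deviation m n (mixed_row n Z es) rs i j / real m"
proof -
  have SZ: "srht m n (es,rs) * Z \<in> carrier_mat m d" using srht_carrier Z by (rule mult_carrier_mat)
  have npos: "0 < n" using n by simp
  have gram: "(transpose_mat M * M) $$ (i,j) = (\<Sum>p<a. M $$ (p,i) * M $$ (p,j))" if M: "M \<in> carrier_mat a d" for M :: "real mat" and a
  proof -
    have "(transpose_mat M * M) $$ (i,j) = (\<Sum>p<a. transpose_mat M $$ (i,p) * M $$ (p,j))"
      using M ij by (intro mult_mat_entry) auto
    then show ?thesis using M ij by simp
  qed
  have "(\<Sum>p<m. (srht m n (es,rs) * Z) $$ (p,i) * (srht m n (es,rs) * Z) $$ (p,j))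
      = (\<Sum>p<m. mixed_row n Z es (rs ! p) i * mixed_row n Z es (rs ! p) j) / real m"
    unfolding sum_divide_distrib using srht_mult_entry[OF rs _ Z] ij m
    by (intro sum.cong) (auto simp flip: real_sqrt_mult)
  moreover have "(\<Sum>q<n. Z $$ (q,i) * Z $$ (q,j)) = (\<Sum>r<n. mixed_row n Z es r i * mixed_row n Z es r j) / real n"
    using mixed_row_gram[OF n es] npos by simp
  moreover have "(transpose_mat (srht m n (es,rs) * Z) * (srht m n (es,rs) * Z) - transpose_mat Z * Z) $$ (i,j)
      = (transpose_mat (srht m n (es,rs) * Z) * (srht m n (es,rs) * Z)) $$ (i,j) - (transpose_mat Z * Z) $$ (i,j)"
    using ij SZ Z by (intro index_minus_mat) auto
  ultimately show ?thesis unfolding gram[OF SZ] gram[OF Z]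
    using m by (simp add: sample_deviation_def diff_divide_distrib)
qed

text \<open>Ties \<open>s2\<close> and \<open>de\<close> to the singular values. As
  \<open>spec_norm\<close> is a supremum, bounding it from below requires boundedness of the set;
  unit vectors then attain the diagonal entries.\<close>

lemma
  fixes D :: "real mat"
  assumes D: "D \<in> carrier_mat d d" "diagonal_mat D"
  shows frob_norm_diagonal: "(frob_norm D)\<^sup>2 = (\<Sum>i<d. (D $$ (i,i))\<^sup>2)"
    and diagonal_le_spec_norm: "i < d \<Longrightarrow> (D $$ (i,i))\<^sup>2 \<le> (spec_norm D)\<^sup>2"
    and spec_norm_le_frob_norm: "(spec_norm D)\<^sup>2 \<le> (frob_norm D)\<^sup>2"
    and spec_norm_diagonal_le_1: "(\<And>i. i < d \<Longrightarrow> (D $$ (i,i))\<^sup>2 \<le> 1) \<Longrightarrow> (spec_norm D)\<^sup>2 \<le> 1"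
proof -
  have off: "D $$ (i,j) = 0" if "i < d" "j < d" "i \<noteq> j" for i j
    using D that by (auto simp: diagonal_mat_def)
  have "(\<Sum>j<d. (D $$ (i,j))\<^sup>2) = (D $$ (i,i))\<^sup>2" if "i < d" for i
  proof -
    have "(\<Sum>j<d. (D $$ (i,j))\<^sup>2) = (\<Sum>j<d. if j = i then (D $$ (i,i))\<^sup>2 else 0)"
      using off that by (intro sum.cong) auto
    then show ?thesis using that by simp
  qed
  then show F: "(frob_norm D)\<^sup>2 = (\<Sum>i<d. (D $$ (i,i))\<^sup>2)"
    using D by (simp add: frob_norm_def sum_nonneg)
  have mvD: "mv d (entries D) y i = D $$ (i,i) * y i" if "i < d" for y i
  proof -
    have "mv d (entries D) y i = (\<Sum>j<d. if j = i then D $$ (i,i) * y i else 0)"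
      unfolding mv_def using off that by (intro sum.cong) auto
    then show ?thesis using that by simp
  qed
  have nrm: "ip d (mv d (entries D) y) (mv d (entries D) y) = (\<Sum>i<d. (D $$ (i,i))\<^sup>2 * (y i)\<^sup>2)" for y
    by (simp add: ip_def mvD power2_eq_square mult_ac)
  have bnd: "ip d (mv d (entries D) y) (mv d (entries D) y) \<le> t\<^sup>2 * ip d y y"
    if "\<And>i. i < d \<Longrightarrow> (D $$ (i,i))\<^sup>2 \<le> t\<^sup>2" for t y
    unfolding nrm unfolding ip_def sum_distrib_left power2_eq_square[symmetric]
    by (intro sum_mono mult_right_mono that) auto
  have ent_le: "(D $$ (i,i))\<^sup>2 \<le> (frob_norm D)\<^sup>2" if "i < d" for i
    unfolding F using that by (intro member_le_sum[where f = "\<lambda>i. (D $$ (i,i))\<^sup>2"]) auto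
  have fn: "0 \<le> frob_norm D" by (simp add: frob_norm_def sum_nonneg)
  let ?N = "{vnorm (D *\<^sub>v x) |x. x \<in> carrier_vec (dim_col D) \<and> vnorm x \<le> 1}"
  have vn: "vnorm (D *\<^sub>v x) = sqrt (\<Sum>i<d. (D $$ (i,i))\<^sup>2 * (x $ i)\<^sup>2)" if x: "x \<in> carrier_vec d" for x
  proof -
    have "(D *\<^sub>v x) \<bullet> (D *\<^sub>v x) = ip d (\<lambda>i. (D *\<^sub>v x) $ i) (\<lambda>i. (D *\<^sub>v x) $ i)"
      using D x by (intro scalar_prod_ip) auto
    also have "\<dots> = ip d (mv d (entries D) (\<lambda>i. x $ i)) (mv d (entries D) (\<lambda>i. x $ i))"
      by (intro ip_cong) (auto simp: mult_mat_vec_mv[OF D(1) x])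
    finally show ?thesis by (simp add: vnorm_def nrm)
  qed
  have bdd: "bdd_above ?N"
  proof (rule bdd_aboveI)
    fix s assume "s \<in> ?N"
    then obtain x where s: "s = vnorm (D *\<^sub>v x)" and x: "x \<in> carrier_vec d" "vnorm x \<le> 1" using D by auto
    have "(\<Sum>i<d. (D $$ (i,i))\<^sup>2 * (x $ i)\<^sup>2) \<le> (\<Sum>i<d. (D $$ (i,i))\<^sup>2 * 1)"
    proof (intro sum_mono mult_left_mono)
      fix i assume "i \<in> {..<d}"
      then have "(x $ i)\<^sup>2 \<le> ip d (\<lambda>i. x $ i) (\<lambda>i. x $ i)"
        unfolding ip_def power2_eq_square by (intro member_le_sum[where f = "\<lambda>i. x $ i * x $ i"]) auto
      also have "\<dots> \<le> 1" using x scalar_prod_ip[OF x(1) x(1)] by (simp add: vnorm_def)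
      finally show "(x $ i)\<^sup>2 \<le> 1" .
    qed auto
    then show "s \<le> sqrt (\<Sum>i<d. (D $$ (i,i))\<^sup>2)" by (simp add: s vn x)
  qed
  have ge: "\<bar>D $$ (i,i)\<bar> \<le> spec_norm D" if i: "i < d" for i
  proof -
    have u: "unit_vec d i \<in> carrier_vec d" by simp
    have "(\<Sum>j<d. (D $$ (j,j))\<^sup>2 * (unit_vec d i $ j)\<^sup>2) = (\<Sum>j<d. if j = i then (D $$ (i,i))\<^sup>2 else 0)"
      using i by (intro sum.cong) auto
    then have "vnorm (D *\<^sub>v unit_vec d i) = \<bar>D $$ (i,i)\<bar>" using i by (simp add: vn)
    moreover have "vnorm (unit_vec d i :: real Matrix.vec) \<le> 1" using i by (simp add: vnorm_def)
    ultimately have "\<bar>D $$ (i,i)\<bar> \<in> ?N" using D u by (auto intro!: exI[of _ "unit_vec d i"])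
    then show ?thesis unfolding spec_norm_def using bdd by (rule cSup_upper)
  qed
  then show "i < d \<Longrightarrow> (D $$ (i,i))\<^sup>2 \<le> (spec_norm D)\<^sup>2"
    by (metis abs_ge_zero power2_abs power_mono)
  have "0 \<le> spec_norm D"
  proof -
    have "vnorm (D *\<^sub>v 0\<^sub>v d) = 0" by (simp add: vn)
    moreover have "vnorm (0\<^sub>v d :: real Matrix.vec) \<le> 1" by (simp add: vnorm_def)
    ultimately have "0 \<in> ?N" using D by (auto intro!: exI[of _ "0\<^sub>v d"])
    then show ?thesis unfolding spec_norm_def using bdd by (rule cSup_upper)
  qed
  then show "(spec_norm D)\<^sup>2 \<le> (frob_norm D)\<^sup>2"
    using spec_norm_le[OF D(1) fn bnd[OF ent_le]] by (intro power_mono)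
  show "(spec_norm D)\<^sup>2 \<le> 1" if "\<And>i. i < d \<Longrightarrow> (D $$ (i,i))\<^sup>2 \<le> 1"
    using spec_norm_le[OF D(1) zero_le_one] bnd[of 1] that \<open>0 \<le> spec_norm D\<close> by (auto simp: power_le_one)
qed

section \<open>Choice of parameters and union bounds\<close>

lemma cosh_minus_one_ge:
  fixes y :: real
  assumes "4 \<le> exp y"
  shows "exp y / 4 \<le> cosh y - 1"
  using assms by (simp add: cosh_def field_simps) (smt (verit) exp_gt_zero)

text \<open>With \<open>q = m * \<rho> / \<beta>\<close>, the threshold gains at least
  \<open>q / 4\<close> in the exponent and the moment costs at most \<open>q / 12\<close>. The net
  factor \<open>exp (- (q / 6))\<close> outweighs \<open>4 * de\<close> because
  \<open>q \<ge> 16 * l\<close>.\<close>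

lemma failure_count_bound:
  fixes count N de \<delta> \<rho> \<beta> s2 m :: real
  assumes m: "0 < m" and N: "0 \<le> N" and de: "1 \<le> de" and \<delta>: "0 < \<delta>" "\<delta> < 1" and \<rho>: "0 < \<rho>"
    and \<beta>: "0 < \<beta>" and s2: "0 < s2" "s2 \<le> 1" and count: "0 \<le> count"
    and m_large: "16 * ln (16 * de / \<delta>) * \<beta> / \<rho> \<le> m"
    and bound: "\<And>\<theta>. 0 \<le> \<theta> \<Longrightarrow> \<theta> * (s2 * \<beta>) < 1 \<Longrightarrow>
      count * (cosh (\<theta> * (m * max (sqrt \<rho>) \<rho>)) - 1)
        \<le> N * de * exp (s2 * \<beta> * m * s2 * \<theta>\<^sup>2 / (1 - \<theta> * (s2 * \<beta>)))"
  shows "count \<le> N * (\<delta> / 2)"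
proof -
  define l where "l = ln (16 * de / \<delta>)"
  \<comment> \<open>This is \<open>\<theta>\<close> times the row bound. The minimum gives
    \<open>\<kappa> * max (sqrt \<rho>) \<rho> = \<rho> / 4\<close> for small and large
    \<open>\<rho>\<close> alike; the quarter keeps \<open>1 - \<kappa>\<close> at least 3/4.\<close>
  define \<kappa> where "\<kappa> = min 1 (sqrt \<rho>) / 4"
  define \<theta> where "\<theta> = \<kappa> / (s2 * \<beta>)"
  define q where "q = m / \<beta> * \<rho>"
  have ratio: "16 \<le> 16 * de / \<delta>"
    using de \<delta> by (simp add: field_simps)
  have expl: "exp l = 16 * de / \<delta>" using ratio by (simp add: l_def)
  have l1: "1 \<le> l"
  proof -
    have "exp 1 \<le> (16 :: real)" using exp_le by linarith
    also note ratio
    finally show ?thesis using ratio by (simp add: l_def ln_ge_iff)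
  qed
  have q: "16 * l \<le> q" using m_large \<beta> \<rho> by (simp add: q_def l_def field_simps)
  have \<kappa>: "0 < \<kappa>" "\<kappa> \<le> 1 / 4" "\<kappa>\<^sup>2 \<le> \<rho> / 16" "\<kappa> * max (sqrt \<rho>) \<rho> = \<rho> / 4"
  proof -
    show "0 < \<kappa>" "\<kappa> \<le> 1 / 4" using \<rho> by (auto simp: \<kappa>_def)
    have "(min 1 (sqrt \<rho>))\<^sup>2 \<le> (sqrt \<rho>)\<^sup>2" using \<rho> by (intro power_mono) auto
    then show "\<kappa>\<^sup>2 \<le> \<rho> / 16" using \<rho> by (simp add: \<kappa>_def power_divide)
    show "\<kappa> * max (sqrt \<rho>) \<rho> = \<rho> / 4"
    proof (cases "\<rho> \<le> 1")
      case True
      then have "sqrt \<rho> \<le> 1" by simp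
      moreover have "\<rho> \<le> sqrt \<rho>"
        using True \<rho> mult_right_mono[OF \<open>sqrt \<rho> \<le> 1\<close>, of "sqrt \<rho>"] by simp
      ultimately show ?thesis using \<rho> by (simp add: \<kappa>_def min_def max_def)
    next
      case False
      then have "1 \<le> sqrt \<rho>" by simp
      moreover have "sqrt \<rho> \<le> \<rho>"
        using False \<rho> mult_right_mono[OF \<open>1 \<le> sqrt \<rho>\<close>, of "sqrt \<rho>"] by simp
      ultimately show ?thesis using \<rho> by (simp add: \<kappa>_def min_def max_def)
    qed
  qed
  have \<theta>B: "\<theta> * (s2 * \<beta>) = \<kappa>" using s2 \<beta> by (simp add: \<theta>_def)
  have \<theta>0: "0 \<le> \<theta>" using \<kappa> s2 \<beta> by (simp add: \<theta>_def)
  have expo: "s2 * \<beta> * m * s2 * \<theta>\<^sup>2 / (1 - \<theta> * (s2 * \<beta>)) \<le> q / 12"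
  proof -
    have "s2 * \<beta> * m * s2 * \<theta>\<^sup>2 = m / \<beta> * \<kappa>\<^sup>2"
      using s2 \<beta> by (simp add: \<theta>_def power2_eq_square field_simps)
    also have "\<dots> \<le> m / \<beta> * (\<rho> / 16)" using \<kappa> m \<beta> by (intro mult_left_mono) auto
    finally have "s2 * \<beta> * m * s2 * \<theta>\<^sup>2 / (1 - \<kappa>) \<le> q / 16 / (1 - \<kappa>)"
      using \<kappa> by (intro divide_right_mono) (auto simp: q_def)
    also have "\<dots> \<le> q / 16 / (3 / 4)" using \<kappa> q l1 by (intro divide_left_mono) auto
    finally show ?thesis unfolding \<theta>B by simp
  qed
  define y where "y = \<theta> * (m * max (sqrt \<rho>) \<rho>)"
  have y: "q / 4 \<le> y"
  proof -
    \<comment> \<open>The factor \<open>1 / s2\<close> comes from \<open>\<theta>\<close>; it can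
      only help, as \<open>s2 \<le> 1\<close>.\<close>
    have "y = q / 4 / s2"
    proof -
      have "y = m * (\<kappa> * max (sqrt \<rho>) \<rho>) / (s2 * \<beta>)" by (simp add: y_def \<theta>_def)
      then show ?thesis unfolding \<kappa>(4) by (simp add: q_def)
    qed
    moreover have "q / 4 * s2 \<le> q / 4 * 1" using q l1 s2 by (intro mult_left_mono) auto
    ultimately show ?thesis using s2 by (simp add: pos_le_divide_eq)
  qed
  have "4 \<le> exp y"
  proof -
    have "4 \<le> y" using y q l1 by simp
    then show ?thesis using exp_ge_add_one_self[of y] by linarith
  qed
  then have "exp (q / 4) / 4 \<le> cosh y - 1"
    using cosh_minus_one_ge[of y] y by (smt (verit) divide_right_mono exp_le_cancel_iff)
  then have "count * (exp (q / 4) / 4) \<le> count * (cosh y - 1)" using count by (rule mult_left_mono)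
  also have "\<dots> \<le> N * de * exp (s2 * \<beta> * m * s2 * \<theta>\<^sup>2 / (1 - \<theta> * (s2 * \<beta>)))"
    unfolding y_def using \<theta>0 \<theta>B \<kappa> by (intro bound) auto
  also have "\<dots> \<le> N * de * exp (q / 12)" using expo N de by (intro mult_left_mono) auto
  finally have "count \<le> 4 * N * de * (exp (q / 12) / exp (q / 4))" by (simp add: field_simps)
  also have "exp (q / 12) / exp (q / 4) = exp (- (q / 6))" by (simp add: exp_diff[symmetric])
  \<comment> \<open>From \<open>q \<ge> 16 * l\<close>, \<open>q / 6\<close> exceeds
    \<open>2 * l\<close>.\<close>
  also have "4 * N * de * \<dots> \<le> 4 * N * de * exp (- (2 * l))"
    using q l1 N de by (intro mult_left_mono) auto
  also have "exp (- (2 * l)) = (\<delta> / (16 * de))\<^sup>2"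
  proof -
    have "exp (- l) = \<delta> / (16 * de)" using expl by (simp add: exp_minus)
    then show ?thesis using exp_double[of "- l"] by simp
  qed
  also have "4 * N * de * (\<delta> / (16 * de))\<^sup>2 = N * (\<delta> * \<delta> / (64 * de))"
    using de by (simp add: power2_eq_square field_simps)
  also have "\<dots> \<le> N * (\<delta> / 2)"
  proof (intro mult_left_mono N)
    have "\<delta> * \<delta> \<le> \<delta> * 1" using \<delta> by (intro mult_left_mono) auto
    also have "\<dots> \<le> \<delta> * (32 * de)" using \<delta> de by (intro mult_left_mono) auto
    finally show "\<delta> * \<delta> / (64 * de) \<le> \<delta> / 2" using de by (simp add: field_simps)
  qed
  finally show ?thesis .
qed

lemma row_samples_nonempty:
  assumes "m \<le> n"
  shows "row_samples m n \<noteq> {}"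
proof -
  have "[0..<m] \<in> row_samples m n" using assms by (auto simp: row_samples_def)
  then show ?thesis by blast
qed

lemma sign_vectors_nonempty: "sign_vectors n \<noteq> {}"
proof -
  have "replicate n 1 \<in> sign_vectors n" by (auto simp: sign_vectors_def)
  then show ?thesis by blast
qed

text \<open>Each mixed row is a Rademacher sum of the vectors \<open>walsh r q\<close> times row
  \<open>q\<close> of \<open>Z\<close>; these signs change neither norm. A union bound over the
  \<open>n\<close> rows follows.\<close>

lemma row_norms_failure_count:
  assumes op: "\<And>y. (\<Sum>q<n. (ip d (\<lambda>i. Z $$ (q,i)) y)\<^sup>2) \<le> s2 * ip d y y"
    and tr: "(\<Sum>q<n. ip d (\<lambda>i. Z $$ (q,i)) (\<lambda>i. Z $$ (q,i))) = s2 * de"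
    and s2: "0 < s2" and de: "1 \<le> de" and \<delta>: "0 < \<delta>" "\<delta> < 1" and n: "0 < n"
  shows "real (card {es \<in> sign_vectors n. \<exists>r<n. ip d (mixed_row n Z es r) (mixed_row n Z es r)
        > s2 * (sqrt de + sqrt (8 * ln (2 * real n / \<delta>)))\<^sup>2})
    \<le> real (card (sign_vectors n)) * (\<delta> / 2)"
proof -
  define \<tau> where "\<tau> = sqrt (8 * ln (2 * real n / \<delta>))"
  define u where "u = s2 * (sqrt de + \<tau>)\<^sup>2"
  let ?bad = "\<lambda>r. {es \<in> sign_vectors n. ip d (mixed_row n Z es r) (mixed_row n Z es r) > u}"
  have "1 * \<delta> \<le> 2 * real n" using n \<delta> by simp
  then have r: "1 \<le> 2 * real n / \<delta>" using \<delta> by (simp add: field_simps)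
  then have \<tau>: "0 \<le> \<tau>" "\<tau>\<^sup>2 = 8 * ln (2 * real n / \<delta>)" by (simp_all add: \<tau>_def)
  \<comment> \<open>\<open>\<tau>\<^sup>2 / 2\<close> equals four times this logarithm, which is
    nonnegative; one copy pays for the union bound.\<close>
  have "exp (- \<tau>\<^sup>2 / 2) \<le> exp (- ln (2 * real n / \<delta>))" using r by (simp add: \<tau>)
  also have "\<dots> = \<delta> / (2 * real n)" using r \<delta> n by (simp add: exp_minus)
  finally have e: "exp (- \<tau>\<^sup>2 / 2) \<le> \<delta> / (2 * real n)" .
  have one: "real (card (?bad r)) \<le> real (card (sign_vectors n)) * (\<delta> / (2 * real n))" for r
  proof -
    have sq: "walsh r q * (walsh r q * t) = t" for q t
      using walsh_square[of r q] by (simp add: mult.assoc[symmetric])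
    have row: "ip d (\<lambda>i. walsh r q * Z $$ (q,i)) y = walsh r q * ip d (\<lambda>i. Z $$ (q,i)) y" for q y
      by (rule ip_scale_left)
    have "real (card {es \<in> sign_vectors n.
        ip d (\<lambda>i. \<Sum>q<n. es ! q * (walsh r q * Z $$ (q,i))) (\<lambda>i. \<Sum>q<n. es ! q * (walsh r q * Z $$ (q,i)))
          > s2 * (sqrt de + \<tau>)\<^sup>2}) \<le> real (card (sign_vectors n)) * exp (- \<tau>\<^sup>2 / 2)"
    proof (rule rademacher_tail_count)
      show "(\<Sum>q<n. (ip d (\<lambda>i. walsh r q * Z $$ (q,i)) y)\<^sup>2) \<le> s2 * ip d y y" for y
        using op[of y] unfolding row by (simp add: power2_eq_square sq mult_ac)
      show "(\<Sum>q<n. ip d (\<lambda>i. walsh r q * Z $$ (q,i)) (\<lambda>i. walsh r q * Z $$ (q,i))) = s2 * de"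
        using tr unfolding row ip_scale_right by (simp add: sq)
    qed (use s2 de \<tau> in auto)
    also have "\<dots> \<le> real (card (sign_vectors n)) * (\<delta> / (2 * real n))" by (intro mult_left_mono e) auto
    finally show ?thesis by (simp add: u_def mixed_row_def[abs_def])
  qed
  have "real (card {es \<in> sign_vectors n. \<exists>r<n. ip d (mixed_row n Z es r) (mixed_row n Z es r) > u})
      \<le> real (card (\<Union>r<n. ?bad r))"
    using finite_sign_vectors by (intro of_nat_mono card_mono) auto
  also have "\<dots> \<le> (\<Sum>r<n. real (card (?bad r)))"
    unfolding of_nat_sum[symmetric] by (intro of_nat_mono card_UN_le) auto
  also have "\<dots> \<le> (\<Sum>r<n. real (card (sign_vectors n)) * (\<delta> / (2 * real n)))" by (intro sum_mono one)
  also have "\<dots> = real (card (sign_vectors n)) * (\<delta> / 2)" using n by simp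
  finally show ?thesis by (simp add: u_def \<tau>_def)
qed

lemma sampling_failure_count:
  fixes x :: "nat \<Rightarrow> nat \<Rightarrow> real"
  assumes n: "0 < n" and m: "0 < m" "m \<le> n"
    and row_bound: "\<And>r. r < n \<Longrightarrow> ip d (x r) (x r) \<le> s2 * \<beta>"
    and op: "\<And>y. (\<Sum>r<n. (ip d (x r) y)\<^sup>2) \<le> real n * s2 * ip d y y"
    and tr: "(\<Sum>r<n. ip d (x r) (x r)) = real n * s2 * de"
    and eig: "\<And>rs. rs \<in> row_samples m n \<Longrightarrow> eigenbasis d (sample_deviation m n x rs) (lam rs) (v rs)"
    and de: "1 \<le> de" and \<delta>: "0 < \<delta>" "\<delta> < 1" and \<rho>: "0 < \<rho>"
    and \<beta>: "0 < \<beta>" and s2: "0 < s2" "s2 \<le> 1"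
    and m_large: "16 * ln (16 * de / \<delta>) * \<beta> / \<rho> \<le> real m"
  shows "real (card {rs \<in> row_samples m n. \<exists>k<d. \<bar>lam rs k\<bar> > real m * max (sqrt \<rho>) \<rho>})
    \<le> real (card (row_samples m n)) * (\<delta> / 2)"
proof -
  interpret row_sampling n d m x "s2 * \<beta>" s2 de lam v
    by unfold_locales (use assms in auto)
  show ?thesis
  proof (rule failure_count_bound[OF _ _ de \<delta> \<rho> \<beta> s2 _ m_large])
    fix \<theta> :: real assume \<theta>: "0 \<le> \<theta>" "\<theta> * (s2 * \<beta>) < 1"
    show "real (card {rs \<in> row_samples m n. \<exists>k<d. \<bar>lam rs k\<bar> > real m * max (sqrt \<rho>) \<rho>})
          * (cosh (\<theta> * (real m * max (sqrt \<rho>) \<rho>)) - 1)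
        \<le> real (card (row_samples m n)) * de * exp (s2 * \<beta> * real m * s2 * \<theta>\<^sup>2 / (1 - \<theta> * (s2 * \<beta>)))"
      using large_deviation_count[OF \<theta>, of "real m * max (sqrt \<rho>) \<rho>"] \<rho> de by (simp add: max_def)
  qed (use m in auto)
qed

text \<open>Fubini by counting: sign vectors with a long row cost \<open>\<delta> / 2\<close>, and
  over each remaining sign vector the bad samples cost \<open>\<delta> / 2\<close>.\<close>

theorem srht_failure_count:
  fixes Z :: "real mat"
  assumes n: "n = 2 ^ K" and Z: "Z \<in> carrier_mat n d" and m: "0 < m" "m \<le> n"
    and op: "\<And>y. (\<Sum>q<n. (ip d (\<lambda>i. Z $$ (q,i)) y)\<^sup>2) \<le> s2 * ip d y y"
    and tr: "(\<Sum>q<n. ip d (\<lambda>i. Z $$ (q,i)) (\<lambda>i. Z $$ (q,i))) = s2 * de"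
    and s2: "0 < s2" "s2 \<le> 1" and de: "1 \<le> de" and \<delta>: "0 < \<delta>" "\<delta> < 1" and \<rho>: "0 < \<rho>"
    and m_large: "16 * ln (16 * de / \<delta>) * (sqrt de + sqrt (8 * ln (2 * real n / \<delta>)))\<^sup>2 / \<rho> \<le> real m"
  shows "real (card {\<omega> \<in> sign_vectors n \<times> row_samples m n.
      max (sqrt \<rho>) \<rho> < spec_norm (transpose_mat (srht m n \<omega> * Z) * (srht m n \<omega> * Z) - transpose_mat Z * Z)})
    \<le> real (card (sign_vectors n \<times> row_samples m n)) * \<delta>"
proof -
  define \<beta> where "\<beta> = (sqrt de + sqrt (8 * ln (2 * real n / \<delta>)))\<^sup>2"
  define t where "t = max (sqrt \<rho>) \<rho>"
  have t: "0 < t" using \<rho> by (simp add: t_def less_max_iff_disj)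
  have npos: "0 < n" using n by simp
  have "1 * \<delta> \<le> 2 * real n" using npos \<delta> by simp
  then have "1 \<le> 2 * real n / \<delta>" using \<delta> by (simp add: field_simps)
  then have \<beta>: "0 < \<beta>" using de unfolding \<beta>_def by (intro zero_less_power add_pos_nonneg) auto
  define dev where "dev es rs = transpose_mat (srht m n (es,rs) * Z) * (srht m n (es,rs) * Z) - transpose_mat Z * Z"
    for es rs
  have dev_carrier: "dev es rs \<in> carrier_mat d d" for es rs
    unfolding dev_def by (rule minus_carrier_mat[OF mult_carrier_mat[OF transpose_carrier_mat[THEN iffD2, OF Z] Z]])
  define bad where "bad = {es \<in> sign_vectors n. \<exists>r<n. ip d (mixed_row n Z es r) (mixed_row n Z es r) > s2 * \<beta>}"
  have bad: "real (card bad) \<le> real (card (sign_vectors n)) * (\<delta> / 2)"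
    unfolding bad_def \<beta>_def by (rule row_norms_failure_count[OF op tr s2(1) de \<delta> npos])
  let ?R = "\<lambda>es. {rs \<in> row_samples m n. t < spec_norm (dev es rs)}"
  have good: "real (card (?R es)) \<le> real (card (row_samples m n)) * (\<delta> / 2)"
    if es: "es \<in> sign_vectors n - bad" for es
  proof -
    let ?x = "mixed_row n Z es"
    have esn: "es \<in> sign_vectors n" using es by simp
    have "\<exists>lam v. eigenbasis d (sample_deviation m n ?x rs) lam v" for rs
      by (rule spectral_theorem) (rule sample_deviation_symmetric)
    then obtain lam v where eig: "\<And>rs. eigenbasis d (sample_deviation m n ?x rs) (lam rs) (v rs)" by metis
    have gram: "(\<Sum>r<n. 1 * (?x r i * ?x r j)) = (\<Sum>q<n. real n * (Z $$ (q,i) * Z $$ (q,j)))" for i j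
      using mixed_row_gram[OF n esn] by (simp add: sum_distrib_left)
    have "(\<Sum>r<n. (ip d (?x r) y)\<^sup>2) = (\<Sum>q<n. real n * (ip d (\<lambda>i. Z $$ (q,i)) y)\<^sup>2)" for y
      using weighted_gram_quadratic_form[where c = "\<lambda>_. 1" and x = ?x, OF gram]
        weighted_gram_quadratic_form[where c = "\<lambda>_. real n" and x = "\<lambda>q i. Z $$ (q,i)", OF refl] by simp
    then have op': "(\<Sum>r<n. (ip d (?x r) y)\<^sup>2) \<le> real n * s2 * ip d y y" for y
      using op[of y] npos by (simp add: sum_distrib_left[symmetric] mult.assoc)
    have "(\<Sum>r<n. ip d (?x r) (?x r)) = (\<Sum>q<n. real n * ip d (\<lambda>i. Z $$ (q,i)) (\<lambda>i. Z $$ (q,i)))"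
      using weighted_gram_trace[where c = "\<lambda>_. 1" and x = ?x, OF gram]
        weighted_gram_trace[where c = "\<lambda>_. real n" and x = "\<lambda>q i. Z $$ (q,i)", OF refl] by simp
    then have tr': "(\<Sum>r<n. ip d (?x r) (?x r)) = real n * s2 * de"
      using tr by (simp add: sum_distrib_left[symmetric] mult.assoc)
    have rb: "ip d (?x r) (?x r) \<le> s2 * \<beta>" if "r < n" for r
    proof (rule ccontr)
      assume "\<not> ip d (?x r) (?x r) \<le> s2 * \<beta>"
      then have "es \<in> bad" using esn that by (auto simp: bad_def not_le)
      then show False using es by simp
    qed
    have "?R es \<subseteq> {rs \<in> row_samples m n. \<exists>k<d. \<bar>lam rs k\<bar> > real m * t}"
    proof (clarify, rule ccontr)
      fix rs assume rs: "rs \<in> row_samples m n" "t < spec_norm (dev es rs)"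
        and "\<not> (\<exists>k<d. \<bar>lam rs k\<bar> > real m * t)"
      then have "\<bar>lam rs k\<bar> \<le> real m * t" if "k < d" for k using that leI by blast
      then have le: "\<bar>lam rs k / real m\<bar> \<le> t" if "k < d" for k
        using that m by (simp add: pos_divide_le_eq mult.commute)
      have entry: "dev es rs $$ (i,j) = sample_deviation m n ?x rs i j / real m" if "i < d" "j < d" for i j
        unfolding dev_def by (rule srht_deviation_entry[OF n esn rs(1) Z that m(1)])
      \<comment> \<open>Dividing by \<open>m\<close> keeps the eigenvectors and scales the
        eigenvalues, which matches the threshold \<open>m * t\<close>.\<close>
      have "eigenbasis d (entries (dev es rs)) (\<lambda>k. lam rs k / real m) (v rs)"
      proof -
        have "mv d (entries (dev es rs)) (v rs k) i = lam rs k / real m * v rs k i" if "k < d" "i < d" for k i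
        proof -
          have "mv d (entries (dev es rs)) (v rs k) i = mv d (sample_deviation m n ?x rs) (v rs k) i / real m"
            unfolding mv_def sum_divide_distrib using that by (intro sum.cong) (auto simp: entry)
          then show ?thesis using mv_eigenvector[OF eig that] by simp
        qed
        then show ?thesis using eig[of rs] by (simp add: eigenbasis_def)
      qed
      then have "spec_norm (dev es rs) \<le> t"
        using t le by (intro spec_norm_le_eigenvalues[OF dev_carrier])
          (auto simp: entry sample_deviation_symmetric)
      then show False using rs by simp
    qed
    then have "real (card (?R es)) \<le> real (card {rs \<in> row_samples m n. \<exists>k<d. \<bar>lam rs k\<bar> > real m * t})"
      using finite_row_samples by (intro of_nat_mono card_mono) auto
    also have "\<dots> \<le> real (card (row_samples m n)) * (\<delta> / 2)"
      unfolding t_def using m_large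
      by (intro sampling_failure_count[OF npos m rb op' tr' eig de \<delta> \<rho> \<beta> s2]) (auto simp: \<beta>_def)
    finally show ?thesis .
  qed
  have "{\<omega> \<in> sign_vectors n \<times> row_samples m n. t < spec_norm (dev (fst \<omega>) (snd \<omega>))}
      \<subseteq> bad \<times> row_samples m n \<union> Sigma (sign_vectors n - bad) ?R"
    by auto
  then have "card {\<omega> \<in> sign_vectors n \<times> row_samples m n. t < spec_norm (dev (fst \<omega>) (snd \<omega>))}
      \<le> card (bad \<times> row_samples m n \<union> Sigma (sign_vectors n - bad) ?R)"
    using finite_sign_vectors finite_row_samples by (intro card_mono) (auto simp: bad_def)
  also have "\<dots> \<le> card (bad \<times> row_samples m n) + card (Sigma (sign_vectors n - bad) ?R)"
    by (rule card_Un_le)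
  finally have split: "real (card {\<omega> \<in> sign_vectors n \<times> row_samples m n. t < spec_norm (dev (fst \<omega>) (snd \<omega>))})
      \<le> real (card bad) * real (card (row_samples m n)) + real (card (Sigma (sign_vectors n - bad) ?R))"
    by (simp only: card_cartesian_product of_nat_le_iff of_nat_add[symmetric] of_nat_mult[symmetric])
  have "real (card (Sigma (sign_vectors n - bad) ?R)) = (\<Sum>es\<in>sign_vectors n - bad. real (card (?R es)))"
    using finite_sign_vectors finite_row_samples by (subst card_SigmaI) auto
  also have "\<dots> \<le> (\<Sum>es\<in>sign_vectors n - bad. real (card (row_samples m n)) * (\<delta> / 2))"
    by (intro sum_mono good)
  also have "\<dots> = real (card (sign_vectors n - bad)) * (real (card (row_samples m n)) * (\<delta> / 2))"
    by simp
  also have "\<dots> \<le> real (card (sign_vectors n)) * (real (card (row_samples m n)) * (\<delta> / 2))"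
    using \<delta> finite_sign_vectors by (intro mult_right_mono of_nat_mono card_mono) auto
  finally have "real (card (Sigma (sign_vectors n - bad) ?R))
      \<le> real (card (sign_vectors n)) * (real (card (row_samples m n)) * (\<delta> / 2))" .
  moreover have "real (card bad) * real (card (row_samples m n))
      \<le> real (card (sign_vectors n)) * (\<delta> / 2) * real (card (row_samples m n))"
    using bad by (intro mult_right_mono) auto
  ultimately have "real (card {\<omega> \<in> sign_vectors n \<times> row_samples m n. t < spec_norm (dev (fst \<omega>) (snd \<omega>))})
      \<le> real (card (sign_vectors n \<times> row_samples m n)) * \<delta>"
    using split by (simp add: card_cartesian_product algebra_simps)
  then show ?thesis by (simp add: t_def dev_def)
qed

theorem theorem5p1:
  fixes A \<Lambda> U D V :: "real mat" and n d m :: nat and \<nu> \<delta> \<rho> :: real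
  assumes A: "A \<in> carrier_mat n d" "A \<noteq> 0\<^sub>m n d"
    and nd: "d \<le> n" and pow2: "\<exists>k. n = 2 ^ k"
    and Lam: "\<Lambda> \<in> carrier_mat d d" "diagonal_mat \<Lambda>" "psd (\<Lambda> - 1\<^sub>m d)"
    and nu: "\<nu> > 0"
    and svd: "U \<in> carrier_mat n d" "transpose_mat U * U = 1\<^sub>m d"
             "V \<in> carrier_mat d d" "transpose_mat V * V = 1\<^sub>m d"
             "D \<in> carrier_mat d d" "diagonal_mat D" "\<forall>i<d. D $$ (i,i) \<ge> 0"
             "A * inv_sqrt_mat (transpose_mat A * A + \<nu>\<^sup>2 \<cdot>\<^sub>m \<Lambda>) = U * D * transpose_mat V"
    and delta: "0 < \<delta>" "\<delta> < 1"
    and rho: "\<rho> > 0"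
    and mn: "m \<le> n"
    and m_large: "real m \<ge>
       (let de = (frob_norm D)\<^sup>2 / (spec_norm D)\<^sup>2 in
        16 * ln (16 * de / \<delta>) * (sqrt de + sqrt (8 * ln (2 * real n / \<delta>)))\<^sup>2) / \<rho>"
  shows "measure_pmf.prob (srht_space m n)
     {\<omega>. let H = transpose_mat A * A + \<nu>\<^sup>2 \<cdot>\<^sub>m \<Lambda>;
            S = srht m n \<omega>;
            H\<^sub>S = transpose_mat A * transpose_mat S * S * A + \<nu>\<^sup>2 \<cdot>\<^sub>m \<Lambda>;
            C\<^sub>S = inv_sqrt_mat H * H\<^sub>S * inv_sqrt_mat H
        in spec_norm (C\<^sub>S - 1\<^sub>m d) \<le> max (sqrt \<rho>) \<rho>} \<ge> 1 - \<delta>"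
proof -
  define H where "H = transpose_mat A * A + \<nu>\<^sup>2 \<cdot>\<^sub>m \<Lambda>"
  define B where "B = inv_sqrt_mat H"
  define Z where "Z = A * B"
  define s2 where "s2 = (spec_norm D)\<^sup>2"
  define de where "de = (frob_norm D)\<^sup>2 / (spec_norm D)\<^sup>2"
  define t where "t = max (sqrt \<rho>) \<rho>"
  obtain K where n: "n = 2 ^ K" using pow2 by blast
  have npos: "0 < n" using n by simp
  have Q: "\<nu>\<^sup>2 \<cdot>\<^sub>m \<Lambda> \<in> carrier_mat d d" and AA: "transpose_mat A * A \<in> carrier_mat d d" using Lam A by simp_all
  have H: "H \<in> carrier_mat d d" using AA Q by (simp add: H_def)
  have Lam_off: "\<Lambda> $$ (i,j) = 0" if "i < d" "j < d" "i \<noteq> j" for i j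
    using Lam that by (auto simp: diagonal_mat_def)
  have AA_entry: "(transpose_mat A * A) $$ (i,j) = (\<Sum>q<n. A $$ (q,i) * A $$ (q,j))" if "i < d" "j < d" for i j
    using mult_mat_entry[of "transpose_mat A" d n A d i j] A that by simp
  have H_entry: "H $$ (i,j) = (\<Sum>q<n. A $$ (q,i) * A $$ (q,j)) + \<nu>\<^sup>2 * \<Lambda> $$ (i,j)" if "i < d" "j < d" for i j
  proof -
    have "H $$ (i,j) = (transpose_mat A * A) $$ (i,j) + (\<nu>\<^sup>2 \<cdot>\<^sub>m \<Lambda>) $$ (i,j)"
      unfolding H_def using Q that by (intro index_add_mat) auto
    then show ?thesis using AA_entry[OF that] Lam that by simp
  qed
  have symLam: "\<Lambda> $$ (i,j) = \<Lambda> $$ (j,i)" if "i < d" "j < d" for i j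
    using Lam_off[of i j] Lam_off[of j i] that by (cases "i = j") auto
  have Htr: "transpose_mat H = H"
    using H by (intro eq_matI) (auto simp: H_entry symLam mult.commute)
  have Lam_ge: "ip d y y \<le> ip d y (mv d (entries \<Lambda>) y)" for y
  proof -
    have LI: "\<Lambda> - 1\<^sub>m d \<in> carrier_mat d d" by (rule minus_carrier_mat) simp
    have "mv d (entries (\<Lambda> - 1\<^sub>m d)) y i = mv d (entries \<Lambda>) y i - y i" if "i < d" for i
    proof -
      have "mv d (entries (\<Lambda> - 1\<^sub>m d)) y i = (\<Sum>j<d. \<Lambda> $$ (i,j) * y j - (if j = i then y i else 0))"
        unfolding mv_def using that Lam(1) by (intro sum.cong) (auto simp: algebra_simps)
      then show ?thesis using that by (simp add: mv_def sum_subtractf)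
    qed
    then have "ip d y (mv d (entries (\<Lambda> - 1\<^sub>m d)) y) = ip d y (\<lambda>i. mv d (entries \<Lambda>) y i - y i)"
      by (intro ip_cong) auto
    then show ?thesis using psd_quadratic_form[OF Lam(3) LI, of y] by (simp add: ip_bilinear)
  qed
  have mvH: "ip d y (mv d (entries H) y)
      = (\<Sum>q<n. (ip d (\<lambda>i. A $$ (q,i)) y)\<^sup>2) + \<nu>\<^sup>2 * ip d y (mv d (entries \<Lambda>) y)" for y
  proof -
    have "mv d (entries H) y i = mv d (entries (transpose_mat A * A)) y i + \<nu>\<^sup>2 * mv d (entries \<Lambda>) y i"
      if "i < d" for i
      unfolding mv_def sum_distrib_left sum.distrib[symmetric] using that
      by (intro sum.cong) (auto simp: H_entry AA_entry algebra_simps simp del: index_mult_mat(1))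
    then have "ip d y (mv d (entries H) y)
        = ip d y (\<lambda>i. mv d (entries (transpose_mat A * A)) y i + \<nu>\<^sup>2 * mv d (entries \<Lambda>) y i)"
      by (intro ip_cong) auto
    also have "\<dots> = ip d y (mv d (entries (transpose_mat A * A)) y) + \<nu>\<^sup>2 * ip d y (mv d (entries \<Lambda>) y)"
      by (simp only: ip_add_right ip_scale_right)
    also have "ip d y (mv d (entries (transpose_mat A * A)) y) = (\<Sum>q<n. 1 * (ip d (\<lambda>i. A $$ (q,i)) y)\<^sup>2)"
      by (rule weighted_gram_quadratic_form[symmetric]) (simp add: AA_entry del: index_mult_mat(1))
    finally show ?thesis by simp
  qed
  have Hpd: "0 < ip d y (mv d (entries H) y)" if "0 < ip d y y" for y
  proof -
    have "0 < \<nu>\<^sup>2 * ip d y (mv d (entries \<Lambda>) y)" using nu that Lam_ge[of y] by simp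
    moreover have "0 \<le> (\<Sum>q<n. (ip d (\<lambda>i. A $$ (q,i)) y)\<^sup>2)" by (simp add: sum_nonneg)
    ultimately show ?thesis unfolding mvH by linarith
  qed
  note Bprops = inv_sqrt_mat_properties[OF H Htr Hpd, folded B_def]
  have B: "B \<in> carrier_mat d d" "psd B" "B * B * H = 1\<^sub>m d" using Bprops by blast+
  have Btr: "transpose_mat B = B" using B(2) by (simp add: psd_def)
  have BHB: "B * H * B = 1\<^sub>m d"
  proof -
    \<comment> \<open>\<open>B * H\<close> is a right inverse of the square matrix \<open>B\<close>,
      hence also a left inverse.\<close>
    have "B * (B * H) = 1\<^sub>m d" using B H by simp
    then show ?thesis using mat_mult_left_right_inverse[of B d "B * H"] B H by simp
  qed
  have Z: "Z \<in> carrier_mat n d" using A B by (simp add: Z_def)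
  have Zsvd: "Z = U * D * transpose_mat V" using svd(8) by (simp add: Z_def B_def H_def)
  have Doff: "D $$ (i,j) = 0" if "i < d" "j < d" "i \<noteq> j" for i j
    using svd(5,6) that by (auto simp: diagonal_mat_def)
  have onV: "orthonormal d d (\<lambda>k i. V $$ (i,k))"
    unfolding orthonormal_def
  proof (intro allI impI)
    fix i j assume ij: "i < d" "j < d"
    have "ip d (\<lambda>k. V $$ (k,i)) (\<lambda>k. V $$ (k,j)) = (transpose_mat V * V) $$ (i,j)"
      using mult_mat_entry[of "transpose_mat V" d d V d i j] svd(3) ij by (simp add: ip_def)
    then show "ip d (\<lambda>k. V $$ (k,i)) (\<lambda>k. V $$ (k,j)) = (if i = j then 1 else 0)" using ij svd(4) by simp
  qed
  \<comment> \<open>Orthonormal columns of \<open>U\<close> drop out: the Gram matrix of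
    \<open>Z\<close> is \<open>V D\<^sup>2 V\<^sup>T\<close>.\<close>
  have Zgram: "(\<Sum>q<n. 1 * (Z $$ (q,i) * Z $$ (q,j))) = (\<Sum>k<d. (D $$ (k,k))\<^sup>2 * (V $$ (i,k) * V $$ (j,k)))"
    if ij: "i < d" "j < d" for i j
  proof -
    define W where "W = D * transpose_mat V"
    have W: "W \<in> carrier_mat d d" using svd by (simp add: W_def)
    have ZUW: "Z = U * W" using Zsvd svd by (simp add: W_def)
    have "transpose_mat Z * Z = transpose_mat W * transpose_mat U * (U * W)"
      unfolding ZUW using transpose_mult[OF svd(1) W] by simp
    also have "\<dots> = transpose_mat W * (transpose_mat U * (U * W))"
      using W svd by (intro assoc_mult_mat[of _ d d _ n _ d]) auto
    also have "transpose_mat U * (U * W) = transpose_mat U * U * W"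
      using W svd by (intro assoc_mult_mat[symmetric, of _ d n _ d _ d]) auto
    also have "\<dots> = W" using svd W by simp
    finally have ZZ: "transpose_mat Z * Z = transpose_mat W * W" .
    have W_entry: "W $$ (k,j) = D $$ (k,k) * V $$ (j,k)" if "k < d" "j < d" for k j
    proof -
      have "W $$ (k,j) = (\<Sum>l<d. D $$ (k,l) * transpose_mat V $$ (l,j))"
        unfolding W_def using svd that by (intro mult_mat_entry) auto
      also have "\<dots> = (\<Sum>l<d. if l = k then D $$ (k,k) * V $$ (j,k) else 0)"
        using that svd(3) Doff by (intro sum.cong) auto
      finally show ?thesis using that by simp
    qed
    have "(\<Sum>q<n. Z $$ (q,i) * Z $$ (q,j)) = (transpose_mat Z * Z) $$ (i,j)"
      using mult_mat_entry[of "transpose_mat Z" d n Z d i j] Z ij by simp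
    also have "\<dots> = (\<Sum>k<d. W $$ (k,i) * W $$ (k,j))"
      unfolding ZZ using mult_mat_entry[of "transpose_mat W" d d W d i j] W ij by simp
    also have "\<dots> = (\<Sum>k<d. (D $$ (k,k))\<^sup>2 * (V $$ (i,k) * V $$ (j,k)))"
      using ij by (intro sum.cong) (auto simp: W_entry power2_eq_square)
    finally show ?thesis by simp
  qed
  have Zquad: "(\<Sum>q<n. (ip d (\<lambda>i. Z $$ (q,i)) y)\<^sup>2) = (\<Sum>k<d. (D $$ (k,k))\<^sup>2 * (ip d (\<lambda>i. V $$ (i,k)) y)\<^sup>2)" for y
    using weighted_gram_quadratic_form[where c = "\<lambda>_. 1" and x = "\<lambda>q i. Z $$ (q,i)", OF Zgram]
      weighted_gram_quadratic_form[where c = "\<lambda>k. (D $$ (k,k))\<^sup>2" and x = "\<lambda>k i. V $$ (i,k)", OF refl]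
    by simp
  have tr: "(\<Sum>q<n. ip d (\<lambda>i. Z $$ (q,i)) (\<lambda>i. Z $$ (q,i))) = (frob_norm D)\<^sup>2"
  proof -
    have "(\<Sum>q<n. ip d (\<lambda>i. Z $$ (q,i)) (\<lambda>i. Z $$ (q,i)))
        = (\<Sum>k<d. (D $$ (k,k))\<^sup>2 * ip d (\<lambda>i. V $$ (i,k)) (\<lambda>i. V $$ (i,k)))"
      using weighted_gram_trace[where c = "\<lambda>_. 1" and x = "\<lambda>q i. Z $$ (q,i)", OF Zgram]
        weighted_gram_trace[where c = "\<lambda>k. (D $$ (k,k))\<^sup>2" and x = "\<lambda>k i. V $$ (i,k)", OF refl]
      by simp
    also have "\<dots> = (frob_norm D)\<^sup>2"
      unfolding frob_norm_diagonal[OF svd(5,6)] using onV by (intro sum.cong) (auto simp: orthonormal_def)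
    finally show ?thesis .
  qed
  have op: "(\<Sum>q<n. (ip d (\<lambda>i. Z $$ (q,i)) y)\<^sup>2) \<le> s2 * ip d y y" for y
  proof -
    have "(\<Sum>k<d. (D $$ (k,k))\<^sup>2 * (ip d (\<lambda>i. V $$ (i,k)) y)\<^sup>2) \<le> (\<Sum>k<d. s2 * (ip d (\<lambda>i. V $$ (i,k)) y)\<^sup>2)"
      unfolding s2_def by (intro sum_mono mult_right_mono diagonal_le_spec_norm[OF svd(5,6)]) auto
    then show ?thesis unfolding Zquad using parseval_norm[OF onV, of y]
      by (simp add: sum_distrib_left[symmetric] ip_commute)
  qed
  \<comment> \<open>With \<open>z = B y\<close>, the squared norm of \<open>Z y\<close> is that of
    \<open>A z\<close>, which is at most \<open>ip d z (H z)\<close> as the regulariser is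
    nonnegative; \<open>B * H * B = 1\<close> turns this into \<open>ip d y y\<close>.\<close>
  have contraction: "(\<Sum>q<n. (ip d (\<lambda>i. Z $$ (q,i)) y)\<^sup>2) \<le> ip d y y" for y
  proof -
    define z where "z = mv d (entries B) y"
    have "ip d (\<lambda>i. Z $$ (q,i)) y = ip d (\<lambda>i. A $$ (q,i)) z" if "q < n" for q
    proof -
      have "ip d (\<lambda>i. Z $$ (q,i)) y = (\<Sum>i<d. \<Sum>k<d. A $$ (q,k) * (B $$ (k,i) * y i))"
        using mult_mat_entry[OF A(1) B(1) that]
        by (simp add: ip_def Z_def sum_distrib_right mult.assoc del: index_mult_mat(1))
      also have "\<dots> = (\<Sum>k<d. \<Sum>i<d. A $$ (q,k) * (B $$ (k,i) * y i))" by (rule sum.swap)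
      finally show ?thesis by (simp add: ip_def z_def mv_def sum_distrib_left)
    qed
    then have "(\<Sum>q<n. (ip d (\<lambda>i. Z $$ (q,i)) y)\<^sup>2) = (\<Sum>q<n. (ip d (\<lambda>i. A $$ (q,i)) z)\<^sup>2)" by simp
    also have "\<dots> \<le> ip d z (mv d (entries H) z)"
    proof -
      have "0 \<le> \<nu>\<^sup>2 * ip d z (mv d (entries \<Lambda>) z)"
        using Lam_ge[of z] ip_self_nonneg[of d z] by simp
      then show ?thesis unfolding mvH by linarith
    qed
    also have "\<dots> = ip d y (mv d (entries B) (mv d (entries H) z))"
    proof -
      have "entries B i j = entries B j i" if "i < d" "j < d" for i j
        by (rule symmetric_entries[OF B(1) Btr that])
      from ip_mv_symmetric[OF this, where x = y and y = "mv d (entries H) z"] show ?thesis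
        by (simp add: z_def)
    qed
    also have "\<dots> = ip d y y"
    proof (intro ip_cong)
      fix i assume i: "i < d"
      have BH: "B * H \<in> carrier_mat d d" using B H by simp
      have "mv d (entries B) (mv d (entries H) z) i = mv d (entries (B * H)) (mv d (entries B) y) i"
        unfolding z_def by (rule mv_mult_mat[OF B(1) H i, symmetric])
      also have "\<dots> = mv d (entries (B * H * B)) y i" by (rule mv_mult_mat[OF BH B(1) i, symmetric])
      also have "\<dots> = (\<Sum>j<d. if j = i then y i else 0)"
        unfolding BHB mv_def using i by (intro sum.cong) auto
      finally show "mv d (entries B) (mv d (entries H) z) i = y i" using i by simp
    qed simp
    finally show ?thesis .
  qed
  \<comment> \<open>The contraction is tested on the \<open>k\<close>-th right singular
    vector.\<close>
  have "(D $$ (k,k))\<^sup>2 \<le> 1" if k: "k < d" for k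
  proof -
    have "(\<Sum>l<d. (D $$ (l,l))\<^sup>2 * (ip d (\<lambda>i. V $$ (i,l)) (\<lambda>i. V $$ (i,k)))\<^sup>2)
        = (\<Sum>l<d. if l = k then (D $$ (k,k))\<^sup>2 else 0)"
      using onV k by (intro sum.cong) (auto simp: orthonormal_def)
    then show ?thesis using contraction[of "\<lambda>i. V $$ (i,k)"] onV k
      unfolding Zquad by (simp add: orthonormal_def)
  qed
  then have s2_le: "s2 \<le> 1" unfolding s2_def by (rule spec_norm_diagonal_le_1[OF svd(5,6)])
  \<comment> \<open>\<open>A \<noteq> 0\<close> enters here: if \<open>D\<close> vanished so would
    \<open>Z\<close>, and \<open>Z * (B * H)\<close> recovers \<open>A\<close>.\<close>
  have s2_pos: "0 < s2"
  proof (rule ccontr)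
    assume "\<not> 0 < s2"
    then have "D $$ (k,k) = 0" if "k < d" for k
      using diagonal_le_spec_norm[OF svd(5,6) that] by (simp add: s2_def)
    then have "D $$ (i,j) = 0" if "i < d" "j < d" for i j
      using Doff[OF that] that by (cases "i = j") auto
    then have "D = 0\<^sub>m d d" using svd(5) by (intro eq_matI) auto
    then have "Z = 0\<^sub>m n d" using Zsvd svd by simp
    moreover have "Z * (B * H) = A"
    proof -
      have "Z * (B * H) = A * (B * (B * H))" unfolding Z_def
        using A B H by (intro assoc_mult_mat[of _ n d _ d _ d]) auto
      also have "B * (B * H) = 1\<^sub>m d" using B H by simp
      finally show ?thesis using A by simp
    qed
    ultimately have "A = 0\<^sub>m n d" using B H by simp
    then show False using A by simp
  qed
  have tr': "(\<Sum>q<n. ip d (\<lambda>i. Z $$ (q,i)) (\<lambda>i. Z $$ (q,i))) = s2 * de"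
    using tr s2_pos by (simp add: s2_def de_def)
  have de: "1 \<le> de"
    using spec_norm_le_frob_norm[OF svd(5,6)] s2_pos by (simp add: de_def s2_def)
  have m_large': "16 * ln (16 * de / \<delta>) * (sqrt de + sqrt (8 * ln (2 * real n / \<delta>)))\<^sup>2 / \<rho> \<le> real m"
    using m_large by (simp add: Let_def de_def)
  \<comment> \<open>The lower bound on \<open>m\<close> is strictly positive, since
    \<open>de \<ge> 1\<close> and \<open>\<delta> < 1\<close> make the logarithm positive.\<close>
  have m: "0 < m"
  proof -
    have "16 \<le> 16 * de / \<delta>" using de delta by (simp add: field_simps)
    then have l: "0 < ln (16 * de / \<delta>)" by (intro ln_gt_zero) simp
    have "1 * \<delta> \<le> 2 * real n" using npos delta by simp
    then have "1 \<le> 2 * real n / \<delta>" using delta by (simp add: field_simps)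
    then have "0 < (sqrt de + sqrt (8 * ln (2 * real n / \<delta>)))\<^sup>2"
      using de by (intro zero_less_power add_pos_nonneg) auto
    then have "0 < 16 * ln (16 * de / \<delta>) * (sqrt de + sqrt (8 * ln (2 * real n / \<delta>)))\<^sup>2 / \<rho>"
      using l rho by simp
    then show ?thesis using m_large' by linarith
  qed
  let ?\<Omega> = "sign_vectors n \<times> row_samples m n"
  let ?dev = "\<lambda>\<omega>. transpose_mat (srht m n \<omega> * Z) * (srht m n \<omega> * Z) - transpose_mat Z * Z"
  have dev: "B * (transpose_mat A * transpose_mat (srht m n \<omega>) * srht m n \<omega> * A + \<nu>\<^sup>2 \<cdot>\<^sub>m \<Lambda>) * B - 1\<^sub>m d
      = ?dev \<omega>" for \<omega>
    unfolding Z_def by (rule preconditioned_deviation[OF A(1) Q B(1) Btr BHB[unfolded H_def] srht_carrier])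
  have fin: "finite ?\<Omega>" and ne: "?\<Omega> \<noteq> {}"
    using finite_sign_vectors finite_row_samples row_samples_nonempty[OF mn] sign_vectors_nonempty by auto
  then have cpos: "0 < real (card ?\<Omega>)" by (simp add: card_gt_0_iff)
  have fail: "real (card {\<omega> \<in> ?\<Omega>. t < spec_norm (?dev \<omega>)}) \<le> real (card ?\<Omega>) * \<delta>"
    unfolding t_def by (rule srht_failure_count[OF n Z m mn op tr' s2_pos s2_le de delta rho m_large'])
  have "card ?\<Omega> = card (?\<Omega> \<inter> {\<omega>. spec_norm (?dev \<omega>) \<le> t} \<union> {\<omega> \<in> ?\<Omega>. t < spec_norm (?dev \<omega>)})"
    by (rule arg_cong[of _ _ card]) (auto simp: not_less)
  also have "\<dots> = card (?\<Omega> \<inter> {\<omega>. spec_norm (?dev \<omega>) \<le> t}) + card {\<omega> \<in> ?\<Omega>. t < spec_norm (?dev \<omega>)}"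
    using fin by (intro card_Un_disjoint) auto
  finally have "real (card ?\<Omega>) * (1 - \<delta>) \<le> real (card (?\<Omega> \<inter> {\<omega>. spec_norm (?dev \<omega>) \<le> t}))"
    using fail by (simp add: algebra_simps)
  then have "1 - \<delta> \<le> real (card (?\<Omega> \<inter> {\<omega>. spec_norm (?dev \<omega>) \<le> t})) / real (card ?\<Omega>)"
    using cpos by (simp add: pos_le_divide_eq mult.commute)
  also have "\<dots> = measure_pmf.prob (srht_space m n) {\<omega>. spec_norm (?dev \<omega>) \<le> t}"
    unfolding srht_space_def using ne fin by (rule measure_pmf_of_set[symmetric])
  finally show ?thesis
    unfolding Let_def H_def[symmetric] B_def[symmetric] dev t_def[symmetric] .
qed

end
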